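(* Let $\mathbf A$ be an irreducible, symmetrizable, non-spherical, non-affine generalized Cartan matrix, $G=G_{\mathbb R}(\mathbf A)$, and $\overline{\mathcal X}_G=\overline G/\overline K$ the reduced Kac–Moody symmetric space. Either the causal pre-order $\preceq$ on $\overline{\mathcal X}_G$ is the trivial pre-order, i.e. any point in $\overline{\mathcal X}_G$ causally precedes any other point, or the causal pre-order is a partial order.
   Context: A generalized Cartan matrix is $\mathbf A=(a_{ij})\in M_n(\mathbb Z)$ with $a_{ii}=2$, $a_{ij}\le0$ for $i\ne j$, $a_{ij}=0\iff a_{ji}=0$; irreducible: the graph on $\{1,\dots,n\}$ with edges $\{i,j\}$ ($i\neq j$, $a_{ij}a_{ji}\neq0$) is connected; symmetrizable: $\mathbf A=DB$ with $D$ positive diagonal, $B$ real symmetric; spherical: $B$ positive definite; affine: $B$ positive semidefinite of corank 1. $G=G_{\mathbb R}(\mathbf A)$ is the simply connected centred split real Kac–Moody group: Tits' split Kac–Moody group over $\mathbb R$ for the root datum with cocharacter lattice $\bigoplus_i\mathbb Z\alpha_i^\vee$ and $\alpha_j(\alpha_i^\vee)=a_{ij}$; it is generated by the images of canonical homomorphisms $\varphi_i:\mathrm{SL}_2(\mathbb R)\to G$ and carries the Kac–Peterson topology, the finest group topology making all $\varphi_i$ continuous. $T\cong(\mathbb R^\times)^n$ consists of the elements $\prod_i\varphi_i(\mathrm{diag}(t_i,t_i^{-1}))$. $C<T$ is the (central) subgroup of those for which there is $z\in\mathbb C^n$ with $t_i=e^{z_i}$ and $\sum_iz_ia_{ij}=0$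 for all $j$; $\overline G:=G/C$. $\theta$ is the unique involutive automorphism with $\theta(\varphi_i(g))=\varphi_i((g^{-1})^T)$; it induces $\overline\theta$ on $\overline G$; $\overline K=\overline G^{\overline\theta}$. $\overline G/\overline K$ carries the quotient topology and the symmetric space multiplication $\mu(g\overline K,h\overline K)=g\overline\theta(g)^{-1}\overline\theta(h)\overline K$. Let $\mathfrak a=\bigoplus_i\mathbb R\alpha_i^\vee$, $\overline{\mathfrak a}=\mathfrak a/\{v:\alpha_j(v)=0\ \forall j\}$; the Weyl group $W=N_G(T)/T$ (generated by the classes $s_i$ of $\varphi_i\begin{pmatrix}0&1\\-1&0\end{pmatrix}$) acts on $\overline{\mathfrak a}$ by $s_i(v)=v-\alpha_i(v)\alpha_i^\vee$; $\exp:\overline{\mathfrak a}\to\overline G$ is induced by $\sum x_i\alpha_i^\vee\mapsto\prod_i\varphi_i(\mathrm{diag}(e^{x_i},e^{-x_i}))$. The reduced Tits cone is $\overline{\mathcal C}=\bigcup_{w\in W}w\{v:\alpha_i(v)\ge0\ \forall i\}$ with interior $\overline{\mathcal C}^o$. The positive causal structure is $\overline C^+_x=\{g\exp(X)\overline K:g\in\overline G,\ g\overline K=x,\ X\in\overline{\mathcal C}^o\}$, $x\in\overline{\mathcal X}_G$. A continuous curve $\gamma:[S,T_0]\to\overline{\mathcal X}_G$ with $0<S<T_0<\infty$ is causal if for every $t\in[S,T_0)$ there is $\epsilon>0$ with $\gamma((t,t+\epsilon))\subset\overline C^+_{\gamma(t)}$. It is a piecewise geodesic causal curve if moreover there is a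 partition $S=t_0<\dots<t_N=T_0$ such that each $\gamma|_{[t_i,t_{i+1}]}$ is a geodesic segment, i.e. the restriction (up to affine reparametrization) of a map $t\mapsto g\exp(tX)\overline K$ with $g\in\overline G$, $0\neq X\in\overline{\mathfrak a}$. Write $x\prec y$ if there is a piecewise geodesic causal curve $\gamma:[S,T_0]\to\overline{\mathcal X}_G$ with $\gamma(S)=x$, $\gamma(T_0)=y$, and $x\preceq y$ ("$x$ causally precedes $y$") if $x\prec y$ or $x=y$. This reflexive and transitive relation is the causal pre-order. *)

theory Defs
  imports "HOL-Analysis.Analysis" "HOL-Algebra.Coset"
begin

section \<open>Generalized Cartan matrices\<close>

definition gcm :: "int^'n^'n \<Rightarrow> bool" where
  "gcm A \<longleftrightarrow> (\<forall>i. A$i$i = 2) \<and> (\<forall>i j. i \<noteq> j \<longrightarrow> A$i$j \<le> 0) \<and>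
             (\<forall>i j. A$i$j = 0 \<longleftrightarrow> A$j$i = 0)"

definition gcm_irreducible :: "int^'n^'n \<Rightarrow> bool" where
  "gcm_irreducible A \<longleftrightarrow>
     (\<forall>i j. (i, j) \<in> {(k, l). k \<noteq> l \<and> A$k$l * A$l$k \<noteq> 0}\<^sup>*)"

definition symmetrization :: "int^'n^'n \<Rightarrow> real^'n^'n \<Rightarrow> real^'n^'n \<Rightarrow> bool" where
  "symmetrization A D B \<longleftrightarrow>
     (\<forall>i. D$i$i > 0) \<and> (\<forall>i j. i \<noteq> j \<longrightarrow> D$i$j = 0) \<and> transpose B = B \<and>
     (\<chi> i j. real_of_int (A$i$j)) = D ** B"

definition symmetrizable :: "int^'n^'n \<Rightarrow> bool" where
  "symmetrizable A \<longleftrightarrow> (\<exists>D B. symmetrization A D B)"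

definition spherical :: "int^'n^'n \<Rightarrow> bool" where
  "spherical A \<longleftrightarrow> (\<exists>D B. symmetrization A D B \<and> (\<forall>x. x \<noteq> 0 \<longrightarrow> x \<bullet> (B *v x) > 0))"

definition affine_type :: "int^'n^'n \<Rightarrow> bool" where
  "affine_type A \<longleftrightarrow>
     (\<exists>D B. symmetrization A D B \<and> (\<forall>x. x \<bullet> (B *v x) \<ge> 0) \<and> rank B + 1 = CARD('n))"


section \<open>Roots and the Weyl group\<close>

text \<open>The root lattice is the free abelian group on the simple roots, modelled by \<open>int^'n\<close>
  (\<open>\<alpha>\<^sub>i = axis i 1\<close>), and \<open>\<aa> = \<Oplus>\<^sub>i \<real>\<alpha>\<^sub>i\<^sup>\<or>\<close> is modelled by \<open>real^'n\<close> (\<open>\<alpha>\<^sub>i\<^sup>\<or> = axis i 1\<close>).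
  The pairing is \<open>\<alpha>\<^sub>j(\<alpha>\<^sub>i\<^sup>\<or>) = A$i$j\<close>.\<close>

definition simple_root :: "int^'n^'n \<Rightarrow> 'n \<Rightarrow> real^'n \<Rightarrow> real" where
  "simple_root A j v = (\<Sum>i\<in>UNIV. v$i * of_int (A$i$j))"

definition refl_a :: "int^'n^'n \<Rightarrow> 'n \<Rightarrow> real^'n \<Rightarrow> real^'n" where
  "refl_a A i v = v - axis i (simple_root A i v)"

definition refl_root :: "int^'n^'n \<Rightarrow> 'n \<Rightarrow> int^'n \<Rightarrow> int^'n" where
  "refl_root A i \<beta> = \<beta> - axis i (\<Sum>j\<in>UNIV. \<beta>$j * A$i$j)"

text \<open>All compositions of the given maps; for a family of involutions this is the group they
  generate.\<close>

definition generated_maps :: "('n \<Rightarrow> 'a \<Rightarrow> 'a) \<Rightarrow> ('a \<Rightarrow> 'a) set" where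
  "generated_maps s = range (foldr s)"

definition real_roots :: "int^'n^'n \<Rightarrow> (int^'n) set" where
  "real_roots A = {w (axis i 1) | w i. w \<in> generated_maps (refl_root A)}"

definition prenilpotent :: "int^'n^'n \<Rightarrow> int^'n \<Rightarrow> int^'n \<Rightarrow> bool" where
  "prenilpotent A \<alpha> \<beta> \<longleftrightarrow> \<alpha> \<in> real_roots A \<and> \<beta> \<in> real_roots A \<and>
     (\<exists>w \<in> generated_maps (refl_root A). \<forall>i. w \<alpha> $ i \<ge> 0 \<and> w \<beta> $ i \<ge> 0) \<and>
     (\<exists>w \<in> generated_maps (refl_root A). \<forall>i. w \<alpha> $ i \<le> 0 \<and> w \<beta> $ i \<le> 0)"

definition root_interval :: "int^'n^'n \<Rightarrow> int^'n \<Rightarrow> int^'n \<Rightarrow> (int^'n) set" where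
  "root_interval A \<alpha> \<beta> = {\<gamma> \<in> real_roots A. \<exists>p q::nat. \<gamma> = int p *s \<alpha> + int q *s \<beta>}"


section \<open>The real Kac--Moody algebra\<close>

text \<open>The Lie algebra of the root datum is presented by the Chevalley generators and the Serre
  relations; \<open>lie_eq A\<close> is equality of Lie words in the presented algebra.\<close>

datatype 'n lie_term =
    GenE 'n | GenF 'n | GenH 'n
  | LZero | LAdd "'n lie_term" "'n lie_term" | LScale real "'n lie_term"
  | LBr "'n lie_term" "'n lie_term"

inductive lie_eq :: "int^'n^'n \<Rightarrow> 'n lie_term \<Rightarrow> 'n lie_term \<Rightarrow> bool" for A where
  lie_refl: "lie_eq A x x"
| lie_sym: "lie_eq A x y \<Longrightarrow> lie_eq A y x"
| lie_trans: "lie_eq A x y \<Longrightarrow> lie_eq A y z \<Longrightarrow> lie_eq A x z"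
| lie_add_cong: "lie_eq A x x' \<Longrightarrow> lie_eq A y y' \<Longrightarrow> lie_eq A (LAdd x y) (LAdd x' y')"
| lie_scale_cong: "lie_eq A x x' \<Longrightarrow> lie_eq A (LScale c x) (LScale c x')"
| lie_br_cong: "lie_eq A x x' \<Longrightarrow> lie_eq A y y' \<Longrightarrow> lie_eq A (LBr x y) (LBr x' y')"
| lie_add_assoc: "lie_eq A (LAdd (LAdd x y) z) (LAdd x (LAdd y z))"
| lie_add_comm: "lie_eq A (LAdd x y) (LAdd y x)"
| lie_add_zero: "lie_eq A (LAdd x LZero) x"
| lie_add_neg: "lie_eq A (LAdd x (LScale (-1) x)) LZero"
| lie_scale_add: "lie_eq A (LScale c (LAdd x y)) (LAdd (LScale c x) (LScale c y))"
| lie_add_scale: "lie_eq A (LScale (c + d) x) (LAdd (LScale c x) (LScale d x))"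
| lie_scale_scale: "lie_eq A (LScale c (LScale d x)) (LScale (c * d) x)"
| lie_scale_one: "lie_eq A (LScale 1 x) x"
| lie_br_add_left: "lie_eq A (LBr (LAdd x y) z) (LAdd (LBr x z) (LBr y z))"
| lie_br_add_right: "lie_eq A (LBr z (LAdd x y)) (LAdd (LBr z x) (LBr z y))"
| lie_br_scale_left: "lie_eq A (LBr (LScale c x) y) (LScale c (LBr x y))"
| lie_br_scale_right: "lie_eq A (LBr x (LScale c y)) (LScale c (LBr x y))"
| lie_br_self: "lie_eq A (LBr x x) LZero"
| lie_jacobi: "lie_eq A (LAdd (LBr x (LBr y z)) (LAdd (LBr y (LBr z x)) (LBr z (LBr x y)))) LZero"
| lie_rel_hh: "lie_eq A (LBr (GenH i) (GenH j)) LZero"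
| lie_rel_he: "lie_eq A (LBr (GenH i) (GenE j)) (LScale (of_int (A$i$j)) (GenE j))"
| lie_rel_hf: "lie_eq A (LBr (GenH i) (GenF j)) (LScale (- of_int (A$i$j)) (GenF j))"
| lie_rel_ef: "lie_eq A (LBr (GenE i) (GenF i)) (GenH i)"
| lie_rel_ef_ne: "i \<noteq> j \<Longrightarrow> lie_eq A (LBr (GenE i) (GenF j)) LZero"
| lie_serre_e: "i \<noteq> j \<Longrightarrow> lie_eq A ((LBr (GenE i) ^^ nat (1 - A$i$j)) (GenE j)) LZero"
| lie_serre_f: "i \<noteq> j \<Longrightarrow> lie_eq A ((LBr (GenF i) ^^ nat (1 - A$i$j)) (GenF j)) LZero"

text \<open>\<open>root_space A \<alpha> x\<close>: the class of \<open>x\<close> is homogeneous of degree \<open>\<alpha>\<close> for the grading of the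
  algebra by the root lattice.\<close>

inductive root_space :: "int^'n^'n \<Rightarrow> int^'n \<Rightarrow> 'n lie_term \<Rightarrow> bool" for A where
  "root_space A (axis i 1) (GenE i)"
| "root_space A (- axis i 1) (GenF i)"
| "root_space A 0 (GenH i)"
| "root_space A \<alpha> LZero"
| "root_space A \<alpha> x \<Longrightarrow> root_space A \<alpha> y \<Longrightarrow> root_space A \<alpha> (LAdd x y)"
| "root_space A \<alpha> x \<Longrightarrow> root_space A \<alpha> (LScale c x)"
| "root_space A \<alpha> x \<Longrightarrow> root_space A \<beta> y \<Longrightarrow> root_space A (\<alpha> + \<beta>) (LBr x y)"
| "root_space A \<alpha> x \<Longrightarrow> lie_eq A x y \<Longrightarrow> root_space A \<alpha> y"

primrec lie_sum :: "(nat \<Rightarrow> 'n lie_term) \<Rightarrow> nat \<Rightarrow> 'n lie_term" where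
  "lie_sum f 0 = LZero"
| "lie_sum f (Suc k) = LAdd (lie_sum f k) (f k)"

text \<open>The exponential of the (locally nilpotent) operator \<open>ad x\<close>: the series stops at the first
  power of \<open>ad x\<close> that annihilates \<open>y\<close>.\<close>

definition exp_ad :: "int^'n^'n \<Rightarrow> 'n lie_term \<Rightarrow> 'n lie_term \<Rightarrow> 'n lie_term" where
  "exp_ad A x y = lie_sum (\<lambda>k. LScale (1 / fact k) ((LBr x ^^ k) y))
                          (LEAST N. lie_eq A ((LBr x ^^ N) y) LZero)"

definition refl_lie :: "int^'n^'n \<Rightarrow> 'n \<Rightarrow> 'n lie_term \<Rightarrow> 'n lie_term" where
  "refl_lie A i y =
     exp_ad A (GenE i) (exp_ad A (LScale (-1) (GenF i)) (exp_ad A (GenE i) y))"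


section \<open>The simply connected centred split real Kac--Moody group\<close>

text \<open>Tits' presentation over the field \<open>\<real>\<close>. The generators are the elements \<open>x(X)\<close> of the root
  groups, where \<open>X\<close> lies in the root space of a real root (letter \<open>Root X\<close>), and the elements
  \<open>\<Prod>\<^sub>i t\<^sub>i^\<alpha>\<^sub>i\<^sup>\<or>\<close> of the torus \<open>(\<real> - {0})^n\<close> (letter \<open>Tor t\<close>). Since the inverse of a generator is
  again a generator, the group is presented as a monoid.

  The rule \<open>km_steinberg\<close> says that for a prenilpotent pair \<open>\<alpha>, \<beta>\<close> the root groups with root in
  \<open>\<theta>(\<alpha>,\<beta>) = (\<nat>\<alpha> + \<nat>\<beta>) \<inter> \<Phi>\<^sup>r\<^sup>e\<close> generate the unipotent group whose Lie algebra is the sum of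
  the corresponding root spaces; this group acts faithfully on the Kac--Moody algebra by \<open>exp ad\<close>,
  so its relations are those that hold between these automorphisms. Together with \<open>\<alpha> = \<beta>\<close>, this
  makes the Steinberg group, i.e. the direct limit of these unipotent groups.\<close>

datatype ('n::finite) km_letter = Tor "real^'n" | Root "'n lie_term"

definition valid_letter :: "int^'n^'n \<Rightarrow> 'n km_letter \<Rightarrow> bool" where
  "valid_letter A l = (case l of
       Tor t \<Rightarrow> \<forall>i. t$i \<noteq> 0
     | Root x \<Rightarrow> \<exists>\<alpha> \<in> real_roots A. root_space A \<alpha> x)"

text \<open>\<open>\<alpha>\<^sub>j(t)\<close> for a torus element \<open>t\<close>, and the action of \<open>s\<^sub>i\<close> on the torus.\<close>

definition char_tor :: "int^'n^'n \<Rightarrow> 'n \<Rightarrow> real^'n \<Rightarrow> real" where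
  "char_tor A j t = (\<Prod>i\<in>UNIV. t$i powi A$i$j)"

definition refl_tor :: "int^'n^'n \<Rightarrow> 'n \<Rightarrow> real^'n \<Rightarrow> real^'n" where
  "refl_tor A i t = (\<chi> j. if j = i then t$j / char_tor A i t else t$j)"

text \<open>\<open>coroot_tor i r\<close> is \<open>r^\<alpha>\<^sub>i\<^sup>\<or>\<close>, and \<open>s_word i r\<close> represents the image of the matrix with
  rows \<open>(0, r)\<close> and \<open>(-1/r, 0)\<close> under \<open>\<phi>\<^sub>i\<close>.\<close>

definition coroot_tor :: "'n \<Rightarrow> real \<Rightarrow> real^'n" where
  "coroot_tor i r = (\<chi> j. if j = i then r else 1)"

definition s_word :: "'n \<Rightarrow> real \<Rightarrow> 'n::finite km_letter list" where
  "s_word i r = [Root (LScale r (GenE i)), Root (LScale (- 1 / r) (GenF i)),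
                 Root (LScale r (GenE i))]"

inductive km_eq :: "int^'n^'n \<Rightarrow> 'n km_letter list \<Rightarrow> 'n km_letter list \<Rightarrow> bool" for A where
  km_refl: "km_eq A u u"
| km_sym: "km_eq A u v \<Longrightarrow> km_eq A v u"
| km_trans: "km_eq A u v \<Longrightarrow> km_eq A v w \<Longrightarrow> km_eq A u w"
| km_cong: "km_eq A u u' \<Longrightarrow> km_eq A v v' \<Longrightarrow> km_eq A (u @ v) (u' @ v')"
| km_steinberg:
    "prenilpotent A \<alpha> \<beta> \<Longrightarrow>
     \<forall>x \<in> set xs \<union> set ys. \<exists>\<gamma> \<in> root_interval A \<alpha> \<beta>. root_space A \<gamma> x \<Longrightarrow>
     \<forall>z. lie_eq A (foldr (exp_ad A) xs z) (foldr (exp_ad A) ys z) \<Longrightarrow>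
     km_eq A (map Root xs) (map Root ys)"
| km_tor_one: "km_eq A [Tor 1] []"
| km_tor_mult: "valid_letter A (Tor s) \<Longrightarrow> valid_letter A (Tor t) \<Longrightarrow>
     km_eq A [Tor s, Tor t] [Tor (s * t)]"
| km_tor_root: "valid_letter A (Tor t) \<Longrightarrow>
     km_eq A [Tor t, Root (LScale c (GenE i))] [Root (LScale (char_tor A i t * c) (GenE i)), Tor t]"
| km_refl_tor: "valid_letter A (Tor t) \<Longrightarrow>
     km_eq A (s_word i 1 @ [Tor t]) (Tor (refl_tor A i t) # s_word i 1)"
| km_s_coroot: "r \<noteq> 0 \<Longrightarrow> km_eq A (s_word i r) (Tor (coroot_tor i r) # s_word i 1)"
| km_refl_root: "valid_letter A (Root x) \<Longrightarrow>
     km_eq A (s_word i 1 @ [Root x]) (Root (refl_lie A i x) # s_word i 1)"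

definition km_words :: "int^'n^'n \<Rightarrow> 'n km_letter list set" where
  "km_words A = {w. \<forall>l \<in> set w. valid_letter A l}"

definition km_rel :: "int^'n^'n \<Rightarrow> 'n km_letter list rel" where
  "km_rel A = {(u, v). u \<in> km_words A \<and> v \<in> km_words A \<and> km_eq A u v}"

type_synonym 'n km = "'n km_letter list set"

definition km_class :: "int^'n^'n \<Rightarrow> 'n km_letter list \<Rightarrow> 'n km" where
  "km_class A w = km_rel A `` {w}"

definition KM :: "int^'n^'n \<Rightarrow> 'n km monoid" where
  "KM A = \<lparr> carrier = km_words A // km_rel A,
            monoid.mult = (\<lambda>P Q. km_rel A `` {u @ v | u v. u \<in> P \<and> v \<in> Q}),
            one = km_class A [] \<rparr>"

definition SL2 :: "(real^2^2) set" where
  "SL2 = {M. det M = 1}"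

text \<open>The canonical homomorphism \<open>\<phi>\<^sub>i\<close>, given by factoring \<open>M\<close> into elementary and diagonal
  matrices: it sends the upper and lower unipotent matrix with parameter \<open>r\<close> to \<open>x(r e\<^sub>i)\<close> and
  \<open>x(r f\<^sub>i)\<close>, and \<open>diag(r, 1/r)\<close> to \<open>r^\<alpha>\<^sub>i\<^sup>\<or>\<close>.\<close>

definition km_phi :: "int^'n^'n \<Rightarrow> 'n \<Rightarrow> real^2^2 \<Rightarrow> 'n km" where
  "km_phi A i M =
     (if M$2$1 = 0
      then km_class A [Tor (coroot_tor i (M$1$1)), Root (LScale (M$1$2 / M$1$1) (GenE i))]
      else km_class A [Root (LScale ((M$1$1 - 1) / M$2$1) (GenE i)), Root (LScale (M$2$1) (GenF i)),
                       Root (LScale ((M$2$2 - 1) / M$2$1) (GenE i))])"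

definition group_topology :: "('a, 'b) monoid_scheme \<Rightarrow> 'a topology \<Rightarrow> bool" where
  "group_topology G \<tau> \<longleftrightarrow> topspace \<tau> = carrier G \<and>
     continuous_map (prod_topology \<tau> \<tau>) \<tau> (\<lambda>(x, y). x \<otimes>\<^bsub>G\<^esub> y) \<and>
     continuous_map \<tau> \<tau> (\<lambda>x. inv\<^bsub>G\<^esub> x)"

definition phi_group_topology :: "int^'n^'n \<Rightarrow> 'n km topology \<Rightarrow> bool" where
  "phi_group_topology A \<tau> \<longleftrightarrow> group_topology (KM A) \<tau> \<and>
     (\<forall>i. continuous_map (top_of_set SL2) \<tau> (km_phi A i))"

definition kac_peterson_topology :: "int^'n^'n \<Rightarrow> 'n km topology" where
  "kac_peterson_topology A = (THE \<tau>. phi_group_topology A \<tau> \<and>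
     (\<forall>\<tau>'. phi_group_topology A \<tau>' \<longrightarrow> (\<forall>U. openin \<tau>' U \<longrightarrow> openin \<tau> U)))"

definition km_theta :: "int^'n^'n \<Rightarrow> 'n km \<Rightarrow> 'n km" where
  "km_theta A = (THE \<theta>. \<theta> \<in> iso (KM A) (KM A) \<and> \<theta> \<in> extensional (carrier (KM A)) \<and>
     (\<forall>g \<in> carrier (KM A). \<theta> (\<theta> g) = g) \<and>
     (\<forall>i. \<forall>M \<in> SL2. \<theta> (km_phi A i M) = km_phi A i (transpose (matrix_inv M))))"


section \<open>The reduced symmetric space\<close>

text \<open>The element \<open>\<Prod>\<^sub>i \<phi>\<^sub>i(diag(t\<^sub>i, 1/t\<^sub>i))\<close> of \<open>T\<close>.\<close>

definition km_tor :: "int^'n^'n \<Rightarrow> real^'n \<Rightarrow> 'n km" where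
  "km_tor A t = km_class A [Tor t]"

definition km_C :: "int^'n^'n \<Rightarrow> 'n km set" where
  "km_C A = {km_tor A t | t. (\<forall>i. t$i \<noteq> 0) \<and>
     (\<exists>z::complex^'n. (\<forall>i. of_real (t$i) = exp (z$i)) \<and>
                      (\<forall>j. (\<Sum>i\<in>UNIV. z$i * of_int (A$i$j)) = 0))}"

definition KM_bar :: "int^'n^'n \<Rightarrow> 'n km set monoid" where
  "KM_bar A = KM A Mod km_C A"

text \<open>The automorphism of the quotient induced by \<open>\<theta>\<close> maps a coset to its image.\<close>

definition K_bar :: "int^'n^'n \<Rightarrow> 'n km set set" where
  "K_bar A = {P \<in> carrier (KM_bar A). km_theta A ` P = P}"

definition quotient_topology :: "'a topology \<Rightarrow> ('a \<Rightarrow> 'b) \<Rightarrow> 'b topology" where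
  "quotient_topology \<tau> f =
     topology (\<lambda>U. U \<subseteq> f ` topspace \<tau> \<and> openin \<tau> {x \<in> topspace \<tau>. f x \<in> U})"

type_synonym 'n km_point = "'n km set set"

definition X_proj :: "int^'n^'n \<Rightarrow> 'n km set \<Rightarrow> 'n km_point" where
  "X_proj A g = g <#\<^bsub>KM_bar A\<^esub> K_bar A"

definition X_bar :: "int^'n^'n \<Rightarrow> 'n km_point set" where
  "X_bar A = X_proj A ` carrier (KM_bar A)"

definition X_topology :: "int^'n^'n \<Rightarrow> 'n km_point topology" where
  "X_topology A = quotient_topology
     (quotient_topology (kac_peterson_topology A) (\<lambda>g. km_C A #>\<^bsub>KM A\<^esub> g)) (X_proj A)"


section \<open>The reduced Tits cone\<close>

text \<open>Elements of the quotient of \<open>\<aa>\<close> by the common kernel of the roots are cosets; all maps on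
  the quotient are induced from maps on \<open>real^'n\<close>.\<close>

definition a_proj :: "int^'n^'n \<Rightarrow> real^'n \<Rightarrow> (real^'n) set" where
  "a_proj A v = {u. \<forall>j. simple_root A j (u - v) = 0}"

definition tits_cone :: "int^'n^'n \<Rightarrow> (real^'n) set set" where
  "tits_cone A = {w ` (a_proj A v) | w v.
     w \<in> generated_maps (refl_a A) \<and> (\<forall>i. simple_root A i v \<ge> 0)}"

definition tits_cone_interior :: "int^'n^'n \<Rightarrow> (real^'n) set set" where
  "tits_cone_interior A = quotient_topology euclidean (a_proj A) interior_of tits_cone A"

text \<open>\<open>km_exp A v\<close> is the exponential of the class of \<open>v\<close>.\<close>

definition km_exp :: "int^'n^'n \<Rightarrow> real^'n \<Rightarrow> 'n km set" where
  "km_exp A v = km_C A #>\<^bsub>KM A\<^esub> km_tor A (\<chi> i. exp (v$i))"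


section \<open>The causal pre-order\<close>

definition causal_cone :: "int^'n^'n \<Rightarrow> 'n km_point \<Rightarrow> 'n km_point set" where
  "causal_cone A x = {X_proj A (g \<otimes>\<^bsub>KM_bar A\<^esub> km_exp A v) | g v.
     g \<in> carrier (KM_bar A) \<and> X_proj A g = x \<and> a_proj A v \<in> tits_cone_interior A}"

definition causal_curve :: "int^'n^'n \<Rightarrow> real \<Rightarrow> real \<Rightarrow> (real \<Rightarrow> 'n km_point) \<Rightarrow> bool" where
  "causal_curve A S T \<gamma> \<longleftrightarrow> 0 < S \<and> S < T \<and>
     continuous_map (top_of_set {S..T}) (X_topology A) \<gamma> \<and>
     (\<forall>t \<in> {S..<T}. \<exists>\<epsilon>>0. t + \<epsilon> \<le> T \<and> \<gamma> ` {t<..<t+\<epsilon>} \<subseteq> causal_cone A (\<gamma> t))"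

definition geodesic_segment :: "int^'n^'n \<Rightarrow> real \<Rightarrow> real \<Rightarrow> (real \<Rightarrow> 'n km_point) \<Rightarrow> bool" where
  "geodesic_segment A r s \<gamma> \<longleftrightarrow>
     (\<exists>g v a b. g \<in> carrier (KM_bar A) \<and> a_proj A v \<noteq> a_proj A 0 \<and> a \<noteq> 0 \<and>
        (\<forall>t \<in> {r..s}. \<gamma> t = X_proj A (g \<otimes>\<^bsub>KM_bar A\<^esub> km_exp A ((a * t + b) *\<^sub>R v))))"

definition pw_geodesic_causal_curve ::
    "int^'n^'n \<Rightarrow> real \<Rightarrow> real \<Rightarrow> (real \<Rightarrow> 'n km_point) \<Rightarrow> bool" where
  "pw_geodesic_causal_curve A S T \<gamma> \<longleftrightarrow> causal_curve A S T \<gamma> \<and>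
     (\<exists>(N::nat) \<tau>. \<tau> 0 = S \<and> \<tau> N = T \<and>
        (\<forall>i<N. \<tau> i < \<tau> (Suc i) \<and> geodesic_segment A (\<tau> i) (\<tau> (Suc i)) \<gamma>))"

definition causally_precedes :: "int^'n^'n \<Rightarrow> 'n km_point \<Rightarrow> 'n km_point \<Rightarrow> bool" where
  "causally_precedes A x y \<longleftrightarrow>
     x = y \<or> (\<exists>S T \<gamma>. pw_geodesic_causal_curve A S T \<gamma> \<and> \<gamma> S = x \<and> \<gamma> T = y)"

definition causal_preorder :: "int^'n^'n \<Rightarrow> 'n km_point rel" where
  "causal_preorder A = {(x, y). x \<in> X_bar A \<and> y \<in> X_bar A \<and> causally_precedes A x y}"

end

theory Submission
  imports Defs
begin

text \<open>
  Let \<open>o\<close> be the base point of the symmetric space and \<open>S\<close> the set of all \<open>g\<close> in the reduced group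
  with \<open>o \<preceq> g o\<close>. The group acts by homeomorphisms that respect the causal structure, so \<open>S\<close> is a
  semigroup. It contains \<open>K\<close>, which fixes \<open>o\<close>, and \<open>exp v\<close> for all \<open>v\<close> in the open Tits cone.

  Suppose that \<open>x \<preceq> y \<preceq> x\<close> with \<open>x \<noteq> y\<close>, and write \<open>x = g o\<close>. A point on the causal curve from \<open>x\<close> to
  \<open>y\<close>, shortly after the start, has the form \<open>g exp(v) o\<close> with \<open>v\<close> in the open cone, and it precedes
  \<open>y\<close>, hence \<open>x\<close> (\<open>causal_first_step\<close>). Translation by \<open>exp(- v) g\<^sup>-\<^sup>1\<close> yields \<open>exp(- v) \<in> S\<close>. As the
  cone is open, \<open>v + \<epsilon> u\<close> lies in it for every \<open>u\<close> and all small \<open>\<epsilon>\<close>, so that \<open>S\<close> contains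
  \<open>exp(\<epsilon> u) = exp(- v) exp(v + \<epsilon> u)\<close> and thus all of \<open>exp \<aa>\<close>. Now \<open>K\<close> and \<open>exp \<aa>\<close> generate the group
  (\<open>rotations_and_diagonals_generate\<close>, by decompositions in \<open>SL\<^sub>2\<close>). So \<open>S\<close> is the whole group, and
  every point precedes every other one (\<open>closed_causal_loop_imp_trivial\<close>).

  Most of the text supplies the facts about the presented group on which this argument rests: the
  \<open>\<phi>\<^sub>i\<close> are homomorphisms (\<open>phi_mult\<close>) whose images generate (\<open>KM_generated\<close>), \<open>C\<close> is central
  (\<open>central_torus\<close>), the involution \<open>\<theta>\<close> exists and is unique (\<open>km_theta\<close>), and there is a finest
  admissible group topology (\<open>kac_peterson_eq\<close>). Generation and centrality need that the root group of
  every real root is conjugate to that of a simple root. This is a statement about the Lie algebra: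
  \<open>exp(ad e\<^sub>i) exp(- ad f\<^sub>i) exp(ad e\<^sub>i)\<close> maps the root space of \<open>\<alpha>\<close> to that of \<open>s\<^sub>i \<alpha>\<close>
  (\<open>root_space_refl_lie\<close>), and the root space of \<open>\<alpha>\<^sub>i\<close> is spanned by \<open>e\<^sub>i\<close> (\<open>root_space_simple\<close>).
\<close>

section \<open>Exponentials of locally nilpotent operators\<close>

definition locally_nilpotent :: "('v::real_vector \<Rightarrow> 'v) \<Rightarrow> bool" where
  "locally_nilpotent T \<longleftrightarrow> (\<forall>y. \<exists>N. (T ^^ N) y = 0)"

text \<open>The series stops at the first vanishing power, as in \<open>exp_ad\<close>.\<close>

definition nil_exp :: "('v::real_vector \<Rightarrow> 'v) \<Rightarrow> 'v \<Rightarrow> 'v" where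
  "nil_exp T y = (\<Sum>k<(LEAST N. (T ^^ N) y = 0). (1 / fact k) *\<^sub>R (T ^^ k) y)"

lemma linear_funpow:
  fixes T :: "'v::real_vector \<Rightarrow> 'v"
  assumes "linear T"
  shows "linear (T ^^ k)"
  by (induction k) (use assms in \<open>auto intro!: linear_compose simp: id_def linear_iff\<close>)

lemma funpow_zero_mono:
  fixes T :: "'v::real_vector \<Rightarrow> 'v"
  assumes "linear T" "(T ^^ N) y = 0" "N \<le> k"
  shows "(T ^^ k) y = 0"
proof -
  have "(T ^^ k) y = (T ^^ (k - N)) ((T ^^ N) y)"
    using assms(3) by (metis comp_apply funpow_add le_add_diff_inverse2)
  then show ?thesis
    using assms linear_funpow linear_0 by metis
qed

lemma nil_exp_eq:
  assumes "linear T" "(T ^^ M) y = 0"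
  shows "nil_exp T y = (\<Sum>k<M. (1 / fact k) *\<^sub>R (T ^^ k) y)"
proof -
  define L where "L = (LEAST N. (T ^^ N) y = 0)"
  have L: "(T ^^ L) y = 0" "L \<le> M"
    unfolding L_def using assms(2) by (auto intro: LeastI Least_le)
  have "(\<Sum>k<L. (1 / fact k) *\<^sub>R (T ^^ k) y) = (\<Sum>k<M. (1 / fact k) *\<^sub>R (T ^^ k) y)"
    by (rule sum.mono_neutral_left) (use L funpow_zero_mono[OF assms(1) L(1)] in auto)
  then show ?thesis by (simp add: nil_exp_def L_def)
qed

lemma nil_exp_2:
  assumes "linear T" "T (T y) = 0"
  shows "nil_exp T y = y + T y"
  using nil_exp_eq[OF assms(1), of 2 y] assms(2)
  by (simp add: eval_nat_numeral lessThan_Suc)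

lemma nil_exp_3:
  assumes "linear T" "T (T (T y)) = 0"
  shows "nil_exp T y = y + T y + (1/2) *\<^sub>R T (T y)"
  using nil_exp_eq[OF assms(1), of 3 y] assms(2)
  by (simp add: eval_nat_numeral lessThan_Suc)

lemma linear_nil_exp:
  assumes "linear T" "locally_nilpotent T"
  shows "linear (nil_exp T)"
proof (rule linearI)
  fix x y :: 'a and c :: real
  note lin = linear_funpow[OF assms(1)]
  obtain M N where MN: "(T ^^ M) x = 0" "(T ^^ N) y = 0"
    using assms(2) unfolding locally_nilpotent_def by blast
  have x: "(T ^^ max M N) x = 0" and y: "(T ^^ max M N) y = 0"
    using funpow_zero_mono[OF assms(1)] MN by auto
  have xy: "(T ^^ max M N) (x + y) = 0" and cx: "(T ^^ max M N) (c *\<^sub>R x) = 0"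
    using x y by (auto simp: linear_add[OF lin] linear_cmul[OF lin])
  show "nil_exp T (x + y) = nil_exp T x + nil_exp T y"
    unfolding nil_exp_eq[OF assms(1) x] nil_exp_eq[OF assms(1) y] nil_exp_eq[OF assms(1) xy]
    by (simp add: linear_add[OF lin] scaleR_add_right sum.distrib)
  show "nil_exp T (c *\<^sub>R x) = c *\<^sub>R nil_exp T x"
    unfolding nil_exp_eq[OF assms(1) x] nil_exp_eq[OF assms(1) cx]
    by (simp add: linear_cmul[OF lin] scaleR_sum_right mult.commute)
qed

lemma nil_exp_intertwine:
  assumes "linear r" "linear T" "linear T'" "locally_nilpotent T" "\<And>x. r (T x) = T' (r x)"
  shows "r (nil_exp T x) = nil_exp T' (r x)"
proof -
  have pow: "r ((T ^^ k) x) = (T' ^^ k) (r x)" for k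
    by (induction k) (auto simp: assms(5))
  obtain M where M: "(T ^^ M) x = 0"
    using assms(4) unfolding locally_nilpotent_def by blast
  have M': "(T' ^^ M) (r x) = 0"
    using M pow[of M] linear_0[OF assms(1)] by simp
  show ?thesis
    unfolding nil_exp_eq[OF assms(2) M] nil_exp_eq[OF assms(3) M']
    by (simp add: linear_sum[OF assms(1)] linear_cmul[OF assms(1)] pow)
qed

text \<open>The Cauchy product of two exponential series that stop before \<open>M\<close>.\<close>

lemma sum_square_by_antidiagonals:
  fixes g :: "nat \<Rightarrow> nat \<Rightarrow> 'v::comm_monoid_add"
  assumes "\<And>i j. M \<le> i \<or> M \<le> j \<Longrightarrow> g i j = 0"
  shows "(\<Sum>n<2*M. \<Sum>i\<le>n. g i (n - i)) = (\<Sum>i<M. \<Sum>j<M. g i j)"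
proof -
  have fin: "finite {(i, j). i + j < 2 * M}"
    by (rule finite_subset[of _ "{..<2*M} \<times> {..<2*M}"]) auto
  have "(\<Sum>n<2*M. \<Sum>i\<le>n. g i (n - i)) = (\<Sum>(i, j)\<in>{(i, j). i + j < 2 * M}. g i j)"
    by (rule sum.triangle_reindex[symmetric])
  also have "\<dots> = (\<Sum>(i, j)\<in>{..<M} \<times> {..<M}. g i j)"
  proof (rule sum.mono_neutral_right[OF fin])
    show "\<forall>x\<in>{(i, j). i + j < 2 * M} - {..<M} \<times> {..<M}. (case x of (i, j) \<Rightarrow> g i j) = 0"
    proof -
      have "g i j = 0" if "\<not> (i < M \<and> j < M)" for i j
        using that by (intro assms) auto
      then show ?thesis by auto
    qed
  qed auto
  also have "\<dots> = (\<Sum>i<M. \<Sum>j<M. g i j)"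
    by (simp add: sum.cartesian_product)
  finally show ?thesis .
qed

lemma nil_exp_add:
  assumes "linear T" "locally_nilpotent T"
  shows "nil_exp (\<lambda>y. a *\<^sub>R T y) (nil_exp (\<lambda>y. b *\<^sub>R T y) y) = nil_exp (\<lambda>y. (a + b) *\<^sub>R T y) y"
proof -
  note lin = linear_funpow[OF assms(1)]
  have linc: "linear (\<lambda>y. c *\<^sub>R T y)" for c
    using assms(1) by (simp add: linear_compose_scale_right)
  have pow: "((\<lambda>y. c *\<^sub>R T y) ^^ k) z = c ^ k *\<^sub>R (T ^^ k) z" for c k z
    by (induction k) (simp_all add: linear_cmul[OF assms(1)])
  obtain M where M: "(T ^^ M) y = 0"
    using assms(2) unfolding locally_nilpotent_def by blast
  have zero: "(T ^^ k) y = 0" if "M \<le> k" for k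
    by (rule funpow_zero_mono[OF assms(1) M that])
  define z where "z = nil_exp (\<lambda>y. b *\<^sub>R T y) y"
  have z: "z = (\<Sum>j<M. (b ^ j / fact j) *\<^sub>R (T ^^ j) y)"
    unfolding z_def using nil_exp_eq[OF linc, of M b y] by (simp add: pow M)
  have Tz: "(T ^^ i) z = (\<Sum>j<M. (b ^ j / fact j) *\<^sub>R (T ^^ (i + j)) y)" for i
    unfolding z by (simp add: linear_sum[OF lin] linear_cmul[OF lin] funpow_add)
  have Mz: "(T ^^ M) z = 0"
    unfolding Tz by (rule sum.neutral) (simp add: zero)
  define g where "g i j = (a ^ i * b ^ j / (fact i * fact j)) *\<^sub>R (T ^^ (i + j)) y" for i j
  have "nil_exp (\<lambda>y. a *\<^sub>R T y) z = (\<Sum>i<M. (a ^ i / fact i) *\<^sub>R (T ^^ i) z)"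
    using nil_exp_eq[OF linc, of M a z] by (simp add: pow Mz)
  also have "\<dots> = (\<Sum>i<M. \<Sum>j<M. g i j)"
    by (simp add: Tz g_def scaleR_sum_right)
  also have "\<dots> = (\<Sum>n<2*M. \<Sum>i\<le>n. g i (n - i))"
    by (rule sum_square_by_antidiagonals[symmetric]) (auto simp: g_def zero)
  also have "\<dots> = (\<Sum>n<2*M. ((a + b) ^ n / fact n) *\<^sub>R (T ^^ n) y)"
  proof (rule sum.cong[OF refl])
    fix n
    have "(\<Sum>i\<le>n. g i (n - i))
          = (\<Sum>i\<le>n. a ^ i * b ^ (n - i) / (fact i * fact (n - i))) *\<^sub>R (T ^^ n) y"
      by (simp add: g_def scaleR_sum_left)
    also have "(\<Sum>i\<le>n. a ^ i * b ^ (n - i) / (fact i * fact (n - i))) = (a + b) ^ n / fact n"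
      unfolding binomial_ring sum_divide_distrib
      by (rule sum.cong[OF refl]) (simp add: binomial_fact field_simps)
    finally show "(\<Sum>i\<le>n. g i (n - i)) = ((a + b) ^ n / fact n) *\<^sub>R (T ^^ n) y" .
  qed
  also have "\<dots> = nil_exp (\<lambda>y. (a + b) *\<^sub>R T y) y"
    using nil_exp_eq[OF linc, of "2*M" "a+b" y] by (simp add: pow zero)
  finally show ?thesis by (simp add: z_def)
qed

lemma nil_exp_zero_op [simp]: "nil_exp (\<lambda>y. 0) y = y"
proof -
  have "linear (\<lambda>y::'a. 0::'a)" by (simp add: linear_iff)
  from nil_exp_eq[OF this, of 1 y] show ?thesis by simp
qed

text \<open>The Leibniz rule for the divided powers \<open>T\<^sup>n / n!\<close>, which is free of binomial coefficients. The
  induction step multiplies by \<open>n + 1\<close> and splits this factor as \<open>k + (n + 1 - k)\<close>.\<close>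

lemma funpow_derivation:
  fixes T :: "'v::real_vector \<Rightarrow> 'v"
  assumes lin: "linear T" and bil: "bilinear b"
    and der: "\<And>u v. T (b u v) = b (T u) v + b u (T v)"
  shows "(1 / fact n) *\<^sub>R (T ^^ n) (b u v)
       = (\<Sum>k\<le>n. b ((1 / fact k) *\<^sub>R (T ^^ k) u) ((1 / fact (n - k)) *\<^sub>R (T ^^ (n - k)) v))"
proof (induction n)
  case 0
  show ?case by simp
next
  case (Suc n)
  define D where "D k y = (1 / fact k) *\<^sub>R (T ^^ k) y" for k and y :: 'v
  have TD: "T (D k y) = real (Suc k) *\<^sub>R D (Suc k) y" for k y
    by (simp add: D_def linear_cmul[OF lin] field_simps del: of_nat_Suc)
  have "real (Suc n) *\<^sub>R D (Suc n) (b u v) = T (D n (b u v))"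
    by (simp add: TD)
  also have "\<dots> = T (\<Sum>k\<le>n. b (D k u) (D (n - k) v))"
    using Suc.IH by (simp add: D_def)
  also have "\<dots> = (\<Sum>k\<le>n. b (T (D k u)) (D (n - k) v)) + (\<Sum>k\<le>n. b (D k u) (T (D (n - k) v)))"
    by (simp add: linear_sum[OF lin] der sum.distrib)
  also have "(\<Sum>k\<le>n. b (T (D k u)) (D (n - k) v))
           = (\<Sum>k\<le>Suc n. real k *\<^sub>R b (D k u) (D (Suc n - k) v))"
    by (simp add: sum.atMost_Suc_shift TD bilinear_lmul[OF bil] del: of_nat_Suc sum.atMost_Suc)
  also have "(\<Sum>k\<le>n. b (D k u) (T (D (n - k) v)))
           = (\<Sum>k\<le>Suc n. real (Suc n - k) *\<^sub>R b (D k u) (D (Suc n - k) v))"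
    by (simp add: TD bilinear_rmul[OF bil] Suc_diff_le del: of_nat_Suc of_nat_diff)
  also have "(\<Sum>k\<le>Suc n. real k *\<^sub>R b (D k u) (D (Suc n - k) v))
        + (\<Sum>k\<le>Suc n. real (Suc n - k) *\<^sub>R b (D k u) (D (Suc n - k) v))
        = (\<Sum>k\<le>Suc n. real (Suc n) *\<^sub>R b (D k u) (D (Suc n - k) v))"
    unfolding sum.distrib[symmetric] scaleR_add_left[symmetric]
    by (rule sum.cong[OF refl]) (simp add: of_nat_diff)
  also have "\<dots> = real (Suc n) *\<^sub>R (\<Sum>k\<le>Suc n. b (D k u) (D (Suc n - k) v))"
    by (simp add: scaleR_sum_right del: of_nat_Suc sum.atMost_Suc)
  finally have "D (Suc n) (b u v) = (\<Sum>k\<le>Suc n. b (D k u) (D (Suc n - k) v))"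
    by (simp del: of_nat_Suc sum.atMost_Suc)
  then show ?case by (simp add: D_def del: sum.atMost_Suc)
qed

lemma nil_derivation:
  fixes T :: "'v::real_vector \<Rightarrow> 'v"
  assumes lin: "linear T" and bil: "bilinear b"
    and der: "\<And>u v. T (b u v) = b (T u) v + b u (T v)"
    and "(T ^^ M) u = 0" "(T ^^ N) v = 0"
  shows "(T ^^ (M + N)) (b u v) = 0"
proof -
  have z: "b ((1 / fact k) *\<^sub>R (T ^^ k) u) ((1 / fact (M + N - k)) *\<^sub>R (T ^^ (M + N - k)) v) = 0" for k
  proof (cases "M \<le> k")
    case True
    then show ?thesis
      using funpow_zero_mono[OF lin assms(4)] by (simp add: bilinear_lzero[OF bil])
  next
    case False
    then have "N \<le> M + N - k" by simp
    then show ?thesis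
      using funpow_zero_mono[OF lin assms(5)] by (simp add: bilinear_rzero[OF bil])
  qed
  have "(1 / fact (M + N)) *\<^sub>R (T ^^ (M + N)) (b u v) = 0"
    unfolding funpow_derivation[OF lin bil der] by (rule sum.neutral) (use z in blast)
  then show ?thesis by simp
qed

text \<open>Exponentials of derivations are automorphisms: multiply the Leibniz rules for all powers out.\<close>

lemma nil_exp_derivation:
  fixes T :: "'v::real_vector \<Rightarrow> 'v"
  assumes lin: "linear T" and bil: "bilinear b"
    and der: "\<And>u v. T (b u v) = b (T u) v + b u (T v)"
    and ln: "locally_nilpotent T"
  shows "nil_exp T (b u v) = b (nil_exp T u) (nil_exp T v)"
proof -
  obtain M0 N0 where "(T ^^ M0) u = 0" "(T ^^ N0) v = 0"
    using ln unfolding locally_nilpotent_def by blast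
  then obtain M where u: "(T ^^ M) u = 0" and v: "(T ^^ M) v = 0"
    using funpow_zero_mono[OF lin] by (metis max.cobounded1 max.cobounded2)
  define D where "D k y = (1 / fact k) *\<^sub>R (T ^^ k) y" for k and y :: 'v
  have zero: "D k u = 0" "D k v = 0" if "M \<le> k" for k
    using funpow_zero_mono[OF lin _ that] u v by (auto simp: D_def)
  have uv: "(T ^^ (2 * M)) (b u v) = 0"
    using nil_derivation[OF lin bil der u v] by (simp add: mult_2)
  have "nil_exp T (b u v) = (\<Sum>n<2*M. \<Sum>i\<le>n. b (D i u) (D (n - i) v))"
    unfolding nil_exp_eq[OF lin uv] funpow_derivation[OF lin bil der] D_def ..
  also have "\<dots> = (\<Sum>i<M. \<Sum>j<M. b (D i u) (D j v))"
    by (rule sum_square_by_antidiagonals)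
       (use zero bilinear_lzero[OF bil] bilinear_rzero[OF bil] in auto)
  also have "\<dots> = b (\<Sum>i<M. D i u) (\<Sum>j<M. D j v)"
    by (simp add: bilinear_sum[OF bil] sum.cartesian_product)
  finally show ?thesis
    unfolding nil_exp_eq[OF lin u] nil_exp_eq[OF lin v] D_def .
qed

section \<open>The Kac--Moody algebra as a vector space\<close>

text \<open>Types cannot depend on a matrix, so all presented algebras are treated together: this type is their
  product over all matrices. The map \<open>cl A\<close> below embeds the algebra of \<open>A\<close> as one factor and thereby
  turns \<open>lie_eq A\<close> into equality in a real vector space.\<close>

quotient_type 'n lie_family = "int^'n^'n \<Rightarrow> ('n::finite) lie_term" /
  "\<lambda>f g. \<forall>A. lie_eq A (f A) (g A)"
  by (rule equivpI) (auto simp: reflp_def symp_def transp_def intro: lie_refl lie_sym lie_trans)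

instantiation lie_family :: (finite) real_vector
begin

lift_definition zero_lie_family :: "'a lie_family" is "\<lambda>_. LZero" .
lift_definition plus_lie_family :: "'a lie_family \<Rightarrow> 'a lie_family \<Rightarrow> 'a lie_family"
  is "\<lambda>f g A. LAdd (f A) (g A)" by (auto intro: lie_add_cong)
lift_definition scaleR_lie_family :: "real \<Rightarrow> 'a lie_family \<Rightarrow> 'a lie_family"
  is "\<lambda>c f A. LScale c (f A)" by (auto intro: lie_scale_cong)
lift_definition uminus_lie_family :: "'a lie_family \<Rightarrow> 'a lie_family"
  is "\<lambda>f A. LScale (-1) (f A)" by (auto intro: lie_scale_cong)
lift_definition minus_lie_family :: "'a lie_family \<Rightarrow> 'a lie_family \<Rightarrow> 'a lie_family"
  is "\<lambda>f g A. LAdd (f A) (LScale (-1) (g A))" by (auto intro: lie_add_cong lie_scale_cong)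

instance
proof
  fix x y z :: "'a lie_family" and c d :: real
  show "x + y + z = x + (y + z)" by transfer (auto intro: lie_eq.intros)
  show "x + y = y + x" by transfer (auto intro: lie_eq.intros)
  show "0 + x = x" by transfer (auto intro: lie_eq.intros)
  show "- x + x = 0" by transfer (auto intro: lie_eq.intros)
  show "x - y = x + - y" by transfer (auto intro: lie_eq.intros)
  show "c *\<^sub>R (x + y) = c *\<^sub>R x + c *\<^sub>R y" by transfer (auto intro: lie_eq.intros)
  show "(c + d) *\<^sub>R x = c *\<^sub>R x + d *\<^sub>R x" by transfer (auto intro: lie_eq.intros)
  show "c *\<^sub>R d *\<^sub>R x = (c * d) *\<^sub>R x" by transfer (auto intro: lie_eq.intros)
  show "1 *\<^sub>R x = x" by transfer (auto intro: lie_eq.intros)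
qed

end

lift_definition br :: "('n::finite) lie_family \<Rightarrow> 'n lie_family \<Rightarrow> 'n lie_family"
  is "\<lambda>f g A. LBr (f A) (g A)" by (auto intro: lie_br_cong)

lemma bilinear_br: "bilinear br"
  unfolding bilinear_def linear_iff by (intro conjI allI; transfer; auto intro: lie_eq.intros)

lemma br_simps [simp]:
  "br (x + y) z = br x z + br y z" "br z (x + y) = br z x + br z y"
  "br (x - y) z = br x z - br y z" "br z (x - y) = br z x - br z y"
  "br (- x) z = - br x z" "br z (- x) = - br z x"
  "br (c *\<^sub>R x) z = c *\<^sub>R br x z" "br z (c *\<^sub>R x) = c *\<^sub>R br z x"
  "br 0 z = 0" "br z 0 = 0"
  by (simp_all add: bilinear_ladd[OF bilinear_br] bilinear_radd[OF bilinear_br]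
      bilinear_lmul[OF bilinear_br] bilinear_rmul[OF bilinear_br] bilinear_lzero[OF bilinear_br]
      bilinear_rzero[OF bilinear_br] bilinear_lneg[OF bilinear_br] bilinear_rneg[OF bilinear_br]
      bilinear_lsub[OF bilinear_br] bilinear_rsub[OF bilinear_br])

lemma br_self [simp]: "br x x = 0"
  by transfer (auto intro: lie_eq.intros)

lemma br_anti: "br y x = - br x y"
proof -
  have "br (x + y) (x + y) = 0" by (rule br_self)
  then have "br x y + br y x = 0" by (simp del: br_self add: br_self[of x] br_self[of y] add.commute)
  then show ?thesis by (simp add: eq_neg_iff_add_eq_0 add.commute)
qed

lemma br_jacobi: "br x (br y z) = br (br x y) z + br y (br x z)"
proof -
  have "br x (br y z) + (br y (br z x) + br z (br x y)) = 0"
    by transfer (auto intro: lie_eq.intros)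
  then show ?thesis
    by (simp add: br_anti[of x z] br_anti[of z "br x y"] algebra_simps)
qed

lemma linear_br: "linear (br x)"
  using bilinear_br[unfolded bilinear_def] by blast

definition cl :: "int^'n^'n \<Rightarrow> ('n::finite) lie_term \<Rightarrow> 'n lie_family" where
  "cl A x = abs_lie_family (\<lambda>B. if B = A then x else LZero)"

lemma cl_eq_iff: "cl A x = cl A y \<longleftrightarrow> lie_eq A x y"
  unfolding cl_def lie_family.abs_eq_iff by (auto intro: lie_refl)

lemma lie_zero_ops:
  "lie_eq A (LScale c LZero) LZero" "lie_eq A (LBr x LZero) LZero" "lie_eq A (LBr LZero x) LZero"
  "lie_eq A LZero (LScale c LZero)" "lie_eq A LZero (LBr x LZero)" "lie_eq A LZero (LBr LZero x)"
proof -
  have "c *\<^sub>R (0 :: 'a lie_family) = 0" "br (cl A x) 0 = 0" "br 0 (cl A x) = 0"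
    by simp_all
  then have "lie_eq A (LScale c LZero) LZero" "lie_eq A (LBr x LZero) LZero"
    "lie_eq A (LBr LZero x) LZero"
    unfolding cl_def by (auto simp: br.abs_eq scaleR_lie_family.abs_eq zero_lie_family_def
        lie_family.abs_eq_iff split: if_splits)
  then show
    "lie_eq A (LScale c LZero) LZero" "lie_eq A (LBr x LZero) LZero" "lie_eq A (LBr LZero x) LZero"
    "lie_eq A LZero (LScale c LZero)" "lie_eq A LZero (LBr x LZero)" "lie_eq A LZero (LBr LZero x)"
    by (auto intro: lie_sym)
qed

lemma cl_simps:
  "cl A LZero = 0"
  "cl A (LAdd x y) = cl A x + cl A y"
  "cl A (LScale c x) = c *\<^sub>R cl A x"
  "cl A (LBr x y) = br (cl A x) (cl A y)"
  unfolding cl_def zero_lie_family_def plus_lie_family.abs_eq scaleR_lie_family.abs_eq br.abs_eq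
    lie_family.abs_eq_iff
  by (auto intro: lie_refl lie_zero_ops lie_add_zero[THEN lie_sym])

text \<open>Brackets with an element of the factor of \<open>A\<close> kill all other factors. Therefore local nilpotency on
  the whole product follows from local nilpotency on this factor.\<close>

lemma br_cl_in_range: "\<exists>y. br (cl A x) v = cl A y"
proof -
  obtain f where v: "v = abs_lie_family f"
    by (metis Quotient_abs_rep[OF Quotient_lie_family])
  have "br (cl A x) (abs_lie_family f) = cl A (LBr x (f A))"
    unfolding cl_def br.abs_eq lie_family.abs_eq_iff by (auto intro: lie_refl lie_zero_ops)
  then show ?thesis unfolding v by blast
qed

lemma cl_funpow_br: "cl A ((LBr x ^^ k) y) = (br (cl A x) ^^ k) (cl A y)"
  by (induction k) (simp_all add: cl_simps)

lemma cl_lie_sum: "cl A (lie_sum f k) = (\<Sum>i<k. cl A (f i))"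
  by (induction k) (simp_all add: cl_simps)

lemma cl_exp_ad: "cl A (exp_ad A x y) = nil_exp (br (cl A x)) (cl A y)"
proof -
  have "lie_eq A ((LBr x ^^ N) y) LZero \<longleftrightarrow> (br (cl A x) ^^ N) (cl A y) = 0" for N
    unfolding cl_eq_iff[symmetric] by (simp add: cl_funpow_br cl_simps)
  then show ?thesis
    by (simp add: exp_ad_def nil_exp_def cl_lie_sum cl_simps cl_funpow_br)
qed

section \<open>The Kac--Moody algebra: integrability and grading\<close>

abbreviation vE :: "int^'n^'n \<Rightarrow> 'n::finite \<Rightarrow> 'n lie_family" where "vE A i \<equiv> cl A (GenE i)"
abbreviation vF :: "int^'n^'n \<Rightarrow> 'n::finite \<Rightarrow> 'n lie_family" where "vF A i \<equiv> cl A (GenF i)"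
abbreviation vH :: "int^'n^'n \<Rightarrow> 'n::finite \<Rightarrow> 'n lie_family" where "vH A i \<equiv> cl A (GenH i)"

lemmas cl_eqI = cl_eq_iff[THEN iffD2]

lemma br_HH [simp]: "br (vH A i) (vH A j) = 0"
  using lie_rel_hh[THEN cl_eqI] by (simp add: cl_simps)
lemma br_HE [simp]: "br (vH A i) (vE A j) = of_int (A$i$j) *\<^sub>R vE A j"
  using lie_rel_he[THEN cl_eqI] by (simp add: cl_simps)
lemma br_HF [simp]: "br (vH A i) (vF A j) = - of_int (A$i$j) *\<^sub>R vF A j"
  using lie_rel_hf[THEN cl_eqI] by (simp add: cl_simps)
lemma br_EF: "br (vE A i) (vF A j) = (if i = j then vH A i else 0)"
  using lie_rel_ef[THEN cl_eqI] lie_rel_ef_ne[THEN cl_eqI] by (auto simp: cl_simps)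
lemma br_EH [simp]: "br (vE A j) (vH A i) = - of_int (A$i$j) *\<^sub>R vE A j"
  by (subst br_anti) simp
lemma br_FH [simp]: "br (vF A j) (vH A i) = of_int (A$i$j) *\<^sub>R vF A j"
  by (subst br_anti) simp
lemma br_FE: "br (vF A i) (vE A j) = (if i = j then - vH A i else 0)"
  by (subst br_anti) (simp add: br_EF)
lemma serre_E: "i \<noteq> j \<Longrightarrow> (br (vE A i) ^^ nat (1 - A$i$j)) (vE A j) = 0"
  using lie_serre_e[THEN cl_eqI] by (simp add: cl_simps cl_funpow_br)
lemma serre_F: "i \<noteq> j \<Longrightarrow> (br (vF A i) ^^ nat (1 - A$i$j)) (vF A j) = 0"
  using lie_serre_f[THEN cl_eqI] by (simp add: cl_simps cl_funpow_br)

text \<open>The elements that some power of \<open>ad x\<close> kills form a subalgebra by the Leibniz rule. So it suffices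
  to look at the generators, where the Serre relations apply.\<close>

lemma locally_nilpotent_ad:
  assumes gens: "\<And>j. \<exists>N. (br (cl A x) ^^ N) (vE A j) = 0" "\<And>j. \<exists>N. (br (cl A x) ^^ N) (vF A j) = 0"
    "\<And>j. \<exists>N. (br (cl A x) ^^ N) (vH A j) = 0"
  shows "locally_nilpotent (br (cl A x))"
  unfolding locally_nilpotent_def
proof
  fix v
  let ?T = "br (cl A x)"
  note lin = linear_funpow[OF linear_br]
  have "\<exists>N. (?T ^^ N) (cl A y) = 0" for y
  proof (induction y)
    case (LAdd y z)
    then obtain M N where MN: "(?T ^^ M) (cl A y) = 0" "(?T ^^ N) (cl A z) = 0" by blast
    have "(?T ^^ max M N) (cl A y) = 0" "(?T ^^ max M N) (cl A z) = 0"
      by (rule funpow_zero_mono[OF linear_br MN(1)], simp,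
          rule funpow_zero_mono[OF linear_br MN(2)], simp)
    then have "(?T ^^ max M N) (cl A (LAdd y z)) = 0"
      by (simp add: cl_simps linear_add[OF lin])
    then show ?case by blast
  next
    case (LScale c y)
    then obtain N where "(?T ^^ N) (cl A y) = 0" by blast
    then have "(?T ^^ N) (cl A (LScale c y)) = 0"
      by (simp only: cl_simps linear_cmul[OF lin]) simp
    then show ?case by blast
  next
    case (LBr y z)
    then obtain M N where MN: "(?T ^^ M) (cl A y) = 0" "(?T ^^ N) (cl A z) = 0" by blast
    have "(?T ^^ (M + N)) (cl A (LBr y z)) = 0"
      unfolding cl_simps(4) by (rule nil_derivation[where b = br, OF linear_br bilinear_br br_jacobi MN])
    then show ?case by blast
  next
    case LZero
    show ?case by (rule exI[of _ 0]) (simp add: cl_simps)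
  qed (simp_all add: gens)
  moreover obtain y where "?T v = cl A y" using br_cl_in_range by blast
  ultimately obtain N where "(?T ^^ N) (?T v) = 0" by metis
  then have "(?T ^^ Suc N) v = 0" by (simp add: funpow_swap1)
  then show "\<exists>N. (?T ^^ N) v = 0" by blast
qed

lemma locally_nilpotent_E: "locally_nilpotent (br (vE A i))"
proof (rule locally_nilpotent_ad)
  fix j
  show "\<exists>N. (br (vE A i) ^^ N) (vE A j) = 0"
  proof (cases "i = j")
    case True
    then show ?thesis by (intro exI[of _ 1]) simp
  next
    case False
    then show ?thesis by (intro exI) (rule serre_E)
  qed
  show "\<exists>N. (br (vE A i) ^^ N) (vF A j) = 0"
    by (intro exI[of _ 3]) (simp add: eval_nat_numeral br_EF)
  show "\<exists>N. (br (vE A i) ^^ N) (vH A j) = 0"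
    by (intro exI[of _ 2]) (simp add: eval_nat_numeral)
qed

lemma locally_nilpotent_F: "locally_nilpotent (br (vF A i))"
proof (rule locally_nilpotent_ad)
  fix j
  show "\<exists>N. (br (vF A i) ^^ N) (vF A j) = 0"
  proof (cases "i = j")
    case True
    then show ?thesis by (intro exI[of _ 1]) simp
  next
    case False
    then show ?thesis by (intro exI) (rule serre_F)
  qed
  show "\<exists>N. (br (vF A i) ^^ N) (vE A j) = 0"
    by (intro exI[of _ 3]) (simp add: eval_nat_numeral br_FE)
  show "\<exists>N. (br (vF A i) ^^ N) (vH A j) = 0"
    by (intro exI[of _ 2]) (simp add: eval_nat_numeral)
qed

lemma br_scale_op: "br (c *\<^sub>R x) = (\<lambda>y. c *\<^sub>R br x y)"
  by (rule ext) simp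

lemma locally_nilpotent_scale:
  assumes "locally_nilpotent (br x)"
  shows "locally_nilpotent (br (c *\<^sub>R x))"
proof -
  have pow: "(br (c *\<^sub>R x) ^^ k) y = c ^ k *\<^sub>R (br x ^^ k) y" for k y
    by (induction k) simp_all
  show ?thesis
    unfolding locally_nilpotent_def
  proof
    fix y
    obtain N where "(br x ^^ N) y = 0" using assms unfolding locally_nilpotent_def by blast
    then have "(br (c *\<^sub>R x) ^^ N) y = 0" by (simp only: pow) simp
    then show "\<exists>N. (br (c *\<^sub>R x) ^^ N) y = 0" ..
  qed
qed

lemma locally_nilpotent_uminus_F: "locally_nilpotent (br (- vF A i))"
  using locally_nilpotent_scale[OF locally_nilpotent_F, of "-1"] by simp

lemma nil_exp_br_add:
  assumes "locally_nilpotent (br x)"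
  shows "nil_exp (br (a *\<^sub>R x)) (nil_exp (br (b *\<^sub>R x)) z) = nil_exp (br ((a + b) *\<^sub>R x)) z"
  unfolding br_scale_op by (rule nil_exp_add[OF linear_br assms])

lemma nil_exp_br_0 [simp]: "nil_exp (br 0) y = y"
proof -
  have "br (0 :: 'a lie_family) = (\<lambda>y. 0)" by (rule ext) simp
  then show ?thesis by (simp only: nil_exp_zero_op)
qed

lemma nil_exp_br_inverse:
  assumes "locally_nilpotent (br x)"
  shows "nil_exp (br x) (nil_exp (br (- x)) z) = z" "nil_exp (br (- x)) (nil_exp (br x) z) = z"
proof -
  show "nil_exp (br x) (nil_exp (br (- x)) z) = z"
    using nil_exp_br_add[OF assms, of 1 "-1" z] by simp
  show "nil_exp (br (- x)) (nil_exp (br x) z) = z"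
    using nil_exp_br_add[OF assms, of "-1" 1 z] by simp
qed

lemma nil_exp_br_hom:
  "locally_nilpotent (br x) \<Longrightarrow> nil_exp (br x) (br u v) = br (nil_exp (br x) u) (nil_exp (br x) v)"
  using nil_exp_derivation[where T = "br x" and b = br, OF linear_br bilinear_br] br_jacobi by blast

definition reflV :: "int^'n^'n \<Rightarrow> 'n::finite \<Rightarrow> 'n lie_family \<Rightarrow> 'n lie_family" where
  "reflV A i x = nil_exp (br (vE A i)) (nil_exp (br (- vF A i)) (nil_exp (br (vE A i)) x))"

lemma cl_refl_lie: "cl A (refl_lie A i x) = reflV A i (cl A x)"
  by (simp add: refl_lie_def reflV_def cl_exp_ad cl_simps)

lemma linear_expE: "linear (nil_exp (br (vE A i)))"
  by (rule linear_nil_exp[OF linear_br locally_nilpotent_E])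
lemma linear_expF: "linear (nil_exp (br (- vF A i)))"
  by (rule linear_nil_exp[OF linear_br locally_nilpotent_uminus_F])

lemma linear_reflV: "linear (reflV A i)"
proof -
  have eq: "reflV A i = nil_exp (br (vE A i)) \<circ> (nil_exp (br (- vF A i)) \<circ> nil_exp (br (vE A i)))"
    by (rule ext) (simp add: reflV_def)
  show ?thesis
    unfolding eq by (intro linear_compose[OF linear_compose] linear_expE linear_expF)
qed

lemma reflV_br: "reflV A i (br x y) = br (reflV A i x) (reflV A i y)"
  by (simp only: reflV_def nil_exp_br_hom[OF locally_nilpotent_E] nil_exp_br_hom[OF locally_nilpotent_uminus_F])

lemma gcm_diag: "gcm A \<Longrightarrow> A$i$i = 2"
  by (simp add: gcm_def)

lemma reflV_gens:
  assumes "gcm A"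
  shows "reflV A i (vE A i) = - vF A i" "reflV A i (vF A i) = - vE A i"
    "reflV A i (vH A i) = - vH A i"
proof -
  note d = gcm_diag[OF assms]
  have EE: "nil_exp (br (vE A i)) (vE A i) = vE A i"
    by (subst nil_exp_2[OF linear_br]) simp_all
  have EF: "nil_exp (br (vE A i)) (vF A i) = vF A i + vH A i - vE A i"
    by (subst nil_exp_3[OF linear_br]) (simp_all add: br_EF d)
  have EH: "nil_exp (br (vE A i)) (vH A i) = vH A i - 2 *\<^sub>R vE A i"
    by (subst nil_exp_2[OF linear_br]) (simp_all add: d)
  have FF: "nil_exp (br (- vF A i)) (vF A i) = vF A i"
    by (subst nil_exp_2[OF linear_br]) simp_all
  have FE: "nil_exp (br (- vF A i)) (vE A i) = vE A i + vH A i - vF A i"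
    by (subst nil_exp_3[OF linear_br]) (simp_all add: br_FE d)
  have FH: "nil_exp (br (- vF A i)) (vH A i) = vH A i - 2 *\<^sub>R vF A i"
    by (subst nil_exp_2[OF linear_br]) (simp_all add: d)
  note lin = linear_add[OF linear_expE] linear_diff[OF linear_expE] linear_cmul[OF linear_expE]
    linear_add[OF linear_expF] linear_diff[OF linear_expF] linear_cmul[OF linear_expF]
    linear_neg[OF linear_expE] linear_neg[OF linear_expF]
  show "reflV A i (vE A i) = - vF A i" "reflV A i (vF A i) = - vE A i"
    "reflV A i (vH A i) = - vH A i"
    unfolding reflV_def by (simp_all add: EE EF EH FF FE FH lin algebra_simps scaleR_2)
qed

text \<open>The automorphism \<open>r = reflV A i\<close> exchanges \<open>e\<^sub>i\<close> and \<open>- f\<^sub>i\<close>, hence it exchanges the two exponentials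
  under conjugation. Moving \<open>r\<close> through its own factors gives \<open>r r = r' r\<close> for the operator \<open>r'\<close> on the
  right, and \<open>r\<close> is surjective.\<close>

lemma reflV_alt:
  assumes "gcm A"
  shows "reflV A i x
    = nil_exp (br (- vF A i)) (nil_exp (br (vE A i)) (nil_exp (br (- vF A i)) x))"
proof -
  have 1: "reflV A i (nil_exp (br (vE A i)) y) = nil_exp (br (- vF A i)) (reflV A i y)" for y
    by (rule nil_exp_intertwine[OF linear_reflV linear_br linear_br locally_nilpotent_E])
       (simp add: reflV_br reflV_gens[OF assms])
  have 2: "reflV A i (nil_exp (br (- vF A i)) y) = nil_exp (br (vE A i)) (reflV A i y)" for y
    by (rule nil_exp_intertwine[OF linear_reflV linear_br linear_br locally_nilpotent_uminus_F])
       (simp add: reflV_br reflV_gens[OF assms] linear_neg[OF linear_reflV])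
  obtain y where y: "x = reflV A i y"
  proof
    show "x = reflV A i (nil_exp (br (- vE A i)) (nil_exp (br (vF A i)) (nil_exp (br (- vE A i)) x)))"
      using nil_exp_br_inverse[OF locally_nilpotent_E[of A i]] nil_exp_br_inverse[OF locally_nilpotent_F[of A i]]
      by (simp add: reflV_def)
  qed
  show ?thesis
    unfolding y by (subst (2) reflV_def) (simp add: 1 2)
qed

subsection \<open>Homogeneous elements\<close>

definition pairing :: "int^'n^'n \<Rightarrow> 'n::finite \<Rightarrow> int^'n \<Rightarrow> int" where
  "pairing A i \<beta> = (\<Sum>j\<in>UNIV. \<beta>$j * A$i$j)"

lemma pairing_simps [simp]:
  "pairing A i (\<alpha> + \<beta>) = pairing A i \<alpha> + pairing A i \<beta>"
  "pairing A i (\<alpha> - \<beta>) = pairing A i \<alpha> - pairing A i \<beta>"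
  "pairing A i (- \<alpha>) = - pairing A i \<alpha>"
  "pairing A i 0 = 0"
  "pairing A i (axis j c) = c * A$i$j"
  by (simp_all add: pairing_def sum.distrib sum_subtractf sum_negf algebra_simps axis_def
      if_distrib[of "\<lambda>x. _ * x"] cong: if_cong)

lemma refl_root_pairing: "refl_root A i \<beta> = \<beta> - axis i (pairing A i \<beta>)"
  by (simp add: refl_root_def pairing_def)

lemma axis_add [simp]: "axis i (a + b) = axis i a + axis i (b :: int)"
  by (simp add: axis_def vec_eq_iff)
lemma axis_minus [simp]: "axis i (- a) = - axis i (a :: int)"
  by (simp add: axis_def vec_eq_iff)

lemma refl_root_invol: "gcm A \<Longrightarrow> refl_root A i (refl_root A i \<beta>) = \<beta>"
  by (simp add: refl_root_pairing gcm_diag flip: axis_minus axis_add)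

lemma refl_root_uminus: "refl_root A i (- \<beta>) = - refl_root A i \<beta>"
  by (simp add: refl_root_pairing)

definition deg_space :: "int^'n^'n \<Rightarrow> int^'n \<Rightarrow> ('n::finite) lie_family set" where
  "deg_space A \<alpha> = {cl A x | x. root_space A \<alpha> x}"

lemma root_space_iff: "root_space A \<alpha> x \<longleftrightarrow> cl A x \<in> deg_space A \<alpha>"
  unfolding deg_space_def by (auto simp: cl_eq_iff intro: root_space.intros(8) lie_sym lie_refl)

lemma deg_space_gens [simp]:
  "vE A i \<in> deg_space A (axis i 1)" "vF A i \<in> deg_space A (- axis i 1)" "vH A i \<in> deg_space A 0"
  by (auto simp: root_space_iff[symmetric] intro: root_space.intros)

lemma subspace_deg_space: "subspace (deg_space A \<alpha>)"
proof (rule subspaceI)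
  show "0 \<in> deg_space A \<alpha>"
    unfolding cl_simps(1)[symmetric, of A] root_space_iff[symmetric] by (rule root_space.intros)
  show "x + y \<in> deg_space A \<alpha>" if "x \<in> deg_space A \<alpha>" "y \<in> deg_space A \<alpha>" for x y
    using that unfolding deg_space_def by (auto simp flip: cl_simps intro: root_space.intros)
  show "c *\<^sub>R x \<in> deg_space A \<alpha>" if "x \<in> deg_space A \<alpha>" for c x
    using that unfolding deg_space_def by (auto simp flip: cl_simps intro: root_space.intros)
qed

lemma deg_space_br:
  "x \<in> deg_space A \<alpha> \<Longrightarrow> y \<in> deg_space A \<beta> \<Longrightarrow> br x y \<in> deg_space A (\<alpha> + \<beta>)"
  unfolding deg_space_def by (auto simp flip: cl_simps intro: root_space.intros)

lemma deg_space_weight: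
  assumes "v \<in> deg_space A \<beta>"
  shows "br (vH A i) v = of_int (pairing A i \<beta>) *\<^sub>R v"
proof -
  have "br (vH A i) (cl A x) = of_int (pairing A i \<beta>) *\<^sub>R cl A x" if "root_space A \<beta> x" for x
    using that
  proof induction
    case (7 \<alpha> x \<beta> y)
    then show ?case
      by (simp add: cl_simps br_jacobi[of "vH A i"] scaleR_add_left)
  next
    case (8 \<alpha> x y)
    then show ?case by (simp add: cl_eq_iff[symmetric])
  qed (simp_all add: cl_simps scaleR_add_right mult.commute)
  then show ?thesis using assms by (auto simp: deg_space_def)
qed

text \<open>The sum over the \<open>\<alpha>\<^sub>i\<close>-string through \<open>\<alpha>\<close>. It is stable under \<open>ad e\<^sub>i\<close> and \<open>ad f\<^sub>i\<close>, and its members are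
  told apart by their \<open>h\<^sub>i\<close>-weights.\<close>

definition deg_string :: "int^'n^'n \<Rightarrow> 'n \<Rightarrow> int^'n \<Rightarrow> ('n::finite) lie_family set" where
  "deg_string A i \<alpha> = span (\<Union>k. deg_space A (\<alpha> + axis i k))"

lemma deg_string_stable:
  assumes "x \<in> deg_space A (axis i m)" "v \<in> deg_string A i \<alpha>"
  shows "br x v \<in> deg_string A i \<alpha>"
proof -
  have "br x v \<in> span (br x ` (\<Union>k. deg_space A (\<alpha> + axis i k)))"
    using assms(2) linear_span_image[OF linear_br] unfolding deg_string_def by blast
  also have "\<dots> \<subseteq> deg_string A i \<alpha>"
    unfolding deg_string_def
  proof (rule span_mono, clarify)
    fix k y assume "y \<in> deg_space A (\<alpha> + axis i k)"
    then have "br x y \<in> deg_space A (\<alpha> + axis i (m + k))"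
      using deg_space_br[OF assms(1), of y "\<alpha> + axis i k"] by (simp add: ac_simps)
    then show "br x y \<in> (\<Union>k. deg_space A (\<alpha> + axis i k))" by blast
  qed
  finally show ?thesis .
qed

lemma nil_exp_in_subspace:
  assumes "subspace S" "\<And>v. v \<in> S \<Longrightarrow> T v \<in> S" "v \<in> S"
  shows "nil_exp T v \<in> S"
proof -
  have "(T ^^ k) v \<in> S" for k by (induction k) (use assms in auto)
  then show ?thesis
    unfolding nil_exp_def by (intro subspace_sum subspace_scale assms)
qed

lemma deg_string_reflV:
  assumes "v \<in> deg_string A i \<alpha>"
  shows "reflV A i v \<in> deg_string A i \<alpha>"
proof -
  have S: "subspace (deg_string A i \<alpha>)" by (simp add: deg_string_def)
  have E: "nil_exp (br (vE A i)) u \<in> deg_string A i \<alpha>" if "u \<in> deg_string A i \<alpha>" for u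
    by (rule nil_exp_in_subspace[OF S _ that]) (rule deg_string_stable[of _ _ _ 1], auto)
  have mF: "- vF A i \<in> deg_space A (axis i (- 1))"
    using subspace_neg[OF subspace_deg_space deg_space_gens(2)] by simp
  have F: "nil_exp (br (- vF A i)) u \<in> deg_string A i \<alpha>" if "u \<in> deg_string A i \<alpha>" for u
    by (rule nil_exp_in_subspace[OF S _ that]) (rule deg_string_stable[OF mF])
  show ?thesis unfolding reflV_def by (intro E F assms)
qed

lemma deg_string_sum:
  assumes "v \<in> deg_string A i \<alpha>"
  shows "\<exists>K y. finite K \<and> (\<forall>k. y k \<in> deg_space A (\<alpha> + axis i k)) \<and> v = (\<Sum>k\<in>K. y k)"
proof -
  let ?P = "\<lambda>v. \<exists>K y. finite K \<and> (\<forall>k. y k \<in> deg_space A (\<alpha> + axis i k)) \<and>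
      (\<forall>k. k \<notin> K \<longrightarrow> y k = 0) \<and> v = (\<Sum>k\<in>K. y k)"
  note sub = subspace_deg_space
  have "?P v"
  proof (rule span_induct[OF assms[unfolded deg_string_def], of ?P])
    show "subspace (Collect ?P)"
    proof (rule subspaceI)
      show "0 \<in> Collect ?P"
        by (auto intro!: exI[of _ "{}"] exI[of _ "\<lambda>_. 0"] subspace_0[OF sub])
    next
      fix u w assume "u \<in> Collect ?P" "w \<in> Collect ?P"
      then obtain K y L z where
        *: "finite K" "\<forall>k. y k \<in> deg_space A (\<alpha> + axis i k)" "\<forall>k. k \<notin> K \<longrightarrow> y k = 0" "u = sum y K"
        "finite L" "\<forall>k. z k \<in> deg_space A (\<alpha> + axis i k)" "\<forall>k. k \<notin> L \<longrightarrow> z k = 0" "w = sum z L"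
        by auto
      have "sum y K = sum y (K \<union> L)" "sum z L = sum z (K \<union> L)"
        using * by (auto intro!: sum.mono_neutral_left)
      then show "u + w \<in> Collect ?P"
        using * by (auto intro!: exI[of _ "K \<union> L"] exI[of _ "\<lambda>k. y k + z k"] subspace_add[OF sub]
            simp: sum.distrib)
    next
      fix c u assume "u \<in> Collect ?P"
      then obtain K y where
        *: "finite K" "\<forall>k. y k \<in> deg_space A (\<alpha> + axis i k)" "\<forall>k. k \<notin> K \<longrightarrow> y k = 0" "u = sum y K"
        by auto
      then show "c *\<^sub>R u \<in> Collect ?P"
        by (auto intro!: exI[of _ K] exI[of _ "\<lambda>k. c *\<^sub>R y k"] subspace_scale[OF sub]
            simp: scaleR_sum_right)
    qed
  next
    fix x assume "x \<in> (\<Union>k. deg_space A (\<alpha> + axis i k))"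
    then obtain k where "x \<in> deg_space A (\<alpha> + axis i k)" by blast
    then show "?P x"
      by (intro exI[of _ "{k}"] exI[of _ "\<lambda>l. if l = k then x else 0"])
         (auto simp: subspace_0[OF sub])
  qed
  then show ?thesis by blast
qed

text \<open>The weights \<open>c\<^sub>k\<close> of \<open>h\<^sub>i\<close> along the string are pairwise different. The operator
  \<open>(ad h\<^sub>i - c\<^sub>k) / (c\<^sub>l - c\<^sub>k)\<close> with \<open>l = k0\<close> fixes \<open>v\<close> and removes the component of index \<open>k\<close>. Doing this for all
  \<open>k \<noteq> k0\<close> leaves a member of degree \<open>\<alpha> + k0 \<alpha>\<^sub>i\<close>. The argument works although the degree spaces of the
  presented algebra are not known to be independent.\<close>

lemma eigenvector_in_deg_space:
  assumes A: "gcm A" and "finite K" "\<And>k. y k \<in> deg_space A (\<alpha> + axis i k)" "v = (\<Sum>k\<in>K. y k)"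
    and "br (vH A i) v = of_int (pairing A i (\<alpha> + axis i k0)) *\<^sub>R v"
  shows "v \<in> deg_space A (\<alpha> + axis i k0)"
  using assms(2-)
proof (induction "card (K - {k0})" arbitrary: K y v)
  case 0
  then have "K \<subseteq> {k0}" by auto
  then consider "K = {}" | "K = {k0}" by blast
  then show ?case
    using 0 subspace_0[OF subspace_deg_space] by cases auto
next
  case (Suc n)
  then obtain k where k: "k \<in> K" "k \<noteq> k0"
    by (metis Diff_iff card_eq_0_iff ex_in_conv nat.distinct(1) singletonI)
  define c where "c l = real_of_int (pairing A i (\<alpha> + axis i l))" for l
  have cc: "c l - c k = 2 * (real_of_int l - real_of_int k)" for l
    using A by (simp add: c_def gcm_diag)
  have ne: "c k0 - c k \<noteq> 0" using k by (simp add: cc)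
  have "(c k0 - c k) *\<^sub>R v = br (vH A i) v - c k *\<^sub>R v"
    using Suc.prems(4) unfolding c_def[symmetric] by (simp add: scaleR_diff_left)
  also have "\<dots> = (\<Sum>l\<in>K. (c l - c k) *\<^sub>R y l)"
    unfolding Suc.prems(3)
    by (simp only: linear_sum[OF linear_br] deg_space_weight[OF Suc.prems(2)] scaleR_sum_right
        scaleR_diff_left sum_subtractf c_def)
  also have "\<dots> = (\<Sum>l\<in>K - {k}. (c l - c k) *\<^sub>R y l)"
    using k Suc.prems(1) by (simp add: sum.remove)
  finally have "(1 / (c k0 - c k)) *\<^sub>R ((c k0 - c k) *\<^sub>R v)
      = (1 / (c k0 - c k)) *\<^sub>R (\<Sum>l\<in>K - {k}. (c l - c k) *\<^sub>R y l)"
    by (rule arg_cong)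
  then have v: "v = (\<Sum>l\<in>K - {k}. ((c l - c k) / (c k0 - c k)) *\<^sub>R y l)"
    using ne by (simp add: scaleR_sum_right)
  have "K - {k0} = insert k (K - {k} - {k0})" using k by auto
  then have "card (K - {k0}) = Suc (card (K - {k} - {k0}))"
    using Suc.prems(1) by simp
  then have card: "n = card (K - {k} - {k0})"
    using Suc.hyps(2) by simp
  show ?case
    by (rule Suc.hyps(1)[OF card _ _ v])
       (simp_all add: Suc.prems(1,4) subspace_scale[OF subspace_deg_space Suc.prems(2)])
qed

text \<open>The image lies in the string, and because \<open>h\<^sub>i\<close> is mapped to \<open>- h\<^sub>i\<close> it has the weight of \<open>s\<^sub>i \<alpha>\<close>.\<close>

lemma deg_space_reflV:
  assumes A: "gcm A" and v: "v \<in> deg_space A \<alpha>"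
  shows "reflV A i v \<in> deg_space A (refl_root A i \<alpha>)"
proof -
  have "v \<in> deg_space A (\<alpha> + axis i 0)"
    using v by (metis add.right_neutral axis_eq_0_iff)
  then have "v \<in> deg_string A i \<alpha>"
    unfolding deg_string_def by (intro span_base) blast
  from deg_string_sum[OF deg_string_reflV[OF this]]
  obtain K y where K: "finite K" "\<And>k. y k \<in> deg_space A (\<alpha> + axis i k)" "reflV A i v = sum y K"
    by blast
  have "br (vH A i) (reflV A i v) = - br (reflV A i (vH A i)) (reflV A i v)"
    by (simp add: reflV_gens[OF A])
  also have "\<dots> = - (of_int (pairing A i \<alpha>) *\<^sub>R reflV A i v)"
    by (simp add: reflV_br[symmetric] deg_space_weight[OF v] linear_cmul[OF linear_reflV])
  finally have "br (vH A i) (reflV A i v)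
      = of_int (pairing A i (\<alpha> + axis i (- pairing A i \<alpha>))) *\<^sub>R reflV A i v"
    by (simp add: gcm_diag[OF A] del: axis_minus)
  from eigenvector_in_deg_space[OF A K this]
  show ?thesis by (simp add: refl_root_pairing)
qed

lemma root_space_refl_lie:
  "gcm A \<Longrightarrow> root_space A \<alpha> x \<Longrightarrow> root_space A (refl_root A i \<alpha>) (refl_lie A i x)"
  by (simp add: root_space_iff cl_refl_lie deg_space_reflV)

subsection \<open>Triangular decomposition\<close>

lemma exI2: "P x y \<Longrightarrow> \<exists>x y. P x y" by blast
lemma exI3: "P x y z \<Longrightarrow> \<exists>x y z. P x y z" by blast

text \<open>The flag chooses between the \<open>e\<^sub>i\<close> and the \<open>f\<^sub>i\<close>, so that both nilpotent halves share their proofs.\<close>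

definition gen :: "int^'n^'n \<Rightarrow> bool \<Rightarrow> 'n::finite \<Rightarrow> 'n lie_family" where
  "gen A b i = (if b then vE A i else vF A i)"

definition sg :: "bool \<Rightarrow> int" where
  "sg b = (if b then 1 else - 1)"

lemma sg_simps [simp]: "sg True = 1" "sg False = - 1" "sg (\<not> b) = - sg b" "sg b * sg b = 1" "sg b \<noteq> 0"
  by (auto simp: sg_def)

inductive nil_part :: "int^'n^'n \<Rightarrow> bool \<Rightarrow> int^'n \<Rightarrow> ('n::finite) lie_family \<Rightarrow> bool"
  for A b where
  np_gen: "nil_part A b (axis i (sg b)) (gen A b i)"
| np_zero: "nil_part A b \<beta> 0"
| np_add: "nil_part A b \<beta> u \<Longrightarrow> nil_part A b \<beta> v \<Longrightarrow> nil_part A b \<beta> (u + v)"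
| np_scale: "nil_part A b \<beta> v \<Longrightarrow> nil_part A b \<beta> (c *\<^sub>R v)"
| np_br: "nil_part A b \<beta> v \<Longrightarrow> nil_part A b (axis i (sg b) + \<beta>) (br (gen A b i) v)"

lemma gen_deg: "gen A b i \<in> deg_space A (axis i (sg b))"
  by (cases b) (auto simp: gen_def)

lemma nil_part_deg: "nil_part A b \<beta> v \<Longrightarrow> v \<in> deg_space A \<beta>"
  by (induction rule: nil_part.induct)
     (auto intro: gen_deg deg_space_br subspace_0 subspace_add subspace_scale subspace_deg_space)

lemma br_gen_opposite:
  "br (gen A (\<not> b) i) (gen A b j) = (if i = j then - of_int (sg b) *\<^sub>R vH A i else 0)"
  by (cases b) (auto simp: gen_def br_EF br_FE)

lemma br_gen_H: "br (gen A b j) (vH A i) = of_int (- sg b * A$i$j) *\<^sub>R gen A b j"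
  by (cases b) (auto simp: gen_def)

lemma br_gen_cartan:
  assumes "h \<in> span (range (vH A))"
  shows "\<exists>c. br (gen A b j) h = c *\<^sub>R gen A b j"
proof (rule span_induct[OF assms])
  show "subspace {h. \<exists>c. br (gen A b j) h = c *\<^sub>R gen A b j}"
    by (rule subspaceI) (auto intro: exI[of _ 0] simp flip: scaleR_add_left)
  show "\<exists>c. br (gen A b j) h = c *\<^sub>R gen A b j" if "h \<in> range (vH A)" for h
    using that br_gen_H by blast
qed

text \<open>An opposite generator moves an iterated bracket back towards the Cartan part: by the Jacobi identity
  it either cancels one factor, leaving a scalar, or passes on to the rest.\<close>

lemma br_opposite_nil_part:
  assumes "nil_part A b \<beta> v"
  shows "\<exists>h w. br (gen A (\<not> b) i) v = h + w \<and> h \<in> span (range (vH A)) \<and>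
     (axis i (- sg b) + \<beta> \<noteq> 0 \<longrightarrow> h = 0) \<and> nil_part A b (axis i (- sg b) + \<beta>) w"
  using assms
proof induction
  case (np_gen j)
  show ?case
  proof (cases "i = j")
    case True
    then show ?thesis
      by (intro exI2[of _ "- of_int (sg b) *\<^sub>R vH A i" 0])
         (auto simp: br_gen_opposite nil_part.np_zero intro: span_base intro!: span_scale span_neg)
  next
    case False
    then show ?thesis
      by (intro exI[of _ 0]) (auto simp: br_gen_opposite nil_part.np_zero span_zero)
  qed
next
  case (np_zero \<beta>)
  show ?case by (intro exI[of _ 0]) (auto simp: nil_part.np_zero span_zero)
next
  case (np_add \<beta> u v)
  then obtain h w h' w' where
    "br (gen A (\<not> b) i) u = h + w" "h \<in> span (range (vH A))"
    "axis i (- sg b) + \<beta> \<noteq> 0 \<longrightarrow> h = 0" "nil_part A b (axis i (- sg b) + \<beta>) w"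
    "br (gen A (\<not> b) i) v = h' + w'" "h' \<in> span (range (vH A))"
    "axis i (- sg b) + \<beta> \<noteq> 0 \<longrightarrow> h' = 0" "nil_part A b (axis i (- sg b) + \<beta>) w'"
    by metis
  then show ?case
    by (intro exI2[of _ "h + h'" "w + w'"])
       (auto intro: nil_part.np_add span_add)
next
  case (np_scale \<beta> v c)
  then obtain h w where
    "br (gen A (\<not> b) i) v = h + w" "h \<in> span (range (vH A))"
    "axis i (- sg b) + \<beta> \<noteq> 0 \<longrightarrow> h = 0" "nil_part A b (axis i (- sg b) + \<beta>) w"
    by metis
  then show ?case
    by (intro exI2[of _ "c *\<^sub>R h" "c *\<^sub>R w"])
       (auto intro: nil_part.np_scale span_scale simp: scaleR_add_right)
next
  case (np_br \<beta> v j)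
  then obtain h w where
    hw: "br (gen A (\<not> b) i) v = h + w" "h \<in> span (range (vH A))"
    "axis i (- sg b) + \<beta> \<noteq> 0 \<longrightarrow> h = 0" "nil_part A b (axis i (- sg b) + \<beta>) w"
    by metis
  define d where "d = axis i (- sg b) + (axis j (sg b) + \<beta>)"
  have "nil_part A b d (br (br (gen A (\<not> b) i) (gen A b j)) v)"
  proof (cases "i = j")
    case True
    have d: "d = \<beta>" by (simp add: d_def True)
    have "br (br (gen A (\<not> b) i) (gen A b j)) v = (- of_int (sg b) * of_int (pairing A i \<beta>)) *\<^sub>R v"
      using True deg_space_weight[OF nil_part_deg[OF np_br.hyps]] by (simp add: br_gen_opposite)
    then show ?thesis
      unfolding d using nil_part.np_scale[OF np_br.hyps] by metis
  qed (simp add: br_gen_opposite nil_part.np_zero)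
  moreover have "nil_part A b d (br (gen A b j) h)"
  proof (cases "axis i (- sg b) + \<beta> = 0")
    case True
    then have d: "d = axis j (sg b)" by (simp add: d_def add.left_commute)
    obtain c where "br (gen A b j) h = c *\<^sub>R gen A b j" using br_gen_cartan[OF hw(2)] by blast
    then show ?thesis unfolding d by (simp add: nil_part.np_scale nil_part.np_gen)
  next
    case False
    then show ?thesis using hw(3) by (simp add: nil_part.np_zero)
  qed
  moreover have "nil_part A b d (br (gen A b j) w)"
    using nil_part.np_br[OF hw(4), of j] by (simp add: d_def add.left_commute)
  ultimately have "nil_part A b d (br (gen A (\<not> b) i) (br (gen A b j) v))"
    unfolding br_jacobi[of "gen A (\<not> b) i"] hw(1) br_simps by (intro nil_part.np_add)
  then show ?case
    unfolding d_def
    by (intro exI2[of _ 0 "br (gen A (\<not> b) i) (br (gen A b j) v)"]) (auto simp: span_zero)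
qed

text \<open>Degree by degree, the decomposition \<open>\<gg> = \<nn>\<^sub>+ + \<hh> + \<nn>\<^sub>-\<close>, as a sum that need not be direct.\<close>

definition triangular :: "int^'n^'n \<Rightarrow> int^'n \<Rightarrow> ('n::finite) lie_family \<Rightarrow> bool" where
  "triangular A \<beta> v \<longleftrightarrow> (\<exists>u h w. v = u + h + w \<and> nil_part A True \<beta> u \<and> nil_part A False \<beta> w \<and>
     h \<in> span (range (vH A)) \<and> (\<beta> \<noteq> 0 \<longrightarrow> h = 0))"

lemma triangular_sym:
  "triangular A \<beta> v \<longleftrightarrow> (\<exists>u h w. v = u + h + w \<and> nil_part A b \<beta> u \<and> nil_part A (\<not> b) \<beta> w \<and>
     h \<in> span (range (vH A)) \<and> (\<beta> \<noteq> 0 \<longrightarrow> h = 0))"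
proof (cases b)
  case False
  have comm: "u + h + w = w + h + u" for u h w :: "'a lie_family" by (simp add: ac_simps)
  show ?thesis
    unfolding triangular_def
  proof (rule iffI; elim exE conjE)
    fix u h w
    assume "v = u + h + w" "nil_part A True \<beta> u" "nil_part A False \<beta> w"
      "h \<in> span (range (vH A))" "\<beta> \<noteq> 0 \<longrightarrow> h = 0"
    then show "\<exists>u h w. v = u + h + w \<and> nil_part A b \<beta> u \<and> nil_part A (\<not> b) \<beta> w \<and>
        h \<in> span (range (vH A)) \<and> (\<beta> \<noteq> 0 \<longrightarrow> h = 0)"
      using False comm[of u h w] by (intro exI3[of _ w h u]) simp
  next
    fix u h w
    assume "v = u + h + w" "nil_part A b \<beta> u" "nil_part A (\<not> b) \<beta> w"
      "h \<in> span (range (vH A))" "\<beta> \<noteq> 0 \<longrightarrow> h = 0"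
    then show "\<exists>u h w. v = u + h + w \<and> nil_part A True \<beta> u \<and> nil_part A False \<beta> w \<and>
        h \<in> span (range (vH A)) \<and> (\<beta> \<noteq> 0 \<longrightarrow> h = 0)"
      using False comm[of u h w] by (intro exI3[of _ w h u]) simp
  qed
qed (simp add: triangular_def)

lemma triangular_nil: "nil_part A b \<beta> v \<Longrightarrow> triangular A \<beta> v"
  unfolding triangular_sym[of A \<beta> v b]
  by (intro exI3[of _ v 0 0]) (auto intro: np_zero span_zero)

lemma triangular_cartan: "h \<in> span (range (vH A)) \<Longrightarrow> triangular A 0 h"
  unfolding triangular_def
  by (intro exI3[of _ 0 h 0]) (auto intro: np_zero)

lemma triangular_zero: "triangular A \<beta> 0"
  using triangular_nil[OF np_zero] .

lemma triangular_add: "triangular A \<beta> u \<Longrightarrow> triangular A \<beta> v \<Longrightarrow> triangular A \<beta> (u + v)"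
  unfolding triangular_def
proof (elim exE conjE)
  fix u1 h1 w1 u2 h2 w2
  assume "u = u1 + h1 + w1" "v = u2 + h2 + w2" "nil_part A True \<beta> u1" "nil_part A True \<beta> u2"
    "nil_part A False \<beta> w1" "nil_part A False \<beta> w2"
    "h1 \<in> span (range (vH A))" "h2 \<in> span (range (vH A))" "\<beta> \<noteq> 0 \<longrightarrow> h1 = 0" "\<beta> \<noteq> 0 \<longrightarrow> h2 = 0"
  then show "\<exists>u' h w. u + v = u' + h + w \<and> nil_part A True \<beta> u' \<and> nil_part A False \<beta> w \<and>
     h \<in> span (range (vH A)) \<and> (\<beta> \<noteq> 0 \<longrightarrow> h = 0)"
    by (intro exI3[of _ "u1 + u2" "h1 + h2" "w1 + w2"])
       (auto intro: np_add span_add)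
qed

lemma triangular_scale: "triangular A \<beta> v \<Longrightarrow> triangular A \<beta> (c *\<^sub>R v)"
  unfolding triangular_def
proof (elim exE conjE)
  fix u h w
  assume "v = u + h + w" "nil_part A True \<beta> u" "nil_part A False \<beta> w"
    "h \<in> span (range (vH A))" "\<beta> \<noteq> 0 \<longrightarrow> h = 0"
  then show "\<exists>u' h w. c *\<^sub>R v = u' + h + w \<and> nil_part A True \<beta> u' \<and> nil_part A False \<beta> w \<and>
     h \<in> span (range (vH A)) \<and> (\<beta> \<noteq> 0 \<longrightarrow> h = 0)"
    by (intro exI3[of _ "c *\<^sub>R u" "c *\<^sub>R h" "c *\<^sub>R w"])
       (auto intro: np_scale span_scale simp: scaleR_add_right)
qed

lemma triangular_br_gen:
  assumes "triangular A \<beta> v"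
  shows "triangular A (axis i (sg b) + \<beta>) (br (gen A b i) v)"
proof -
  obtain u h w where v: "v = u + h + w" and u: "nil_part A b \<beta> u" and w: "nil_part A (\<not> b) \<beta> w"
    and h: "h \<in> span (range (vH A))" "\<beta> \<noteq> 0 \<longrightarrow> h = 0"
    using assms unfolding triangular_sym[of A \<beta> v b] by blast
  have "triangular A (axis i (sg b) + \<beta>) (br (gen A b i) u)"
    by (rule triangular_nil[OF np_br[OF u]])
  moreover have "triangular A (axis i (sg b) + \<beta>) (br (gen A b i) h)"
  proof (cases "\<beta> = 0")
    case True
    obtain c where "br (gen A b i) h = c *\<^sub>R gen A b i" using br_gen_cartan[OF h(1)] by blast
    then show ?thesis
      using True by (simp add: triangular_scale triangular_nil[OF np_gen])
  qed (use h in \<open>simp add: triangular_zero\<close>)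
  moreover have "triangular A (axis i (sg b) + \<beta>) (br (gen A b i) w)"
  proof -
    obtain h' w' where hw: "br (gen A b i) w = h' + w'" "h' \<in> span (range (vH A))"
      "axis i (sg b) + \<beta> \<noteq> 0 \<longrightarrow> h' = 0" "nil_part A (\<not> b) (axis i (sg b) + \<beta>) w'"
      using br_opposite_nil_part[OF w, of i] by auto
    have "triangular A (axis i (sg b) + \<beta>) h'"
      using hw(2,3) by (cases "axis i (sg b) + \<beta> = 0") (auto simp: triangular_cartan triangular_zero)
    then show ?thesis
      unfolding hw(1) by (rule triangular_add[OF _ triangular_nil[OF hw(4)]])
  qed
  ultimately show ?thesis
    unfolding v br_simps by (intro triangular_add)
qed

lemma triangular_br_H:
  assumes "triangular A \<beta> v"
  shows "triangular A \<beta> (br (vH A i) v)"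
proof -
  obtain u h w where v: "v = u + h + w" and u: "nil_part A True \<beta> u" and w: "nil_part A False \<beta> w"
    and h: "h \<in> span (range (vH A))"
    using assms unfolding triangular_def by blast
  have "br (vH A i) h = 0"
    by (rule span_induct[OF h]) (auto intro!: subspaceI)
  then show ?thesis
    unfolding v br_simps deg_space_weight[OF nil_part_deg[OF u]] deg_space_weight[OF nil_part_deg[OF w]]
    by (intro triangular_add triangular_scale triangular_nil[OF u] triangular_nil[OF w])
       (simp add: triangular_zero)
qed

text \<open>The stability under \<open>ad x\<close> carries the induction over brackets, since
  \<open>ad [x, y] = [ad x, ad y]\<close>.\<close>

lemma root_space_triangular:
  assumes "root_space A \<alpha> x"
  shows "triangular A \<alpha> (cl A x)" "triangular A \<beta> v \<Longrightarrow> triangular A (\<alpha> + \<beta>) (br (cl A x) v)"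
proof -
  have "triangular A \<alpha> (cl A x) \<and> (\<forall>\<beta> v. triangular A \<beta> v \<longrightarrow> triangular A (\<alpha> + \<beta>) (br (cl A x) v))"
    using assms
  proof induction
    case (1 i)
    show ?case
      using triangular_nil[OF np_gen[of A True i]] triangular_br_gen[of A _ _ i True] by (simp add: gen_def)
  next
    case (2 i)
    show ?case
      using triangular_nil[OF np_gen[of A False i]] triangular_br_gen[of A _ _ i False] by (simp add: gen_def)
  next
    case (3 i)
    show ?case by (auto intro: triangular_br_H triangular_cartan span_base)
  next
    case (7 \<alpha> x \<beta> y)
    have "triangular A (\<alpha> + \<beta> + \<gamma>) (br (cl A (LBr x y)) v)" if v: "triangular A \<gamma> v" for \<gamma> v
    proof -
      have "triangular A (\<alpha> + (\<beta> + \<gamma>)) (br (cl A x) (br (cl A y) v))"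
        using 7 v by blast
      moreover have "triangular A (\<beta> + (\<alpha> + \<gamma>)) (br (cl A y) (br (cl A x) v))"
        using 7 v by blast
      moreover have "br (cl A (LBr x y)) v
          = br (cl A x) (br (cl A y) v) + (- 1) *\<^sub>R br (cl A y) (br (cl A x) v)"
        by (simp add: cl_simps br_jacobi[of "cl A x" "cl A y"])
      ultimately show ?thesis
        by (simp only: ac_simps) (intro triangular_add triangular_scale; simp add: ac_simps)
    qed
    then show ?case using 7 by (simp add: cl_simps)
  next
    case (8 \<alpha> x y)
    then show ?case by (simp add: cl_eq_iff[symmetric])
  qed (auto simp: cl_simps triangular_zero intro: triangular_add triangular_scale)
  then show "triangular A \<alpha> (cl A x)"
    "triangular A \<beta> v \<Longrightarrow> triangular A (\<alpha> + \<beta>) (br (cl A x) v)" by blast+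
qed

definition height :: "int^'n::finite \<Rightarrow> int" where
  "height \<beta> = (\<Sum>i\<in>UNIV. \<beta>$i)"

lemma height_simps [simp]: "height (\<alpha> + \<beta>) = height \<alpha> + height \<beta>" "height (axis i c) = c"
  "height (- \<alpha>) = - height \<alpha>"
  by (simp_all add: height_def sum.distrib axis_def sum_negf)

text \<open>A bracket of several generators has height at least two in absolute value.\<close>

lemma nil_part_height:
  assumes "nil_part A b \<beta> v"
  shows "v = 0 \<or> sg b * height \<beta> > 1 \<or> (\<exists>j c. \<beta> = axis j (sg b) \<and> v = c *\<^sub>R gen A b j)"
  using assms
proof induction
  case (np_gen i)
  show ?case by (intro disjI2 exI[of _ i] exI[of _ 1]) simp
next
  case (np_add \<beta> u v)
  have "axis i (sg b) = axis j (sg b) \<longleftrightarrow> i = j" for i j :: 'a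
    by (simp add: axis_eq_axis)
  with np_add show ?case
    by (auto simp flip: scaleR_add_left) (metis add_cancel_right_left)?
next
  case (np_scale \<beta> v c)
  then show ?case by auto
next
  case (np_br \<beta> v i)
  then show ?case by (auto simp: distrib_left)
qed simp

text \<open>In height one, \<open>\<nn>\<^sub>+\<close> contains only multiples of the \<open>e\<^sub>j\<close>, and the other two summands vanish.\<close>

lemma root_space_simple:
  assumes "root_space A (axis i 1) x"
  shows "\<exists>c. lie_eq A x (LScale c (GenE i))"
proof -
  obtain u h w where v: "cl A x = u + h + w" and u: "nil_part A True (axis i 1) u"
    and w: "nil_part A False (axis i 1) w" and h: "(axis i 1 :: int^'a) \<noteq> 0 \<longrightarrow> h = 0"
    using root_space_triangular(1)[OF assms] unfolding triangular_def by blast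
  have h0: "h = 0" using h by (simp add: axis_eq_0_iff)
  have w0: "w = 0"
    using nil_part_height[OF w] by (auto dest: arg_cong[of _ _ height])
  have "\<exists>c. u = c *\<^sub>R vE A i"
    using nil_part_height[OF u] by (auto simp: gen_def axis_eq_axis intro: exI[of _ 0])
  then obtain c where "cl A x = cl A (LScale c (GenE i))"
    by (auto simp: v h0 w0 cl_simps)
  then show ?thesis unfolding cl_eq_iff by blast
qed

subsection \<open>The Chevalley involution\<close>

text \<open>The Chevalley involution, with \<open>e\<^sub>i \<mapsto> - f\<^sub>i\<close> and \<open>h\<^sub>i \<mapsto> - h\<^sub>i\<close>.\<close>

primrec lie_omega :: "'n lie_term \<Rightarrow> 'n lie_term" where
  "lie_omega (GenE i) = LScale (-1) (GenF i)"
| "lie_omega (GenF i) = LScale (-1) (GenE i)"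
| "lie_omega (GenH i) = LScale (-1) (GenH i)"
| "lie_omega LZero = LZero"
| "lie_omega (LAdd x y) = LAdd (lie_omega x) (lie_omega y)"
| "lie_omega (LScale c x) = LScale c (lie_omega x)"
| "lie_omega (LBr x y) = LBr (lie_omega x) (lie_omega y)"

lemma lie_omega_funpow: "lie_omega ((LBr x ^^ k) y) = (LBr (lie_omega x) ^^ k) (lie_omega y)"
  by (induction k) simp_all

lemma lie_omega_sum: "lie_omega (lie_sum f k) = lie_sum (\<lambda>i. lie_omega (f i)) k"
  by (induction k) simp_all

lemma funpow_br_uminus: "(br (- x) ^^ k) (- y) = (- 1) ^ Suc k *\<^sub>R (br x ^^ k) y"
  by (induction k) simp_all

lemma cl_lie_omega_cong:
  assumes "lie_eq A x y"
  shows "cl A (lie_omega x) = cl A (lie_omega y)"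
  using assms
proof induction
  case (lie_jacobi x y z)
  have "cl A (LAdd (LBr (lie_omega x) (LBr (lie_omega y) (lie_omega z)))
      (LAdd (LBr (lie_omega y) (LBr (lie_omega z) (lie_omega x)))
        (LBr (lie_omega z) (LBr (lie_omega x) (lie_omega y))))) = cl A LZero"
    by (intro cl_eqI lie_eq.lie_jacobi)
  then show ?case by simp
next
  case (lie_rel_ef i)
  show ?case by (simp add: cl_simps br_FE)
next
  case (lie_rel_ef_ne i j)
  then show ?case by (simp add: cl_simps br_FE)
next
  case (lie_serre_e i j)
  then show ?case by (simp add: lie_omega_funpow cl_funpow_br cl_simps funpow_br_uminus serre_F)
next
  case (lie_serre_f i j)
  then show ?case by (simp add: lie_omega_funpow cl_funpow_br cl_simps funpow_br_uminus serre_E)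
qed (simp_all add: cl_simps scaleR_add_left scaleR_add_right)

lemma cl_lie_omega_invol: "cl A (lie_omega (lie_omega x)) = cl A x"
  by (induction x) (simp_all add: cl_simps)

lemma lie_omega_eq_iff: "lie_eq A (lie_omega x) (lie_omega y) \<longleftrightarrow> lie_eq A x y"
  using cl_lie_omega_cong[of A x y] cl_lie_omega_cong[of A "lie_omega x" "lie_omega y"]
  by (auto simp: cl_lie_omega_invol cl_eq_iff)

lemma root_space_omega: "root_space A \<alpha> x \<Longrightarrow> root_space A (- \<alpha>) (lie_omega x)"
proof (induction rule: root_space.induct)
  case (7 \<alpha> x \<beta> y)
  then have "root_space A (- \<alpha> + - \<beta>) (lie_omega (LBr x y))"
    unfolding lie_omega.simps by (intro root_space.intros(7))
  then show ?case by simp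
next
  case (8 \<alpha> x y)
  then show ?case by (metis lie_omega_eq_iff root_space.intros(8))
next
  case (2 i)
  have "root_space A (axis i 1) (LScale (- 1) (GenE i))"
    by (intro root_space.intros)
  then show ?case by simp
qed (auto intro: root_space.intros)

lemma lie_omega_exp_ad: "lie_omega (exp_ad A x y) = exp_ad A (lie_omega x) (lie_omega y)"
proof -
  have "lie_eq A ((LBr (lie_omega x) ^^ N) (lie_omega y)) LZero \<longleftrightarrow> lie_eq A ((LBr x ^^ N) y) LZero" for N
    using lie_omega_eq_iff[of A "(LBr x ^^ N) y" LZero] by (simp add: lie_omega_funpow)
  then show ?thesis
    by (simp add: exp_ad_def lie_omega_sum lie_omega_funpow)
qed

text \<open>The involution turns the product of exponentials into the one with \<open>e\<^sub>i\<close> and \<open>- f\<^sub>i\<close> exchanged, which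
  by \<open>reflV_alt\<close> is the same operator.\<close>

lemma lie_omega_refl:
  assumes "gcm A"
  shows "lie_eq A (lie_omega (refl_lie A i x)) (refl_lie A i (lie_omega x))"
  unfolding cl_eq_iff[symmetric] cl_refl_lie reflV_alt[OF assms]
  by (simp add: refl_lie_def lie_omega_exp_ad cl_exp_ad cl_simps)

section \<open>Words modulo the relations of the Kac--Moody group\<close>

text \<open>As for the algebras, a product over all matrices turns \<open>km_eq A\<close> into equality in one monoid type.\<close>

quotient_type 'n word_family = "int^'n^'n \<Rightarrow> ('n::finite) km_letter list" /
  "\<lambda>f g. \<forall>A. km_eq A (f A) (g A)"
  by (rule equivpI) (auto simp: reflp_def symp_def transp_def intro: km_refl km_sym km_trans)

instantiation word_family :: (finite) monoid_mult
begin

lift_definition one_word_family :: "'a word_family" is "\<lambda>_. []" .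
lift_definition times_word_family :: "'a word_family \<Rightarrow> 'a word_family \<Rightarrow> 'a word_family"
  is "\<lambda>f g A. f A @ g A" by (auto intro: km_cong)

instance
  by (standard; transfer) (auto intro: km_refl)

end

definition wd :: "int^'n^'n \<Rightarrow> ('n::finite) km_letter list \<Rightarrow> 'n word_family" where
  "wd A w = abs_word_family (\<lambda>B. if B = A then w else [])"

lemma wd_eq_iff: "wd A u = wd A v \<longleftrightarrow> km_eq A u v"
  unfolding wd_def word_family.abs_eq_iff by (auto intro: km_refl)

lemmas wd_eqI = wd_eq_iff[THEN iffD2]

lemma wd_Nil: "wd A [] = 1"
  unfolding wd_def one_word_family_def by simp

lemma wd_append: "wd A (u @ v) = wd A u * wd A v"
  unfolding wd_def times_word_family.abs_eq word_family.abs_eq_iff by (auto intro: km_refl)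

lemma wd_Cons: "wd A (l # w) = wd A [l] * wd A w"
  using wd_append[of A "[l]" w] by simp

text \<open>The elements \<open>t\<close>, \<open>x(X)\<close>, \<open>x\<^sub>i(c) = x(c e\<^sub>i)\<close>, \<open>y\<^sub>i(c) = x(c f\<^sub>i)\<close>, \<open>s\<^sub>i\<close> and \<open>r^\<alpha>\<^sub>i\<^sup>\<or>\<close> of this monoid.\<close>

definition wT :: "int^'n^'n \<Rightarrow> real^'n \<Rightarrow> ('n::finite) word_family" where "wT A t = wd A [Tor t]"
definition wR :: "int^'n^'n \<Rightarrow> 'n lie_term \<Rightarrow> ('n::finite) word_family" where "wR A x = wd A [Root x]"
definition wX :: "int^'n^'n \<Rightarrow> 'n \<Rightarrow> real \<Rightarrow> ('n::finite) word_family" where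
  "wX A i c = wR A (LScale c (GenE i))"
definition wY :: "int^'n^'n \<Rightarrow> 'n \<Rightarrow> real \<Rightarrow> ('n::finite) word_family" where
  "wY A i c = wR A (LScale c (GenF i))"
definition wS :: "int^'n^'n \<Rightarrow> 'n \<Rightarrow> ('n::finite) word_family" where "wS A i = wd A (s_word i 1)"
definition wH :: "int^'n^'n \<Rightarrow> 'n \<Rightarrow> real \<Rightarrow> ('n::finite) word_family" where
  "wH A i r = wT A (coroot_tor i r)"

lemma wd_s_word: "wd A (s_word i r) = wX A i r * wY A i (- 1 / r) * wX A i r"
  by (simp add: s_word_def wX_def wY_def wR_def mult.assoc wd_Cons[of A _ "_ # _"])

lemma wS_eq: "wS A i = wX A i 1 * wY A i (- 1) * wX A i 1"
  by (simp add: wS_def wd_s_word)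

subsection \<open>Real roots\<close>

lemma real_rootsI: "foldr (refl_root A) js (axis i 1) \<in> real_roots A"
  by (auto simp: real_roots_def generated_maps_def)

lemma real_roots_obtain:
  assumes "\<alpha> \<in> real_roots A"
  obtains js i where "\<alpha> = foldr (refl_root A) js (axis i 1)"
  using assms by (auto simp: real_roots_def generated_maps_def)

lemma foldr_refl_root_rev:
  assumes "gcm A"
  shows "foldr (refl_root A) (rev js) (foldr (refl_root A) js \<beta>) = \<beta>"
  by (induction js) (simp_all add: refl_root_invol[OF assms])

lemma foldr_refl_root_uminus: "foldr (refl_root A) js (- \<beta>) = - foldr (refl_root A) js \<beta>"
  by (induction js) (simp_all add: refl_root_uminus)

lemma refl_root_simple: "gcm A \<Longrightarrow> refl_root A i (axis i 1) = - axis i 1"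
  by (simp add: refl_root_pairing gcm_diag flip: axis_minus axis_add)
     (simp add: axis_def vec_eq_iff)

lemma real_roots_simple: "axis i 1 \<in> real_roots A"
  using real_rootsI[of A "[]"] by simp

lemma real_roots_uminus:
  assumes "gcm A" "\<alpha> \<in> real_roots A"
  shows "- \<alpha> \<in> real_roots A"
proof -
  obtain js i where "\<alpha> = foldr (refl_root A) js (axis i 1)"
    using assms(2) by (rule real_roots_obtain)
  then have "- \<alpha> = foldr (refl_root A) (js @ [i]) (axis i 1)"
    using assms(1) by (simp add: refl_root_simple foldr_refl_root_uminus)
  then show ?thesis by (metis real_rootsI)
qed

lemma real_roots_refl: "\<alpha> \<in> real_roots A \<Longrightarrow> refl_root A i \<alpha> \<in> real_roots A"
proof -
  assume "\<alpha> \<in> real_roots A"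
  then obtain js j where "\<alpha> = foldr (refl_root A) js (axis j 1)" by (rule real_roots_obtain)
  then have "refl_root A i \<alpha> = foldr (refl_root A) (i # js) (axis j 1)" by simp
  then show ?thesis by (metis real_rootsI)
qed

lemma prenilpotent_self:
  assumes "gcm A" "\<alpha> \<in> real_roots A"
  shows "prenilpotent A \<alpha> \<alpha>"
proof -
  obtain js i where \<alpha>: "\<alpha> = foldr (refl_root A) js (axis i 1)"
    using assms(2) by (rule real_roots_obtain)
  have 1: "foldr (refl_root A) (rev js) \<alpha> = axis i 1"
    using assms(1) by (simp add: \<alpha> foldr_refl_root_rev)
  have 2: "foldr (refl_root A) (i # rev js) \<alpha> = - axis i 1"
    using assms(1) 1 by (simp add: refl_root_simple)
  have gen: "foldr (refl_root A) ks \<in> generated_maps (refl_root A)" for ks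
    by (simp add: generated_maps_def)
  have "\<forall>j. foldr (refl_root A) (rev js) \<alpha> $ j \<ge> 0"
    unfolding 1 by (simp add: axis_def)
  then have pos: "\<exists>w \<in> generated_maps (refl_root A). \<forall>j. w \<alpha> $ j \<ge> 0 \<and> w \<alpha> $ j \<ge> 0"
    using gen[of "rev js"] by auto
  have "\<forall>j. foldr (refl_root A) (i # rev js) \<alpha> $ j \<le> 0"
    unfolding 2 by (simp add: axis_def)
  then have neg: "\<exists>w \<in> generated_maps (refl_root A). \<forall>j. w \<alpha> $ j \<le> 0 \<and> w \<alpha> $ j \<le> 0"
    using gen[of "i # rev js"] by blast
  show ?thesis
    unfolding prenilpotent_def using assms(2) pos neg by simp
qed

lemma root_interval_self: "\<alpha> \<in> real_roots A \<Longrightarrow> \<alpha> \<in> root_interval A \<alpha> \<alpha>"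
proof -
  have "\<alpha> = int 1 *s \<alpha> + int 0 *s \<alpha>" by (simp add: vec_eq_iff)
  then show "\<alpha> \<in> real_roots A \<Longrightarrow> \<alpha> \<in> root_interval A \<alpha> \<alpha>"
    unfolding root_interval_def by blast
qed

text \<open>The Steinberg relations for \<open>\<alpha> = \<beta>\<close>: in one root group, words with equal adjoint action are equal.\<close>

lemma km_eq_one_root:
  assumes "gcm A" "\<alpha> \<in> real_roots A" "\<forall>x \<in> set xs \<union> set ys. root_space A \<alpha> x"
    and "\<And>z. cl A (foldr (exp_ad A) xs z) = cl A (foldr (exp_ad A) ys z)"
  shows "wd A (map Root xs) = wd A (map Root ys)"
  using assms(3,4) root_interval_self[OF assms(2)]
  by (intro wd_eqI km_steinberg[OF prenilpotent_self[OF assms(1,2)]]) (auto simp: cl_eq_iff)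

lemma valid_Root: "valid_letter A (Root x) \<longleftrightarrow> (\<exists>\<alpha> \<in> real_roots A. root_space A \<alpha> x)"
  by (simp add: valid_letter_def)

lemma valid_Tor: "valid_letter A (Tor t) \<longleftrightarrow> (\<forall>i. t$i \<noteq> 0)"
  by (simp add: valid_letter_def)

lemma wR_cong:
  assumes "gcm A" "valid_letter A (Root x)" "lie_eq A x y"
  shows "wR A x = wR A y"
proof -
  obtain \<alpha> where \<alpha>: "\<alpha> \<in> real_roots A" "root_space A \<alpha> x"
    using assms(2) by (auto simp: valid_Root)
  have "root_space A \<alpha> y" using \<alpha>(2) assms(3) by (rule root_space.intros)
  with \<alpha> km_eq_one_root[OF assms(1) \<alpha>(1), of "[x]" "[y]"] assms(3)
  show ?thesis by (simp add: wR_def cl_exp_ad cl_eq_iff[symmetric])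
qed

lemma root_space_E: "root_space A (axis i 1) (LScale c (GenE i))"
  by (intro root_space.intros)
lemma root_space_F: "root_space A (- axis i 1) (LScale c (GenF i))"
  by (intro root_space.intros)

lemma valid_E: "valid_letter A (Root (LScale c (GenE i)))"
  using root_space_E[of A i c] real_roots_simple[of i A] by (auto simp: valid_Root)
lemma valid_F: "gcm A \<Longrightarrow> valid_letter A (Root (LScale c (GenF i)))"
  using root_space_F[of A i c] real_roots_uminus[OF _ real_roots_simple[of i A]] by (auto simp: valid_Root)

lemma wX_add: "gcm A \<Longrightarrow> wX A i a * wX A i b = wX A i (a + b)"
  using km_eq_one_root[OF _ real_roots_simple[of i],
      of A "[LScale a (GenE i), LScale b (GenE i)]" "[LScale (a + b) (GenE i)]"]
  by (simp add: root_space_E cl_exp_ad cl_simps nil_exp_br_add[OF locally_nilpotent_E] wX_def wR_def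
      wd_Cons[of A _ "_ # _"])

lemma wY_add: "gcm A \<Longrightarrow> wY A i a * wY A i b = wY A i (a + b)"
  using km_eq_one_root[OF _ real_roots_uminus[OF _ real_roots_simple[of i]],
      of A "[LScale a (GenF i), LScale b (GenF i)]" "[LScale (a + b) (GenF i)]"]
  by (simp add: root_space_F cl_exp_ad cl_simps nil_exp_br_add[OF locally_nilpotent_F] wY_def wR_def
      wd_Cons[of A _ "_ # _"])

lemma wX_0: "gcm A \<Longrightarrow> wX A i 0 = 1"
  using km_eq_one_root[OF _ real_roots_simple[of i], of A "[LScale 0 (GenE i)]" "[]"]
  by (simp add: root_space_E cl_exp_ad cl_simps wX_def wR_def wd_Nil)

lemma wY_0: "gcm A \<Longrightarrow> wY A i 0 = 1"
  using km_eq_one_root[OF _ real_roots_uminus[OF _ real_roots_simple[of i]], of A "[LScale 0 (GenF i)]" "[]"]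
  by (simp add: root_space_F cl_exp_ad cl_simps wY_def wR_def wd_Nil)

lemma wS_wR: "valid_letter A (Root x) \<Longrightarrow> wS A i * wR A x = wR A (refl_lie A i x) * wS A i"
  using km_refl_root[THEN wd_eqI, of A x i] by (simp add: wS_def wR_def wd_append wd_Cons[of A _ "s_word _ _"])

lemma valid_refl_lie: "gcm A \<Longrightarrow> valid_letter A (Root x) \<Longrightarrow> valid_letter A (Root (refl_lie A i x))"
  by (auto simp: valid_Root intro: root_space_refl_lie real_roots_refl)

lemma wS_wX:
  assumes "gcm A"
  shows "wS A i * wX A i c = wY A i (- c) * wS A i"
proof -
  have "cl A (refl_lie A i (LScale c (GenE i))) = cl A (LScale (- c) (GenF i))"
    using assms by (simp add: cl_refl_lie cl_simps linear_cmul[OF linear_reflV] reflV_gens)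
  then show ?thesis
    using wS_wR[OF valid_E] wR_cong[OF assms valid_refl_lie[OF assms valid_E]]
    unfolding wX_def wY_def cl_eq_iff by metis
qed

lemma wS_wY:
  assumes "gcm A"
  shows "wS A i * wY A i c = wX A i (- c) * wS A i"
proof -
  have "cl A (refl_lie A i (LScale c (GenF i))) = cl A (LScale (- c) (GenE i))"
    using assms by (simp add: cl_refl_lie cl_simps linear_cmul[OF linear_reflV] reflV_gens)
  then show ?thesis
    using wS_wR[OF valid_F[OF assms]] wR_cong[OF assms valid_refl_lie[OF assms valid_F[OF assms]]]
    unfolding wX_def wY_def cl_eq_iff by metis
qed

subsection \<open>The rank one relations\<close>

definition wSi :: "int^'n^'n \<Rightarrow> 'n \<Rightarrow> ('n::finite) word_family" where
  "wSi A i = wX A i (- 1) * wY A i 1 * wX A i (- 1)"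

lemma assoc_rule:
  fixes a b c z :: "'a::monoid_mult"
  assumes "a * b = c"
  shows "a * (b * z) = c * z"
  using assms by (simp add: mult.assoc[symmetric])

lemma wS_inverse:
  assumes "gcm A"
  shows "wS A i * wSi A i = 1" "wSi A i * wS A i = 1"
  unfolding wS_eq wSi_def
  by (simp_all add: mult.assoc wX_add[OF assms, THEN assoc_rule] wY_add[OF assms, THEN assoc_rule]
      wX_add[OF assms] wY_add[OF assms] wX_0[OF assms] wY_0[OF assms])

lemma cancel_right:
  fixes a b s s' :: "'a::monoid_mult"
  assumes "s * s' = 1" "a * s = b * s"
  shows "a = b"
  by (metis assms mult.assoc mult.right_neutral)

text \<open>Conjugation by \<open>s\<^sub>i\<close> fixes \<open>s\<^sub>i\<close> but exchanges the letters \<open>x\<^sub>i\<close> and \<open>y\<^sub>i\<close> in its word.\<close>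

lemma wS_alt:
  assumes "gcm A"
  shows "wS A i = wY A i (- 1) * wX A i 1 * wY A i (- 1)"
proof (rule cancel_right[OF wS_inverse(1)[OF assms]])
  have "wS A i * wS A i = wS A i * (wX A i 1 * (wY A i (- 1) * wX A i 1))"
    by (subst (2) wS_eq) (simp add: mult.assoc)
  also have "\<dots> = wY A i (- 1) * wX A i 1 * wY A i (- 1) * wS A i"
    by (simp add: wS_wX[OF assms] wS_wY[OF assms] mult.assoc
        wS_wX[OF assms, THEN assoc_rule] wS_wY[OF assms, THEN assoc_rule])
  finally show "wS A i * wS A i = wY A i (- 1) * wX A i 1 * wY A i (- 1) * wS A i" .
qed

lemma wT_mult: "(\<And>i. s$i \<noteq> 0) \<Longrightarrow> (\<And>i. t$i \<noteq> 0) \<Longrightarrow> wT A s * wT A t = wT A (s * t)"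
  using km_tor_mult[THEN wd_eqI, of A s t] by (simp add: wT_def valid_Tor wd_Cons[of A _ "_ # _"])

lemma wT_one: "wT A 1 = 1"
  using km_tor_one[THEN wd_eqI] by (simp add: wT_def wd_Nil)

lemma wT_wX: "(\<And>i. t$i \<noteq> 0) \<Longrightarrow> wT A t * wX A i c = wX A i (char_tor A i t * c) * wT A t"
  using km_tor_root[THEN wd_eqI, of A t]
  by (simp add: wT_def wX_def wR_def valid_Tor wd_Cons[of A _ "_ # _"])

lemma wS_wT: "(\<And>i. t$i \<noteq> 0) \<Longrightarrow> wS A i * wT A t = wT A (refl_tor A i t) * wS A i"
  using km_refl_tor[THEN wd_eqI, of A t]
  by (simp add: wT_def wS_def valid_Tor wd_append wd_Cons[of A _ "s_word _ _"])

lemma wX_wY_wX: "r \<noteq> 0 \<Longrightarrow> wX A i r * wY A i (- 1 / r) * wX A i r = wH A i r * wS A i"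
  using km_s_coroot[THEN wd_eqI, of r A i]
  by (simp add: wH_def wT_def wd_s_word wS_eq wd_Cons[of A _ "s_word _ _"])

lemma char_tor_nonzero: "(\<And>i. t$i \<noteq> 0) \<Longrightarrow> char_tor A j t \<noteq> 0"
  by (simp add: char_tor_def)

lemma refl_tor_nonzero: "(\<And>i. t$i \<noteq> 0) \<Longrightarrow> refl_tor A i t $ j \<noteq> 0"
  by (simp add: refl_tor_def char_tor_nonzero)

lemma char_tor_coroot: "char_tor A j (coroot_tor i r) = r powi A$i$j"
proof -
  have "char_tor A j (coroot_tor i r) = (\<Prod>k\<in>UNIV. if k = i then r powi A$i$j else 1)"
    unfolding char_tor_def coroot_tor_def by (rule prod.cong) auto
  then show ?thesis by simp
qed

lemma refl_tor_eq: "refl_tor A i t = t * coroot_tor i (1 / char_tor A i t)"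
  by (simp add: refl_tor_def coroot_tor_def vec_eq_iff)

lemma char_tor_mult: "char_tor A j (s * t) = char_tor A j s * char_tor A j t"
  by (simp add: char_tor_def power_int_mult_distrib prod.distrib)

lemma char_tor_refl:
  assumes "gcm A" "\<And>i. t$i \<noteq> 0"
  shows "char_tor A i (refl_tor A i t) = 1 / char_tor A i t"
  using char_tor_nonzero[OF assms(2), of A i]
  by (simp add: refl_tor_eq char_tor_mult char_tor_coroot gcm_diag[OF assms(1)] power_int_def
      power2_eq_square divide_simps numeral_2_eq_2)

lemma refl_tor_invol:
  assumes "gcm A" "\<And>i. t$i \<noteq> 0"
  shows "refl_tor A i (refl_tor A i t) = t"
proof (subst vec_eq_iff, rule allI)
  fix j
  have "refl_tor A i (refl_tor A i t) $ j
      = (if j = i then refl_tor A i t $ j / char_tor A i (refl_tor A i t) else refl_tor A i t $ j)"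
    by (subst refl_tor_def) simp
  also have "\<dots> = t $ j"
    unfolding char_tor_refl[OF assms]
    using char_tor_nonzero[OF assms(2), of A i] by (simp add: refl_tor_def)
  finally show "refl_tor A i (refl_tor A i t) $ j = t $ j" .
qed

text \<open>The presentation has this relation only for \<open>x\<^sub>i\<close>; conjugation by \<open>s\<^sub>i\<close> transports it to \<open>y\<^sub>i\<close>.\<close>

lemma wT_wY:
  assumes A: "gcm A" and t: "\<And>i. t$i \<noteq> 0"
  shows "wT A t * wY A i c = wY A i (c / char_tor A i t) * wT A t"
proof (rule cancel_right[OF wS_inverse(1)[OF A]])
  note rt = refl_tor_nonzero[OF t]
  have "wT A t * wY A i c * wS A i = wT A t * wS A i * wX A i (- c)"
    by (simp add: mult.assoc wS_wX[OF A])
  also have "wT A t * wS A i = wS A i * wT A (refl_tor A i t)"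
    using wS_wT[OF rt] by (simp add: refl_tor_invol[OF A t])
  also have "\<dots> * wX A i (- c) = wS A i * wX A i (- c / char_tor A i t) * wT A (refl_tor A i t)"
    by (simp add: mult.assoc wT_wX[OF rt] char_tor_refl[OF A t])
  also have "\<dots> = wY A i (c / char_tor A i t) * (wS A i * wT A (refl_tor A i t))"
    by (simp add: wS_wX[OF A] mult.assoc)
  also have "wS A i * wT A (refl_tor A i t) = wT A t * wS A i"
    using wS_wT[OF rt] by (simp add: refl_tor_invol[OF A t])
  finally show "wT A t * wY A i c * wS A i = wY A i (c / char_tor A i t) * wT A t * wS A i"
    by (simp add: mult.assoc)
qed

lemma coroot_tor_nonzero: "r \<noteq> 0 \<Longrightarrow> coroot_tor i r $ j \<noteq> 0"
  by (simp add: coroot_tor_def)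

lemma coroot_tor_mult: "coroot_tor i r * coroot_tor i s = coroot_tor i (r * s)"
  by (simp add: coroot_tor_def vec_eq_iff)

lemma wH_mult: "r \<noteq> 0 \<Longrightarrow> s \<noteq> 0 \<Longrightarrow> wH A i r * wH A i s = wH A i (r * s)"
  unfolding wH_def by (simp add: wT_mult coroot_tor_nonzero coroot_tor_mult)

lemma wH_1: "wH A i 1 = 1"
proof -
  have "coroot_tor i (1::real) = 1" by (simp add: coroot_tor_def vec_eq_iff)
  then show ?thesis by (simp add: wH_def wT_one)
qed

lemma wH_wX: "gcm A \<Longrightarrow> r \<noteq> 0 \<Longrightarrow> wH A i r * wX A i c = wX A i (r\<^sup>2 * c) * wH A i r"
  unfolding wH_def by (simp add: wT_wX coroot_tor_nonzero char_tor_coroot gcm_diag)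

lemma wH_wY: "gcm A \<Longrightarrow> r \<noteq> 0 \<Longrightarrow> wH A i r * wY A i c = wY A i (c / r\<^sup>2) * wH A i r"
  unfolding wH_def by (simp add: wT_wY coroot_tor_nonzero char_tor_coroot gcm_diag)

lemma wS_wH:
  assumes "gcm A" "r \<noteq> 0"
  shows "wS A i * wH A i r = wH A i (1 / r) * wS A i"
proof -
  have "refl_tor A i (coroot_tor i r) = coroot_tor i (1 / r)"
    using assms by (simp add: refl_tor_eq char_tor_coroot gcm_diag coroot_tor_mult power2_eq_square)
  then show ?thesis
    unfolding wH_def using wS_wT[OF coroot_tor_nonzero[OF assms(2)]] by metis
qed

lemma wS_square:
  assumes "gcm A"
  shows "wS A i * wS A i = wH A i (- 1)"
proof -
  have "wSi A i = wH A i (- 1) * wS A i"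
    using wX_wY_wX[of "- 1" A i] by (simp add: wSi_def)
  then have "wH A i (- 1) * (wS A i * wS A i) = 1"
    using wS_inverse(2)[OF assms, of i] by (simp add: mult.assoc)
  then have "wH A i (- 1) * wH A i (- 1) * (wS A i * wS A i) = wH A i (- 1)"
    by (simp add: mult.assoc)
  then show ?thesis by (simp add: wH_mult wH_1)
qed

text \<open>The homomorphism \<open>\<phi>\<^sub>i\<close> as a function of the entries \<open>a, b, c, d\<close> of a matrix.\<close>

definition phi :: "int^'n^'n \<Rightarrow> 'n \<Rightarrow> real \<Rightarrow> real \<Rightarrow> real \<Rightarrow> real \<Rightarrow> ('n::finite) word_family" where
  "phi A i a b c d = (if c = 0 then wH A i a * wX A i (b / a)
     else wX A i ((a - 1) / c) * wY A i c * wX A i ((d - 1) / c))"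

lemma wY_big_cell:
  assumes "gcm A" "c \<noteq> 0"
  shows "wY A i c = wX A i (1 / c) * wH A i (- 1 / c) * wS A i * wX A i (1 / c)"
proof -
  have "wX A i (1 / c) * wH A i (- 1 / c) * wS A i * wX A i (1 / c)
      = wX A i (1 / c) * (wX A i (- 1 / c) * wY A i c * wX A i (- 1 / c)) * wX A i (1 / c)"
    using wX_wY_wX[of "- 1 / c" A i] assms(2) by (simp add: mult.assoc)
  also have "\<dots> = wY A i c"
    using assms by (simp add: mult.assoc wX_add[OF assms(1), THEN assoc_rule] wX_add wX_0)
  finally show ?thesis ..
qed

lemma phi_big_cell:
  assumes "gcm A" "c \<noteq> 0"
  shows "phi A i a b c d = wX A i (a / c) * (wH A i (- 1 / c) * (wS A i * wX A i (d / c)))"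
  using assms
  by (simp add: phi_def wY_big_cell[OF assms] mult.assoc wX_add[OF assms(1), THEN assoc_rule] wX_add
      diff_divide_distrib)

lemma phi_X:
  assumes "gcm A" "a * d - b * c = 1"
  shows "phi A i (a + t * c) (b + t * d) c d = wX A i t * phi A i a b c d"
proof (cases "c = 0")
  case True
  then have "a \<noteq> 0" "d = 1 / a" using assms(2) by (auto simp: eq_divide_eq mult.commute)
  moreover have "wX A i t = wX A i (a\<^sup>2 * (t / a\<^sup>2))" using \<open>a \<noteq> 0\<close> by simp
  then have "wX A i t * (wH A i a * wX A i (b / a)) = wH A i a * (wX A i (t / a\<^sup>2) * wX A i (b / a))"
    using wH_wX[OF assms(1) \<open>a \<noteq> 0\<close>, of i "t / a\<^sup>2"] by (simp only: mult.assoc[symmetric])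
  ultimately show ?thesis
    using True assms(1)
    by (simp add: phi_def wX_add add_divide_distrib power2_eq_square add.commute)
next
  case False
  then show ?thesis
    by (simp add: phi_big_cell[OF assms(1)] wX_add[OF assms(1), THEN assoc_rule] add_divide_distrib
        add.commute)
qed

lemma phi_H:
  assumes "gcm A" "a * d - b * c = 1" "r \<noteq> 0"
  shows "phi A i (r * a) (r * b) (c / r) (d / r) = wH A i r * phi A i a b c d"
proof (cases "c = 0")
  case True
  then have "a \<noteq> 0" using assms(2) by auto
  then show ?thesis
    using True assms(3) by (simp add: phi_def mult.assoc[symmetric] wH_mult)
next
  case False
  have "wH A i r * phi A i a b c d
      = wX A i (r\<^sup>2 * (a / c)) * (wH A i r * wH A i (- 1 / c) * (wS A i * wX A i (d / c)))"
    using False by (simp add: phi_big_cell[OF assms(1)] wH_wX[OF assms(1,3), THEN assoc_rule] mult.assoc)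
  also have "\<dots> = phi A i (r * a) (r * b) (c / r) (d / r)"
    using False assms by (simp add: phi_big_cell wH_mult power2_eq_square ac_simps)
  finally show ?thesis ..
qed

lemma phi_S:
  assumes "gcm A" "a * d - b * c = 1"
  shows "phi A i c d (- a) (- b) = wS A i * phi A i a b c d"
proof (cases "c = 0")
  case True
  then have "a \<noteq> 0" using assms(2) by auto
  then show ?thesis
    using True by (simp add: phi_big_cell[OF assms(1)] wX_0[OF assms(1)])
      (simp add: phi_def wS_wH[OF assms(1), THEN assoc_rule] mult.assoc)
next
  case c: False
  show ?thesis
  proof (cases "a = 0")
    case True
    have "wS A i * phi A i a b c d = wS A i * wH A i (- 1 / c) * wS A i * wX A i (d / c)"
      using True c by (simp add: phi_big_cell[OF assms(1)] wX_0[OF assms(1)] mult.assoc)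
    also have "wS A i * wH A i (- 1 / c) * wS A i = wH A i (- c) * (wS A i * wS A i)"
      using c by (simp add: wS_wH[OF assms(1)] mult.assoc)
    also have "\<dots> = wH A i c"
      using c by (simp add: wS_square[OF assms(1)] wH_mult)
    finally show ?thesis using True by (simp add: phi_def)
  next
    case a: False
    have "wS A i * phi A i a b c d
        = wY A i (- (a / c)) * (wS A i * wH A i (- 1 / c) * wS A i) * wX A i (d / c)"
      using c by (simp add: phi_big_cell[OF assms(1)] wS_wX[OF assms(1), THEN assoc_rule] mult.assoc)
    also have "wS A i * wH A i (- 1 / c) * wS A i = wH A i (- c) * (wS A i * wS A i)"
      using c by (simp add: wS_wH[OF assms(1)] mult.assoc)
    also have "\<dots> = wH A i c"
      using c by (simp add: wS_square[OF assms(1)] wH_mult)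
    also have "wY A i (- (a / c)) = wX A i (- (c / a)) * wH A i (c / a) * wS A i * wX A i (- (c / a))"
      using wY_big_cell[OF assms(1), of "- (a / c)" i] a c by simp
    also have "\<dots> * wH A i c * wX A i (d / c)
        = wX A i (- (c / a)) * (wH A i (c / a) * (wS A i * (wX A i (- (c / a)) * wH A i c))) * wX A i (d / c)"
      by (simp add: mult.assoc)
    also have "wX A i (- (c / a)) * wH A i c = wH A i c * wX A i (- (1 / (a * c)))"
      using wH_wX[OF assms(1) c, of i "- (1 / (a * c))"] c by (simp add: power2_eq_square)
    also have "wH A i (c / a) * (wS A i * (wH A i c * wX A i (- (1 / (a * c)))))
        = wH A i (1 / a) * (wS A i * wX A i (- (1 / (a * c))))"
      using a c by (simp add: wS_wH[OF assms(1), THEN assoc_rule] wH_mult[THEN assoc_rule] mult.assoc)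
    also have "wX A i (- (c / a)) * \<dots> * wX A i (d / c)
        = wX A i (- (c / a)) * (wH A i (1 / a) * (wS A i * wX A i (d / c - 1 / (a * c))))"
      by (simp add: wX_add[OF assms(1)] mult.assoc add.commute)
    also have "d / c - 1 / (a * c) = b / a"
      using a c assms(2) by (simp add: field_simps)
    finally show ?thesis
      using a by (simp add: phi_big_cell[OF assms(1)])
  qed
qed

text \<open>By the Bruhat decomposition, the left factor is a product of upper unipotent matrices, diagonal
  matrices and \<open>s\<close>. The three preceding lemmas multiply by each of these.\<close>

lemma phi_mult:
  assumes A: "gcm A" and M: "a * d - b * c = 1" and N: "a' * d' - b' * c' = 1"
  shows "phi A i a b c d * phi A i a' b' c' d'
    = phi A i (a * a' + b * c') (a * b' + b * d') (c * a' + d * c') (c * b' + d * d')"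
proof (cases "c = 0")
  case True
  then have a: "a \<noteq> 0" "d = 1 / a" using M by (auto simp: eq_divide_eq mult.commute)
  have det: "(a' + b / a * c') * d' - (b' + b / a * d') * c' = 1"
    using N by (simp add: algebra_simps)
  have "phi A i a b c d * phi A i a' b' c' d' = wH A i a * (wX A i (b / a) * phi A i a' b' c' d')"
    using True by (simp add: phi_def[of A i a] mult.assoc)
  also have "\<dots> = phi A i (a * (a' + b / a * c')) (a * (b' + b / a * d')) (c' / a) (d' / a)"
    by (simp only: phi_X[OF A N, symmetric] phi_H[OF A det a(1)])
  finally show ?thesis
    using True a by (simp add: distrib_left)
next
  case False
  define e where "e = d / c"
  have 1: "(a' + e * c') * d' - (b' + e * d') * c' = 1"
    using N by (simp add: algebra_simps)
  have 2: "c' * - (b' + e * d') - d' * - (a' + e * c') = 1"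
    using N by (simp add: algebra_simps)
  have 3: "- 1 / c * c' * (- (b' + e * d') / (- 1 / c)) - - 1 / c * d' * (- (a' + e * c') / (- 1 / c)) = 1"
    using 2 False by simp
  have c': "- 1 / c \<noteq> 0" using False by simp
  have "phi A i a b c d * phi A i a' b' c' d' =
      wX A i (a / c) * (wH A i (- 1 / c) * (wS A i * (wX A i e * phi A i a' b' c' d')))"
    using False by (simp add: phi_big_cell[OF A] mult.assoc e_def)
  also have "\<dots> = phi A i (- 1 / c * c' + a / c * (- (a' + e * c') / (- 1 / c)))
      (- 1 / c * d' + a / c * (- (b' + e * d') / (- 1 / c)))
      (- (a' + e * c') / (- 1 / c)) (- (b' + e * d') / (- 1 / c))"
    by (simp only: phi_X[OF A N, symmetric] phi_S[OF A 1, symmetric] phi_H[OF A 2 c', symmetric]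
        phi_X[OF A 3, symmetric])
  also have "- (a' + e * c') / (- 1 / c) = c * a' + d * c'"
    using False by (simp add: e_def field_simps)
  also have "- (b' + e * d') / (- 1 / c) = c * b' + d * d'"
    using False by (simp add: e_def field_simps)
  also have "- 1 / c * c' + a / c * (c * a' + d * c') = a * a' + b * c'"
  proof -
    have "- 1 / c * c' + a / c * (c * a' + d * c') = a * a' + c' * (a * d - 1) / c"
      using False by (simp add: field_simps)
    also have "a * d - 1 = b * c" using M by simp
    finally show ?thesis using False by (simp add: mult.commute)
  qed
  also have "- 1 / c * d' + a / c * (c * b' + d * d') = a * b' + b * d'"
  proof -
    have "- 1 / c * d' + a / c * (c * b' + d * d') = a * b' + d' * (a * d - 1) / c"
      using False by (simp add: field_simps)
    also have "a * d - 1 = b * c" using M by simp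
    finally show ?thesis using False by (simp add: mult.commute)
  qed
  finally show ?thesis .
qed

subsection \<open>Generation by the simple root groups and the torus\<close>

text \<open>Following \<open>\<alpha> = s\<^sub>j\<^sub>1 \<cdots> s\<^sub>j\<^sub>n \<alpha>\<^sub>i\<close>, conjugation by the \<open>s\<^sub>j\<close> moves the root group of \<open>\<alpha>\<close> to that of \<open>\<alpha>\<^sub>i\<close>, which
  consists of the \<open>x\<^sub>i(c)\<close> by \<open>root_space_simple\<close>.\<close>

lemma wR_induct:
  assumes A: "gcm A" and x: "valid_letter A (Root x)"
    and mult: "\<And>u v. P u \<Longrightarrow> P v \<Longrightarrow> P (u * v)"
    and X: "\<And>i c. P (wX A i c)" and Y: "\<And>i c. P (wY A i c)"
  shows "P (wR A x)"
proof -
  obtain \<alpha> where \<alpha>: "\<alpha> \<in> real_roots A" "root_space A \<alpha> x"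
    using x by (auto simp: valid_Root)
  obtain js i where js: "\<alpha> = foldr (refl_root A) js (axis i 1)"
    using \<alpha>(1) by (rule real_roots_obtain)
  have "P (wR A x)" if "root_space A (foldr (refl_root A) js (axis i 1)) x" for js x
    using that
  proof (induction js arbitrary: x)
    case Nil
    then obtain c where c: "lie_eq A x (LScale c (GenE i))"
      using root_space_simple[of A i x] by auto
    have "valid_letter A (Root x)"
      using Nil real_roots_simple by (auto simp: valid_Root)
    then show ?case
      using wR_cong[OF A _ c] X by (simp add: wX_def)
  next
    case (Cons j js)
    let ?\<beta> = "foldr (refl_root A) js (axis i 1)"
    have v: "valid_letter A (Root x)"
      using Cons.prems real_rootsI[of A "j # js"] by (auto simp: valid_Root)
    have "root_space A (refl_root A j (refl_root A j ?\<beta>)) (refl_lie A j x)"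
      by (rule root_space_refl_lie[OF A]) (use Cons.prems in simp)
    then have "P (wR A (refl_lie A j x))"
      using Cons.IH by (simp add: refl_root_invol[OF A])
    moreover have "wR A x = wSi A j * wR A (refl_lie A j x) * wS A j"
      using wS_wR[OF v, of j] wS_inverse(2)[OF A, of j] by (metis mult.assoc mult.left_neutral)
    ultimately show ?case
      by (simp add: wS_eq wSi_def mult X Y)
  qed
  then show ?thesis using \<alpha>(2) js by blast
qed

lemma wT_induct:
  assumes t: "\<And>i. t$i \<noteq> 0"
    and mult: "\<And>u v. P u \<Longrightarrow> P v \<Longrightarrow> P (u * v)" and one: "P 1"
    and H: "\<And>i r. r \<noteq> 0 \<Longrightarrow> P (wH A i r)"
  shows "P (wT A t)"
proof -
  have "P (wT A (\<chi> j. if j \<in> J then t$j else 1))" for J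
    using finite[of J]
  proof (induction J rule: finite_induct)
    case empty
    have "(\<chi> j. if j \<in> {} then t$j else 1) = 1" by (simp add: vec_eq_iff)
    then show ?case by (simp add: wT_one one)
  next
    case (insert i J)
    have "(\<chi> j. if j \<in> insert i J then t$j else 1)
        = coroot_tor i (t$i) * (\<chi> j. if j \<in> J then t$j else 1)"
      using insert.hyps by (auto simp: vec_eq_iff coroot_tor_def)
    also have "wT A \<dots> = wH A i (t$i) * wT A (\<chi> j. if j \<in> J then t$j else 1)"
      unfolding wH_def by (rule wT_mult[symmetric]) (use t coroot_tor_nonzero in auto)
    finally show ?case using insert.IH H t mult by metis
  qed
  from this[of UNIV] show ?thesis by simp
qed

lemma word_induct:
  assumes A: "gcm A" and w: "w \<in> km_words A"
    and mult: "\<And>u v. P u \<Longrightarrow> P v \<Longrightarrow> P (u * v)" and one: "P 1"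
    and X: "\<And>i c. P (wX A i c)" and Y: "\<And>i c. P (wY A i c)" and H: "\<And>i r. r \<noteq> 0 \<Longrightarrow> P (wH A i r)"
  shows "P (wd A w)"
  using w
proof (induction w)
  case Nil
  then show ?case by (simp add: wd_Nil one)
next
  case (Cons l w)
  have "P (wd A [l])"
  proof (cases l)
    case (Tor t)
    then have "\<And>i. t$i \<noteq> 0" using Cons.prems by (simp add: km_words_def valid_Tor)
    then have "P (wT A t)" by (rule wT_induct[OF _ mult one H])
    then show ?thesis by (simp add: Tor wT_def)
  next
    case (Root x)
    then have "valid_letter A (Root x)" using Cons.prems by (simp add: km_words_def)
    then have "P (wR A x)" by (rule wR_induct[OF A _ mult X Y])
    then show ?thesis by (simp add: Root wR_def)
  qed
  moreover have "P (wd A w)" using Cons by (simp add: km_words_def)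
  ultimately show ?case unfolding wd_Cons[of A l w] by (rule mult)
qed

lemma word_inverse:
  assumes A: "gcm A" and w: "w \<in> km_words A"
  shows "\<exists>v \<in> km_words A. wd A v * wd A w = 1 \<and> wd A w * wd A v = 1"
proof (rule word_induct[OF A w, where P = "\<lambda>u. \<exists>v \<in> km_words A. wd A v * u = 1 \<and> u * wd A v = 1"])
  fix u1 u2
  assume "\<exists>v \<in> km_words A. wd A v * u1 = 1 \<and> u1 * wd A v = 1"
    "\<exists>v \<in> km_words A. wd A v * u2 = 1 \<and> u2 * wd A v = 1"
  then obtain v1 v2 where v: "v1 \<in> km_words A" "v2 \<in> km_words A"
    "wd A v1 * u1 = 1" "u1 * wd A v1 = 1" "wd A v2 * u2 = 1" "u2 * wd A v2 = 1" by blast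
  have "wd A (v2 @ v1) * (u1 * u2) = 1" "u1 * u2 * wd A (v2 @ v1) = 1"
    using v(3-)[THEN assoc_rule] v(3-) by (simp_all add: wd_append mult.assoc)
  then show "\<exists>v \<in> km_words A. wd A v * (u1 * u2) = 1 \<and> u1 * u2 * wd A v = 1"
    using v(1,2) by (intro bexI[of _ "v2 @ v1"]) (auto simp: km_words_def)
next
  show "\<exists>v \<in> km_words A. wd A v * 1 = 1 \<and> 1 * wd A v = 1"
    by (rule bexI[of _ "[]"]) (auto simp: wd_Nil km_words_def)
  fix i c
  show "\<exists>v \<in> km_words A. wd A v * wX A i c = 1 \<and> wX A i c * wd A v = 1"
    using wX_add[OF A] wX_0[OF A]
    by (intro bexI[of _ "[Root (LScale (- c) (GenE i))]"])
       (auto simp: km_words_def valid_E simp flip: wR_def wX_def)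
  show "\<exists>v \<in> km_words A. wd A v * wY A i c = 1 \<and> wY A i c * wd A v = 1"
    using wY_add[OF A] wY_0[OF A]
    by (intro bexI[of _ "[Root (LScale (- c) (GenF i))]"])
       (auto simp: km_words_def valid_F[OF A] simp flip: wR_def wY_def)
next
  fix i and r :: real assume r: "r \<noteq> 0"
  show "\<exists>v \<in> km_words A. wd A v * wH A i r = 1 \<and> wH A i r * wd A v = 1"
    using r wH_mult[of r "1 / r" A i] wH_mult[of "1 / r" r A i]
    by (intro bexI[of _ "[Tor (coroot_tor i (1 / r))]"])
       (auto simp: km_words_def valid_Tor coroot_tor_nonzero wH_1 simp flip: wT_def wH_def)
qed

lemma central_torus:
  assumes A: "gcm A" and t: "\<And>i. t$i \<noteq> 0" and char: "\<And>j. char_tor A j t = 1" and w: "w \<in> km_words A"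
  shows "wT A t * wd A w = wd A w * wT A t"
proof (rule word_induct[OF A w, where P = "\<lambda>u. wT A t * u = u * wT A t"])
  show "wT A t * (u * v) = u * v * wT A t" if "wT A t * u = u * wT A t" "wT A t * v = v * wT A t" for u v
    using that by (metis mult.assoc)
  show "wT A t * wH A i r = wH A i r * wT A t" if "r \<noteq> 0" for i r
    unfolding wH_def by (simp add: wT_mult mult.commute t coroot_tor_nonzero that)
qed (simp_all add: wT_wX[OF t] wT_wY[OF A t] char)

subsection \<open>The Chevalley involution on words\<close>

primrec letter_omega :: "('n::finite) km_letter \<Rightarrow> 'n km_letter" where
  "letter_omega (Tor t) = Tor (\<chi> i. 1 / t$i)"
| "letter_omega (Root x) = Root (lie_omega x)"

lemma valid_letter_omega: "gcm A \<Longrightarrow> valid_letter A l \<Longrightarrow> valid_letter A (letter_omega l)"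
  by (cases l) (auto simp: valid_Tor valid_Root intro: root_space_omega real_roots_uminus)

lemma km_words_omega: "gcm A \<Longrightarrow> w \<in> km_words A \<Longrightarrow> map letter_omega w \<in> km_words A"
  by (auto simp: km_words_def valid_letter_omega)

lemma wR_omega_E: "gcm A \<Longrightarrow> wR A (lie_omega (LScale c (GenE i))) = wY A i (- c)"
  unfolding wY_def using valid_letter_omega[OF _ valid_E, of A]
  by (intro wR_cong) (auto simp: cl_eq_iff[symmetric] cl_simps)

lemma wR_omega_F: "gcm A \<Longrightarrow> wR A (lie_omega (LScale c (GenF i))) = wX A i (- c)"
  unfolding wX_def using valid_letter_omega[OF _ valid_F, of A]
  by (intro wR_cong) (auto simp: cl_eq_iff[symmetric] cl_simps)

lemma cl_foldr_exp_ad_cong: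
  "cl A z = cl A z' \<Longrightarrow> cl A (foldr (exp_ad A) xs z) = cl A (foldr (exp_ad A) xs z')"
  by (induction xs) (simp_all add: cl_exp_ad)

lemma lie_omega_foldr_exp_ad:
  "lie_omega (foldr (exp_ad A) xs z) = foldr (exp_ad A) (map lie_omega xs) (lie_omega z)"
  by (induction xs) (simp_all add: lie_omega_exp_ad)

lemma prenilpotent_uminus:
  assumes "gcm A" "prenilpotent A \<alpha> \<beta>"
  shows "prenilpotent A (- \<alpha>) (- \<beta>)"
proof -
  have neg: "w (- \<gamma>) = - w \<gamma>" if "w \<in> generated_maps (refl_root A)" for w \<gamma>
    using that by (auto simp: generated_maps_def foldr_refl_root_uminus)
  obtain w w' where w: "w \<in> generated_maps (refl_root A)" "\<forall>i. w \<alpha> $ i \<ge> 0 \<and> w \<beta> $ i \<ge> 0"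
    and w': "w' \<in> generated_maps (refl_root A)" "\<forall>i. w' \<alpha> $ i \<le> 0 \<and> w' \<beta> $ i \<le> 0"
    using assms(2) unfolding prenilpotent_def by blast
  have "\<forall>i. w' (- \<alpha>) $ i \<ge> 0 \<and> w' (- \<beta>) $ i \<ge> 0" "\<forall>i. w (- \<alpha>) $ i \<le> 0 \<and> w (- \<beta>) $ i \<le> 0"
    using w(2) w'(2) by (simp_all add: neg[OF w(1)] neg[OF w'(1)])
  with assms w(1) w'(1) show ?thesis
    unfolding prenilpotent_def using real_roots_uminus[OF assms(1)] by metis
qed

lemma root_interval_uminus:
  assumes "gcm A" "\<gamma> \<in> root_interval A \<alpha> \<beta>"
  shows "- \<gamma> \<in> root_interval A (- \<alpha>) (- \<beta>)"
proof -
  obtain p q :: nat where \<gamma>: "\<gamma> \<in> real_roots A" "\<gamma> = int p *s \<alpha> + int q *s \<beta>"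
    using assms(2) unfolding root_interval_def by blast
  have "- \<gamma> = int p *s (- \<alpha>) + int q *s (- \<beta>)"
    by (simp add: \<gamma>(2) vec_eq_iff)
  then show ?thesis
    using real_roots_uminus[OF assms(1) \<gamma>(1)] unfolding root_interval_def by blast
qed

lemma steinberg_omega:
  assumes A: "gcm A" and pre: "prenilpotent A \<alpha> \<beta>"
    and roots: "\<forall>x \<in> set xs \<union> set ys. \<exists>\<gamma> \<in> root_interval A \<alpha> \<beta>. root_space A \<gamma> x"
    and eq: "\<forall>z. lie_eq A (foldr (exp_ad A) xs z) (foldr (exp_ad A) ys z)"
  shows "km_eq A (map Root (map lie_omega xs)) (map Root (map lie_omega ys))"
proof (rule km_steinberg[OF prenilpotent_uminus[OF A pre]])
  show "\<forall>x \<in> set (map lie_omega xs) \<union> set (map lie_omega ys).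
      \<exists>\<gamma> \<in> root_interval A (- \<alpha>) (- \<beta>). root_space A \<gamma> x"
  proof
    fix x assume "x \<in> set (map lie_omega xs) \<union> set (map lie_omega ys)"
    then obtain y where y: "x = lie_omega y" "y \<in> set xs \<union> set ys" by auto
    then obtain \<gamma> where "\<gamma> \<in> root_interval A \<alpha> \<beta>" "root_space A \<gamma> y" using roots by blast
    then show "\<exists>\<gamma> \<in> root_interval A (- \<alpha>) (- \<beta>). root_space A \<gamma> x"
      using root_interval_uminus[OF A] root_space_omega y(1) by blast
  qed
  show "\<forall>z. lie_eq A (foldr (exp_ad A) (map lie_omega xs) z) (foldr (exp_ad A) (map lie_omega ys) z)"
  proof
    fix z
    have *: "cl A (foldr (exp_ad A) (map lie_omega us) z) = cl A (lie_omega (foldr (exp_ad A) us (lie_omega z)))"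
      for us
      unfolding lie_omega_foldr_exp_ad
      by (rule cl_foldr_exp_ad_cong) (simp add: cl_lie_omega_invol)
    have "cl A (foldr (exp_ad A) (map lie_omega xs) z) = cl A (foldr (exp_ad A) (map lie_omega ys) z)"
      unfolding * by (rule cl_lie_omega_cong) (use eq in blast)
    then show "lie_eq A (foldr (exp_ad A) (map lie_omega xs) z) (foldr (exp_ad A) (map lie_omega ys) z)"
      by (simp add: cl_eq_iff)
  qed
qed

lemma inverse_tor_simps:
  "char_tor A j (\<chi> i. 1 / t$i) = 1 / char_tor A j t"
  "(\<chi> i. 1 / coroot_tor k r $ i) = coroot_tor k (1 / r)"
  "(\<chi> i. 1 / refl_tor A k t $ i) = refl_tor A k (\<chi> i. 1 / t$i)"
proof -
  show char: "char_tor A j (\<chi> i. 1 / t$i) = 1 / char_tor A j t" for j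
    unfolding char_tor_def by (simp add: power_int_divide_distrib prod_dividef)
  show "(\<chi> i. 1 / coroot_tor k r $ i) = coroot_tor k (1 / r)"
    by (simp add: coroot_tor_def vec_eq_iff)
  show "(\<chi> i. 1 / refl_tor A k t $ i) = refl_tor A k (\<chi> i. 1 / t$i)"
    by (simp add: refl_tor_def vec_eq_iff char)
qed

lemma wd_omega_s_word:
  assumes "gcm A" "r \<noteq> 0"
  shows "wd A (map letter_omega (s_word i r)) = wY A i (- r) * wX A i (1 / r) * wY A i (- r)"
  unfolding s_word_def list.map letter_omega.simps wd_Cons[of A _ "_ # _"] wR_def[symmetric]
    wR_omega_E[OF assms(1)] wR_omega_F[OF assms(1)]
  by (simp add: mult.assoc)

text \<open>The argument of \<open>wS_alt\<close> for the element \<open>n = (1/r)^\<alpha>\<^sub>i\<^sup>\<or> s\<^sub>i\<close>, whose conjugation exchanges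
  \<open>x\<^sub>i(1/r)\<close> and \<open>y\<^sub>i(- r)\<close>.\<close>

lemma wY_wX_wY:
  assumes A: "gcm A" and r: "r \<noteq> 0"
  shows "wY A i (- r) * wX A i (1 / r) * wY A i (- r) = wH A i (1 / r) * wS A i"
proof -
  define n where "n = wH A i (1 / r) * wS A i"
  have n: "n = wX A i (1 / r) * wY A i (- r) * wX A i (1 / r)"
    using wX_wY_wX[of "1 / r" A i] r by (simp add: n_def)
  have nX: "n * wX A i (1 / r) = wY A i (- r) * n"
    using r by (simp add: n_def mult.assoc wS_wX[OF A] wH_wY[OF A, THEN assoc_rule] power2_eq_square)
  have nY: "n * wY A i (- r) = wX A i (1 / r) * n"
    using r by (simp add: n_def mult.assoc wS_wY[OF A] wH_wX[OF A, THEN assoc_rule] power2_eq_square)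
  have "n * (wSi A i * wH A i r) = 1"
    using r by (simp add: n_def mult.assoc wS_inverse(1)[OF A, THEN assoc_rule] wH_mult wH_1)
  moreover have "n * n = wY A i (- r) * wX A i (1 / r) * wY A i (- r) * n"
    by (subst (2) n) (simp add: mult.assoc nX nY nX[THEN assoc_rule] nY[THEN assoc_rule])
  ultimately show ?thesis
    unfolding n_def[symmetric] by (metis cancel_right)
qed

text \<open>Each relation of the presentation is mapped to a consequence of the relations.\<close>

lemma wd_omega_cong:
  assumes A: "gcm A" and "km_eq A u v"
  shows "wd A (map letter_omega u) = wd A (map letter_omega v)"
  using assms(2)
proof induction
  case (km_cong u u' v v')
  then show ?case by (simp add: wd_append)
next
  case (km_steinberg \<alpha> \<beta> xs ys)
  have "map letter_omega (map Root zs) = map Root (map lie_omega zs)" for zs :: "'a lie_term list" by simp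
  then show ?case
    using steinberg_omega[OF A km_steinberg] by (simp only: wd_eq_iff)
next
  case km_tor_one
  have "(\<chi> i. 1 / 1 $ i) = (1 :: real^'a)" by (simp add: vec_eq_iff)
  then show ?case using wT_one by (simp add: wT_def wd_Nil)
next
  case (km_tor_mult s t)
  then have "wT A (\<chi> i. 1 / s$i) * wT A (\<chi> i. 1 / t$i) = wT A ((\<chi> i. 1 / s$i) * (\<chi> i. 1 / t$i))"
    by (intro wT_mult) (auto simp: valid_Tor)
  moreover have "(\<chi> i. 1 / s$i) * (\<chi> i. 1 / t$i) = (\<chi> i. 1 / (s * t)$i)" by (simp add: vec_eq_iff)
  ultimately show ?case by (simp add: wT_def wd_Cons[of A _ "_ # _"])
next
  case (km_tor_root t c i)
  then have "wT A (\<chi> i. 1 / t$i) * wY A i (- c) = wY A i (- c / (1 / char_tor A i t)) * wT A (\<chi> i. 1 / t$i)"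
    by (subst wT_wY[OF A]) (auto simp: valid_Tor inverse_tor_simps)
  then show ?case
    by (simp add: wd_Cons[of A _ "_ # _"] wR_omega_E[OF A] mult.commute del: lie_omega.simps
        flip: wT_def wR_def)
next
  case (km_refl_tor t i)
  have S: "wd A (map letter_omega (s_word i 1)) = wS A i"
    using wd_omega_s_word[OF A, of 1 i] wS_alt[OF A, of i] by simp
  have "wS A i * wT A (\<chi> i. 1 / t$i) = wT A (refl_tor A i (\<chi> i. 1 / t$i)) * wS A i"
    using km_refl_tor by (intro wS_wT) (auto simp: valid_Tor)
  then show ?case
    by (simp add: wd_append S inverse_tor_simps wd_Cons[of A _ "map letter_omega _"] flip: wT_def)
next
  case (km_s_coroot r i)
  have S: "wd A (map letter_omega (s_word i 1)) = wS A i"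
    using wd_omega_s_word[OF A, of 1 i] wS_alt[OF A, of i] by simp
  show ?case
    using km_s_coroot
    by (simp add: wd_omega_s_word[OF A] wY_wX_wY[OF A] S inverse_tor_simps wd_Cons[of A _ "map letter_omega _"]
        flip: wT_def wH_def)
next
  case (km_refl_root x i)
  have S: "wd A (map letter_omega (s_word i 1)) = wS A i"
    using wd_omega_s_word[OF A, of 1 i] wS_alt[OF A, of i] by simp
  have v: "valid_letter A (Root (lie_omega x))" "valid_letter A (Root (lie_omega (refl_lie A i x)))"
    using valid_letter_omega[OF A km_refl_root] valid_letter_omega[OF A valid_refl_lie[OF A km_refl_root]] by auto
  show ?case
    using wS_wR[OF v(1), of i] wR_cong[OF A v(2) lie_omega_refl[OF A]]
    by (simp add: wd_append S wd_Cons[of A _ "map letter_omega _"] flip: wR_def)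
qed auto

lemma wd_omega_om:
  assumes A: "gcm A" and "w \<in> km_words A"
  shows "wd A (map letter_omega (map letter_omega w)) = wd A w"
  using assms(2)
proof (induction w)
  case (Cons l w)
  have l: "valid_letter A l" and w: "w \<in> km_words A" using Cons.prems by (auto simp: km_words_def)
  have "wd A [letter_omega (letter_omega l)] = wd A [l]"
  proof (cases l)
    case (Tor t)
    have "(\<chi> i. 1 / (1 / t$i)) = t" by (simp add: vec_eq_iff)
    then show ?thesis using Tor by simp
  next
    case (Root x)
    then have "wR A x = wR A (lie_omega (lie_omega x))"
      using l cl_lie_omega_invol[of A x] by (intro wR_cong[OF A]) (auto simp: cl_eq_iff intro: lie_sym)
    then show ?thesis using Root by (simp add: wR_def)
  qed
  then show ?case
    using Cons.IH[OF w] wd_Cons[of A "letter_omega (letter_omega l)" "map letter_omega (map letter_omega w)"] wd_Cons[of A l w] by simp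
qed simp

section \<open>The Kac--Moody group\<close>

locale kac_moody =
  fixes A :: "int^'n^'n"
  assumes gcm: "gcm A"
begin

lemma km_class_eq:
  assumes "u \<in> km_words A" "v \<in> km_words A"
  shows "km_class A u = km_class A v \<longleftrightarrow> wd A u = wd A v"
  using assms unfolding km_class_def km_rel_def wd_eq_iff
  by (auto intro: km_refl km_sym km_trans)

lemma mem_km_class: "u \<in> km_words A \<Longrightarrow> v \<in> km_class A u \<longleftrightarrow> v \<in> km_words A \<and> wd A v = wd A u"
  unfolding km_class_def km_rel_def wd_eq_iff by (auto intro: km_sym)

lemma carrier_KM: "carrier (KM A) = km_class A ` km_words A"
  unfolding KM_def km_class_def by (auto simp: quotient_def)

lemma km_words_append [simp]: "u @ v \<in> km_words A \<longleftrightarrow> u \<in> km_words A \<and> v \<in> km_words A"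
  by (auto simp: km_words_def)

lemma km_words_Nil [simp]: "[] \<in> km_words A"
  by (simp add: km_words_def)

lemma km_words_Cons: "l # w \<in> km_words A \<longleftrightarrow> valid_letter A l \<and> w \<in> km_words A"
  by (auto simp: km_words_def)

lemma KM_mult:
  assumes "u \<in> km_words A" "v \<in> km_words A"
  shows "km_class A u \<otimes>\<^bsub>KM A\<^esub> km_class A v = km_class A (u @ v)"
proof -
  have "km_class A u \<otimes>\<^bsub>KM A\<^esub> km_class A v
      = km_rel A `` {u' @ v' | u' v'. u' \<in> km_class A u \<and> v' \<in> km_class A v}"
    by (simp add: KM_def)
  also have "\<dots> = km_class A (u @ v)"
  proof (intro equalityI subsetI)
    fix w assume "w \<in> km_rel A `` {u' @ v' | u' v'. u' \<in> km_class A u \<and> v' \<in> km_class A v}"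
    then obtain u' v' where "u' \<in> km_class A u" "v' \<in> km_class A v" "(u' @ v', w) \<in> km_rel A" by blast
    then show "w \<in> km_class A (u @ v)"
      using assms by (simp add: mem_km_class km_rel_def wd_eq_iff[symmetric] wd_append)
  next
    fix w assume "w \<in> km_class A (u @ v)"
    then have "(u @ v, w) \<in> km_rel A" by (simp add: km_class_def)
    moreover have "u \<in> km_class A u" "v \<in> km_class A v" using assms by (simp_all add: mem_km_class)
    ultimately show "w \<in> km_rel A `` {u' @ v' | u' v'. u' \<in> km_class A u \<and> v' \<in> km_class A v}"
      by blast
  qed
  finally show ?thesis .
qed

lemma KM_one: "\<one>\<^bsub>KM A\<^esub> = km_class A []"
  by (simp add: KM_def)

lemma group_KM: "group (KM A)"
proof (rule groupI)
  fix x y z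
  assume "x \<in> carrier (KM A)" "y \<in> carrier (KM A)" "z \<in> carrier (KM A)"
  then obtain u v w where *: "u \<in> km_words A" "v \<in> km_words A" "w \<in> km_words A"
    "x = km_class A u" "y = km_class A v" "z = km_class A w" by (auto simp: carrier_KM)
  show "x \<otimes>\<^bsub>KM A\<^esub> y \<otimes>\<^bsub>KM A\<^esub> z = x \<otimes>\<^bsub>KM A\<^esub> (y \<otimes>\<^bsub>KM A\<^esub> z)"
    using * by (simp add: KM_mult)
next
  fix x y
  assume "x \<in> carrier (KM A)" "y \<in> carrier (KM A)"
  then show "x \<otimes>\<^bsub>KM A\<^esub> y \<in> carrier (KM A)" by (auto simp: carrier_KM KM_mult)
next
  show "\<one>\<^bsub>KM A\<^esub> \<in> carrier (KM A)" by (auto simp: carrier_KM KM_one)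
next
  fix x assume "x \<in> carrier (KM A)"
  then obtain w where w: "w \<in> km_words A" "x = km_class A w" by (auto simp: carrier_KM)
  then show "\<one>\<^bsub>KM A\<^esub> \<otimes>\<^bsub>KM A\<^esub> x = x" by (simp add: KM_one KM_mult)
  obtain v where "v \<in> km_words A" "wd A v * wd A w = 1"
    using word_inverse[OF gcm w(1)] by blast
  then have "km_class A v \<otimes>\<^bsub>KM A\<^esub> x = \<one>\<^bsub>KM A\<^esub>"
    using w by (simp add: KM_mult KM_one km_class_eq wd_append wd_Nil)
  then show "\<exists>y \<in> carrier (KM A). y \<otimes>\<^bsub>KM A\<^esub> x = \<one>\<^bsub>KM A\<^esub>"
    using \<open>v \<in> km_words A\<close> by (auto simp: carrier_KM)
qed

sublocale G: group "KM A" by (rule group_KM)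

abbreviation mult_KM (infixl "\<star>" 70) where "g \<star> h \<equiv> g \<otimes>\<^bsub>KM A\<^esub> h"
abbreviation \<G> where "\<G> \<equiv> carrier (KM A)"

subsection \<open>The canonical homomorphisms\<close>

definition mat2 :: "real \<Rightarrow> real \<Rightarrow> real \<Rightarrow> real \<Rightarrow> real^2^2" where
  "mat2 a b c d = (\<chi> i j. if i = 1 then (if j = 1 then a else b) else (if j = 1 then c else d))"

lemma mat2_nth [simp]:
  "mat2 a b c d $ 1 $ 1 = a" "mat2 a b c d $ 1 $ 2 = b" "mat2 a b c d $ 2 $ 1 = c" "mat2 a b c d $ 2 $ 2 = d"
  by (simp_all add: mat2_def)

lemma mat2_eta: "M = mat2 (M$1$1) (M$1$2) (M$2$1) (M$2$2)"
  by (simp add: vec_eq_iff forall_2)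

lemma mat2_mult:
  "mat2 a b c d ** mat2 a' b' c' d'
    = mat2 (a * a' + b * c') (a * b' + b * d') (c * a' + d * c') (c * b' + d * d')"
  by (simp add: vec_eq_iff forall_2 matrix_matrix_mult_def sum_2)

lemma mat2_SL2: "mat2 a b c d \<in> SL2 \<longleftrightarrow> a * d - b * c = 1"
  by (simp add: SL2_def det_2)

lemma SL2_cases:
  assumes "M \<in> SL2"
  obtains a b c d where "M = mat2 a b c d" "a * d - b * c = 1"
  using assms mat2_eta[of M] mat2_SL2 by metis

lemma mat2_inverse_transpose:
  assumes "a * d - b * c = 1"
  shows "transpose (matrix_inv (mat2 a b c d)) = mat2 d (- c) (- b) a"
proof -
  let ?M = "mat2 a b c d" and ?N = "mat2 d (- b) (- c) a"
  have 1: "mat2 1 0 0 1 = mat 1" by (simp add: vec_eq_iff forall_2 mat_def)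
  have MN: "?M ** ?N = mat 1" "?N ** ?M = mat 1"
    unfolding mat2_mult 1[symmetric] using assms by (simp_all add: algebra_simps)
  then have "?M ** matrix_inv ?M = mat 1"
    unfolding matrix_inv_def by (rule_tac someI2[of _ ?N]) auto
  then have "matrix_inv ?M = ?N"
    using MN(2) by (metis matrix_mul_assoc matrix_mul_lid matrix_mul_rid)
  then show ?thesis by (simp add: vec_eq_iff forall_2 transpose_def)
qed

definition phi_word :: "'n \<Rightarrow> real^2^2 \<Rightarrow> 'n km_letter list" where
  "phi_word i M = (if M$2$1 = 0
      then [Tor (coroot_tor i (M$1$1)), Root (LScale (M$1$2 / M$1$1) (GenE i))]
      else [Root (LScale ((M$1$1 - 1) / M$2$1) (GenE i)), Root (LScale (M$2$1) (GenF i)),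
            Root (LScale ((M$2$2 - 1) / M$2$1) (GenE i))])"

lemma km_phi_word: "km_phi A i M = km_class A (phi_word i M)"
  by (simp add: km_phi_def phi_word_def)

lemma phi_word_valid: "M \<in> SL2 \<Longrightarrow> phi_word i M \<in> km_words A"
  by (auto simp: phi_word_def km_words_Cons valid_E valid_F[OF gcm] valid_Tor coroot_tor_def
      SL2_def det_2)

lemma wd_phi_word: "wd A (phi_word i M) = phi A i (M$1$1) (M$1$2) (M$2$1) (M$2$2)"
  by (simp add: phi_word_def phi_def wX_def wY_def wH_def wR_def wT_def wd_Cons[of A _ "_ # _"] mult.assoc)

lemma km_phi_closed [simp]: "M \<in> SL2 \<Longrightarrow> km_phi A i M \<in> \<G>"
  by (simp add: km_phi_word carrier_KM phi_word_valid)

lemma SL2_mult: "M \<in> SL2 \<Longrightarrow> N \<in> SL2 \<Longrightarrow> M ** N \<in> SL2"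
  by (simp add: SL2_def det_mul)

lemma km_phi_mult:
  assumes "M \<in> SL2" "N \<in> SL2"
  shows "km_phi A i (M ** N) = km_phi A i M \<star> km_phi A i N"
proof -
  have "wd A (phi_word i (M ** N)) = wd A (phi_word i M @ phi_word i N)"
    using assms
    by (elim SL2_cases) (simp add: wd_append wd_phi_word mat2_mult phi_mult[OF gcm])
  then show ?thesis
    using assms by (simp add: km_phi_word KM_mult phi_word_valid km_class_eq SL2_mult)
qed

lemma phi_elementary:
  "phi A i 1 c 0 1 = wX A i c" "phi A i 1 0 c 1 = wY A i c" "phi A i r 0 0 (1 / r) = wH A i r"
  by (simp_all add: phi_def wH_1 wX_0[OF gcm] wY_0[OF gcm])

text \<open>The letters \<open>x\<^sub>i(c)\<close>, \<open>y\<^sub>i(c)\<close> and \<open>r^\<alpha>\<^sub>i\<^sup>\<or>\<close> are values of \<open>\<phi>\<^sub>i\<close>.\<close>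

lemma KM_generated:
  assumes mult: "\<And>g h. g \<in> Q \<Longrightarrow> h \<in> Q \<Longrightarrow> g \<star> h \<in> Q"
    and phi: "\<And>i M. M \<in> SL2 \<Longrightarrow> km_phi A i M \<in> Q"
    and g: "g \<in> \<G>"
  shows "g \<in> Q"
proof -
  obtain w where w: "w \<in> km_words A" "g = km_class A w" using g by (auto simp: carrier_KM)
  let ?P = "\<lambda>u. \<exists>v \<in> km_words A. wd A v = u \<and> km_class A v \<in> Q"
  have phi': "?P (phi A i a b c d)" if "a * d - b * c = 1" for i a b c d
    using phi[of "mat2 a b c d" i] that
    by (intro bexI[of _ "phi_word i (mat2 a b c d)"]) 
       (simp_all add: wd_phi_word mat2_SL2 phi_word_valid flip: km_phi_word)
  have "?P (wd A w)"
  proof (rule word_induct[OF gcm w(1), where P = ?P])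
    fix u1 u2 assume "?P u1" "?P u2"
    then obtain v1 v2 where "v1 \<in> km_words A" "wd A v1 = u1" "km_class A v1 \<in> Q"
      "v2 \<in> km_words A" "wd A v2 = u2" "km_class A v2 \<in> Q" by blast
    then show "?P (u1 * u2)"
      using mult[of "km_class A v1" "km_class A v2"]
      by (intro bexI[of _ "v1 @ v2"]) (auto simp: wd_append KM_mult)
  next
    show "?P 1" using phi'[of 1 1 0 0] phi_elementary(1)[of _ 0] wX_0[OF gcm] by auto
    show "?P (wX A i c)" for i c using phi'[of 1 1 c 0 i] by (simp add: phi_elementary)
    show "?P (wY A i c)" for i c using phi'[of 1 1 0 c i] by (simp add: phi_elementary)
    show "?P (wH A i r)" if "r \<noteq> 0" for i r
      using phi'[of r "1 / r" 0 0 i] that by (simp add: phi_elementary)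
  qed
  then show ?thesis using w by (metis km_class_eq)
qed

subsection \<open>The Cartan--Chevalley involution\<close>

text \<open>All representatives of a class have the same image class, so that the union is this class.\<close>

definition theta :: "'n km \<Rightarrow> 'n km" where
  "theta = restrict (\<lambda>P. \<Union>w \<in> P. km_class A (map letter_omega w)) \<G>"

lemma theta_class:
  assumes "w \<in> km_words A"
  shows "theta (km_class A w) = km_class A (map letter_omega w)"
proof -
  have "km_class A (map letter_omega v) = km_class A (map letter_omega w)" if "v \<in> km_class A w" for v
  proof -
    have "v \<in> km_words A" "km_eq A v w" using that assms by (simp_all add: mem_km_class wd_eq_iff)
    then show ?thesis
      using wd_omega_cong[OF gcm] assms by (simp add: km_class_eq km_words_omega[OF gcm])
  qed
  moreover have "w \<in> km_class A w" using assms by (simp add: mem_km_class)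
  ultimately have "(\<Union>v \<in> km_class A w. km_class A (map letter_omega v)) = km_class A (map letter_omega w)" by blast
  then show ?thesis using assms by (simp add: theta_def carrier_KM)
qed

lemma theta_closed: "g \<in> \<G> \<Longrightarrow> theta g \<in> \<G>"
  by (auto simp: carrier_KM theta_class km_words_omega[OF gcm])

lemma theta_mult:
  "g \<in> \<G> \<Longrightarrow> h \<in> \<G> \<Longrightarrow>
    theta (g \<star> h) = theta g \<star> theta h"
  by (auto simp: carrier_KM theta_class KM_mult km_words_omega[OF gcm])

lemma theta_theta:
  assumes "g \<in> \<G>"
  shows "theta (theta g) = g"
proof -
  obtain w where w: "w \<in> km_words A" "g = km_class A w" using assms by (auto simp: carrier_KM)
  note letter_omega = km_words_omega[OF gcm w(1)]
  have "theta (theta g) = km_class A (map letter_omega (map letter_omega w))"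
    unfolding w(2) theta_class[OF w(1)] theta_class[OF letter_omega] ..
  also have "\<dots> = g"
    unfolding w(2) km_class_eq[OF km_words_omega[OF gcm letter_omega] w(1)] by (rule wd_omega_om[OF gcm w(1)])
  finally show ?thesis .
qed

lemma wd_omega_phi_word:
  assumes "a * d - b * c = 1"
  shows "wd A (map letter_omega (phi_word i (mat2 a b c d))) = phi A i d (- c) (- b) a"
proof (cases "c = 0")
  case True
  then have a: "a \<noteq> 0" "d = 1 / a" using assms by (auto simp: eq_divide_eq mult.commute)
  have "wd A (map letter_omega (phi_word i (mat2 a b c d))) = wH A i (1 / a) * wY A i (- (b / a))"
    using True
    by (simp add: phi_word_def wd_Cons[of A _ "_ # _"] inverse_tor_simps wR_omega_E[OF gcm]
        del: lie_omega.simps flip: wR_def wT_def wH_def)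
  also have "\<dots> = phi A i (1 / a) 0 0 a * phi A i 1 0 (- (b / a)) 1"
    using phi_elementary(3)[of i "1 / a"] by (simp add: phi_elementary)
  also have "\<dots> = phi A i d (- c) (- b) a"
    using a True by (subst phi_mult[OF gcm]) simp_all
  finally show ?thesis .
next
  case False
  have "wd A (map letter_omega (phi_word i (mat2 a b c d)))
      = wY A i (- ((a - 1) / c)) * wX A i (- c) * wY A i (- ((d - 1) / c))"
    using False
    by (simp add: phi_word_def wd_Cons[of A _ "_ # _"] wR_omega_E[OF gcm] wR_omega_F[OF gcm] mult.assoc
        del: lie_omega.simps flip: wR_def)
  also have "\<dots> = phi A i 1 0 (- ((a - 1) / c)) 1 * phi A i 1 (- c) 0 1 * phi A i 1 0 (- ((d - 1) / c)) 1"
    by (simp add: phi_elementary)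
  also have "\<dots> = phi A i 1 (- c) (- ((a - 1) / c)) a * phi A i 1 0 (- ((d - 1) / c)) 1"
    using False by (subst phi_mult[OF gcm]) simp_all
  also have "\<dots> = phi A i d (- c) (- ((a - 1) / c) + a * - ((d - 1) / c)) a"
    using False by (subst phi_mult[OF gcm]) simp_all
  also have "- ((a - 1) / c) + a * - ((d - 1) / c) = - b"
    using False assms by (simp add: field_simps)
  finally show ?thesis .
qed

lemma theta_phi:
  assumes "M \<in> SL2"
  shows "theta (km_phi A i M) = km_phi A i (transpose (matrix_inv M))"
proof -
  obtain a b c d where M: "M = mat2 a b c d" "a * d - b * c = 1" using assms by (rule SL2_cases)
  have N: "mat2 d (- c) (- b) a \<in> SL2" using M(2) by (simp add: mat2_SL2 mult.commute)
  show ?thesis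
    unfolding M(1) mat2_inverse_transpose[OF M(2)] km_phi_word theta_class[OF phi_word_valid[OF assms[unfolded M(1)]]]
    using assms N M
    by (subst km_class_eq) (simp_all add: km_words_omega[OF gcm] phi_word_valid wd_omega_phi_word wd_phi_word)
qed

text \<open>Uniqueness holds because the images of the \<open>\<phi>\<^sub>i\<close> generate.\<close>

lemma km_theta: "km_theta A = theta"
  unfolding km_theta_def
proof (rule the_equality)
  have "theta \<in> iso (KM A) (KM A)"
  proof (rule isoI)
    show "theta \<in> hom (KM A) (KM A)" by (auto simp: hom_def theta_closed theta_mult)
    show "bij_betw theta \<G> \<G>"
      by (rule bij_betwI[where g = theta]) (auto simp: theta_closed theta_theta)
  qed
  then show "theta \<in> iso (KM A) (KM A) \<and> theta \<in> extensional \<G> \<and>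
      (\<forall>g\<in>\<G>. theta (theta g) = g) \<and>
      (\<forall>i. \<forall>M\<in>SL2. theta (km_phi A i M) = km_phi A i (transpose (matrix_inv M)))"
    using theta_theta theta_phi by (simp add: theta_def)
next
  fix \<theta>
  assume \<theta>: "\<theta> \<in> iso (KM A) (KM A) \<and> \<theta> \<in> extensional \<G> \<and>
      (\<forall>g\<in>\<G>. \<theta> (\<theta> g) = g) \<and>
      (\<forall>i. \<forall>M\<in>SL2. \<theta> (km_phi A i M) = km_phi A i (transpose (matrix_inv M)))"
  have hom: "\<theta> (g \<star> h) = \<theta> g \<star> \<theta> h"
    if "g \<in> \<G>" "h \<in> \<G>" for g h
    using \<theta> that by (auto simp: iso_def hom_def)
  have "g \<in> {g \<in> \<G>. \<theta> g = theta g}" if "g \<in> \<G>" for g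
    by (rule KM_generated[OF _ _ that]) (use \<theta> in \<open>auto simp: hom theta_mult theta_phi\<close>)
  then show "\<theta> = theta"
    using \<theta> by (intro extensionalityI[of _ "\<G>"]) (auto simp: theta_def)
qed

section \<open>The reduced group\<close>

lemma km_tor_mult:
  "(\<And>i. s$i \<noteq> 0) \<Longrightarrow> (\<And>i. t$i \<noteq> 0) \<Longrightarrow> km_tor A s \<star> km_tor A t = km_tor A (s * t)"
  using wT_mult[of s t A]
  by (simp add: km_tor_def KM_mult km_words_Cons valid_Tor km_class_eq wd_Cons[of A _ "_ # _"] wT_def)

lemma km_tor_one: "km_tor A 1 = \<one>\<^bsub>KM A\<^esub>"
  using wT_one[of A] by (simp add: km_tor_def KM_one km_words_Cons valid_Tor km_class_eq wT_def wd_Nil)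

lemma km_tor_closed: "(\<And>i. t$i \<noteq> 0) \<Longrightarrow> km_tor A t \<in> \<G>"
  by (simp add: km_tor_def carrier_KM km_words_Cons valid_Tor)

lemma theta_tor: "(\<And>i. t$i \<noteq> 0) \<Longrightarrow> theta (km_tor A t) = km_tor A (\<chi> i. 1 / t$i)"
  by (simp add: km_tor_def theta_class km_words_Cons valid_Tor)

text \<open>This is where the complex logarithm \<open>z\<close> in the definition of \<open>C\<close> enters: \<open>\<alpha>\<^sub>j(t) = exp(\<alpha>\<^sub>j(z)) = 1\<close>.\<close>

lemma exp_ker_char:
  assumes "\<And>i. of_real (t$i) = exp (z$i)" "(\<Sum>i\<in>UNIV. z$i * of_int (A$i$j)) = (0::complex)"
  shows "char_tor A j t = 1"
proof -
  have "complex_of_real (char_tor A j t) = (\<Prod>i\<in>UNIV. exp (z$i) powi A$i$j)"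
    by (simp add: char_tor_def of_real_power_int assms(1))
  also have "\<dots> = exp (\<Sum>i\<in>UNIV. z$i * of_int (A$i$j))"
    by (simp add: exp_power_int exp_sum mult.commute)
  finally show ?thesis using assms(2) by (simp add: of_real_eq_1_iff)
qed

lemma km_C_obtain:
  assumes "c \<in> km_C A"
  obtains t z where "c = km_tor A t" "\<And>i. t$i \<noteq> 0" "\<And>i. of_real (t$i) = exp (z$i)"
    "\<And>j. (\<Sum>i\<in>UNIV. z$i * of_int (A$i$j)) = (0::complex)"
proof -
  from assms obtain t where t: "c = km_tor A t" "\<forall>i. t$i \<noteq> 0"
    and "\<exists>z::complex^'n. (\<forall>i. of_real (t$i) = exp (z$i)) \<and> (\<forall>j. (\<Sum>i\<in>UNIV. z$i * of_int (A$i$j)) = 0)"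
    unfolding km_C_def by blast
  then obtain z :: "complex^'n" where "\<forall>i. of_real (t$i) = exp (z$i)"
    "\<forall>j. (\<Sum>i\<in>UNIV. z$i * of_int (A$i$j)) = 0" by blast
  then show ?thesis using t by (intro that[of t z]) blast+
qed

lemma km_CI:
  assumes "\<And>i. t$i \<noteq> 0" "\<And>i. of_real (t$i) = exp (z$i)"
    "\<And>j. (\<Sum>i\<in>UNIV. z$i * of_int (A$i$j)) = (0::complex)"
  shows "km_tor A t \<in> km_C A"
  using assms unfolding km_C_def by blast

lemma km_C_inverse:
  assumes t: "\<And>i. t$i \<noteq> 0" "\<And>i. of_real (t$i) = exp (z$i)"
    "\<And>j. (\<Sum>i\<in>UNIV. z$i * of_int (A$i$j)) = (0::complex)"
  shows "km_tor A (\<chi> i. 1 / t$i) \<in> km_C A"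
  by (rule km_CI[of _ "- z"]) (simp_all add: t exp_minus inverse_eq_divide sum_negf)

lemma km_C_closed: "c \<in> km_C A \<Longrightarrow> c \<in> \<G>"
  by (elim km_C_obtain) (simp add: km_tor_closed)

lemma km_C_central:
  assumes "c \<in> km_C A" "g \<in> \<G>"
  shows "c \<star> g = g \<star> c"
proof -
  obtain t z where t: "c = km_tor A t" "\<And>i. t$i \<noteq> 0" "\<And>i. of_real (t$i) = exp (z$i)"
    "\<And>j. (\<Sum>i\<in>UNIV. z$i * of_int (A$i$j)) = (0::complex)"
    using assms(1) by (rule km_C_obtain) blast
  obtain w where w: "w \<in> km_words A" "g = km_class A w" using assms(2) by (auto simp: carrier_KM)
  have "char_tor A j t = 1" for j by (rule exp_ker_char[OF t(3,4)])
  from central_torus[OF gcm t(2) this w(1)]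
  have "wd A ([Tor t] @ w) = wd A (w @ [Tor t])"
    unfolding wd_append wT_def .
  then show ?thesis
    unfolding t(1) w(2) km_tor_def using w(1) t(2)
    by (simp add: KM_mult km_words_Cons valid_Tor km_class_eq)
qed

lemma subgroup_C: "subgroup (km_C A) (KM A)"
proof (rule G.subgroupI)
  show "km_C A \<subseteq> \<G>" using km_C_closed by blast
  have "km_tor A 1 \<in> km_C A" by (rule km_CI[of _ 0]) simp_all
  then show "km_C A \<noteq> {}" by blast
next
  fix c assume "c \<in> km_C A"
  then obtain t z where t: "c = km_tor A t" "\<And>i. t$i \<noteq> 0" "\<And>i. of_real (t$i) = exp (z$i)"
    "\<And>j. (\<Sum>i\<in>UNIV. z$i * of_int (A$i$j)) = (0::complex)"
    by (rule km_C_obtain) blast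
  have "(\<chi> i. 1 / t$i) * t = 1" using t(2) by (simp add: vec_eq_iff)
  then have "km_tor A (\<chi> i. 1 / t$i) \<star> c = \<one>\<^bsub>KM A\<^esub>"
    using km_tor_mult[of "\<chi> i. 1 / t$i" t] t(2) by (simp add: t(1) km_tor_one)
  then have "inv\<^bsub>KM A\<^esub> c = km_tor A (\<chi> i. 1 / t$i)"
    using t(2) by (intro G.inv_equality) (simp_all add: t(1) km_tor_closed)
  then show "inv\<^bsub>KM A\<^esub> c \<in> km_C A" using km_C_inverse[OF t(2-4)] by simp
next
  fix c d assume c: "c \<in> km_C A" and d: "d \<in> km_C A"
  obtain s y where s: "c = km_tor A s" "\<And>i. s$i \<noteq> 0" "\<And>i. of_real (s$i) = exp (y$i)"
    "\<And>j. (\<Sum>i\<in>UNIV. y$i * of_int (A$i$j)) = (0::complex)"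
    using c by (rule km_C_obtain) blast
  obtain t z where t: "d = km_tor A t" "\<And>i. t$i \<noteq> 0" "\<And>i. of_real (t$i) = exp (z$i)"
    "\<And>j. (\<Sum>i\<in>UNIV. z$i * of_int (A$i$j)) = (0::complex)"
    using d by (rule km_C_obtain) blast
  have "km_tor A (s * t) \<in> km_C A"
    by (rule km_CI[of _ "y + z"])
       (simp_all add: s(2-4) t(2-4) exp_add distrib_right sum.distrib)
  then show "c \<star> d \<in> km_C A"
    using km_tor_mult[OF s(2) t(2)] by (simp add: s(1) t(1))
qed

lemma normal_C: "normal (km_C A) (KM A)"
proof (rule G.normalI[OF subgroup_C], rule ballI)
  fix x assume "x \<in> \<G>"
  then show "km_C A #>\<^bsub>KM A\<^esub> x = x <#\<^bsub>KM A\<^esub> km_C A"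
    unfolding r_coset_def l_coset_def by (intro SUP_cong refl) (metis km_C_central)
qed

sublocale C: normal "km_C A" "KM A" by (rule normal_C)

sublocale B: group "KM_bar A"
  unfolding KM_bar_def by (rule C.factorgroup_is_group)

abbreviation mult_bar (infixl "\<cdot>" 70) where "g \<cdot> h \<equiv> g \<otimes>\<^bsub>KM_bar A\<^esub> h"
abbreviation unit_bar where "unit_bar \<equiv> \<one>\<^bsub>KM_bar A\<^esub>"
abbreviation \<G>\<^sub>b where "\<G>\<^sub>b \<equiv> carrier (KM_bar A)"

abbreviation bar :: "'n km \<Rightarrow> 'n km set" where
  "bar g \<equiv> km_C A #>\<^bsub>KM A\<^esub> g"

lemma carrier_bar: "\<G>\<^sub>b = bar ` \<G>"
  unfolding KM_bar_def by (rule carrier_FactGroup)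

lemma bar_mult:
  "g \<in> \<G> \<Longrightarrow> h \<in> \<G> \<Longrightarrow> bar (g \<star> h) = bar g \<cdot> bar h"
  by (simp add: KM_bar_def C.rcos_sum)

lemma bar_closed: "g \<in> \<G> \<Longrightarrow> bar g \<in> \<G>\<^sub>b"
  by (simp add: carrier_bar)

text \<open>The involution inverts the torus, and \<open>- z\<close> is a logarithm of the inverse.\<close>

lemma theta_C: "theta ` km_C A = km_C A"
proof -
  have sub: "theta c \<in> km_C A" if "c \<in> km_C A" for c
    using that by (elim km_C_obtain) (simp add: theta_tor km_C_inverse)
  have "c \<in> theta ` km_C A" if "c \<in> km_C A" for c
    using sub[OF that] theta_theta[OF km_C_closed[OF that]] by (metis imageI)
  with sub show ?thesis by blast
qed

lemma theta_bar: "g \<in> \<G> \<Longrightarrow> theta ` bar g = bar (theta g)"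
proof -
  assume g: "g \<in> \<G>"
  have "theta ` bar g = (\<lambda>c. theta c \<star> theta g) ` km_C A"
    using g by (simp add: r_coset_def theta_mult km_C_closed image_UN UNION_singleton_eq_range image_image cong: image_cong_simp)
  also have "\<dots> = (\<lambda>c. c \<star> theta g) ` (theta ` km_C A)"
    by (simp add: image_image)
  also have "\<dots> = bar (theta g)"
    unfolding theta_C by (auto simp: r_coset_def)
  finally show ?thesis .
qed

lemma K_bar_iff: "g \<in> \<G> \<Longrightarrow> bar g \<in> K_bar A \<longleftrightarrow> bar (theta g) = bar g"
  by (simp add: K_bar_def km_theta theta_bar bar_closed)

lemma K_bar_obtain:
  assumes "P \<in> K_bar A"
  obtains g where "g \<in> \<G>" "P = bar g" "bar (theta g) = bar g"
proof -
  have "P \<in> \<G>\<^sub>b" using assms by (simp add: K_bar_def)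
  then obtain g where g: "g \<in> \<G>" "P = bar g" unfolding carrier_bar by (rule imageE)
  show ?thesis
    by (rule that[OF g]) (use assms g K_bar_iff[OF g(1)] in simp)
qed

lemma subgroup_K: "subgroup (K_bar A) (KM_bar A)"
proof (rule B.subgroupI)
  show "K_bar A \<subseteq> \<G>\<^sub>b" by (auto simp: K_bar_def)
  have "theta \<one>\<^bsub>KM A\<^esub> = \<one>\<^bsub>KM A\<^esub>"
    by (simp add: KM_one theta_class)
  then have "bar \<one>\<^bsub>KM A\<^esub> \<in> K_bar A" by (subst K_bar_iff) simp_all
  then show "K_bar A \<noteq> {}" by (metis empty_iff)
next
  fix P Q assume PQ: "P \<in> K_bar A" "Q \<in> K_bar A"
  obtain g where g: "g \<in> \<G>" "P = bar g" "bar (theta g) = bar g"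
    using PQ(1) by (rule K_bar_obtain)
  obtain h where h: "h \<in> \<G>" "Q = bar h" "bar (theta h) = bar h"
    using PQ(2) by (rule K_bar_obtain)
  note gh = g h
  have "bar (theta (g \<star> h)) = bar (g \<star> h)"
    using gh by (simp add: theta_mult bar_mult theta_closed)
  then have "bar (g \<star> h) \<in> K_bar A"
    using gh by (simp add: K_bar_iff)
  then show "P \<cdot> Q \<in> K_bar A" using gh by (simp add: bar_mult)
next
  fix P assume P: "P \<in> K_bar A"
  then obtain g where g: "g \<in> \<G>" "P = bar g" "bar (theta g) = bar g"
    by (rule K_bar_obtain)
  have one: "theta \<one>\<^bsub>KM A\<^esub> = \<one>\<^bsub>KM A\<^esub>"
    by (simp add: KM_one theta_class)
  have inv: "inv\<^bsub>KM_bar A\<^esub> (bar h) = bar (inv\<^bsub>KM A\<^esub> h)" if "h \<in> \<G>" for h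
  proof (rule B.inv_equality)
    have "bar (inv\<^bsub>KM A\<^esub> h) \<cdot> bar h = bar \<one>\<^bsub>KM A\<^esub>"
      using that by (simp flip: bar_mult)
    then show "bar (inv\<^bsub>KM A\<^esub> h) \<cdot> bar h = unit_bar"
      using C.subset by (simp add: KM_bar_def)
  qed (use that in \<open>auto intro: bar_closed\<close>)
  have "theta (inv\<^bsub>KM A\<^esub> g) \<star> theta g = \<one>\<^bsub>KM A\<^esub>"
    using g(1) by (simp add: one flip: theta_mult)
  then have "theta (inv\<^bsub>KM A\<^esub> g) = inv\<^bsub>KM A\<^esub> (theta g)"
    using g(1) by (intro G.inv_equality[symmetric]) (auto intro: theta_closed)
  then have "bar (theta (inv\<^bsub>KM A\<^esub> g)) = bar (inv\<^bsub>KM A\<^esub> g)"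
    using g by (simp add: inv[symmetric] theta_closed)
  then have "bar (inv\<^bsub>KM A\<^esub> g) \<in> K_bar A"
    using g(1) by (simp add: K_bar_iff)
  then show "inv\<^bsub>KM_bar A\<^esub> P \<in> K_bar A" using g by (simp add: inv)
qed

lemma rotation_in_K:
  assumes "c\<^sup>2 + s\<^sup>2 = 1"
  shows "bar (km_phi A i (mat2 c (- s) s c)) \<in> K_bar A"
proof -
  have det: "c * c - - s * s = 1" using assms by (simp add: power2_eq_square)
  then have M: "mat2 c (- s) s c \<in> SL2" by (simp add: mat2_SL2)
  show ?thesis
    using theta_phi[OF M, of i] by (simp add: K_bar_iff M mat2_inverse_transpose[OF det])
qed

text \<open>Every upper unipotent matrix is \<open>k a k'\<close> with rotations \<open>k, k'\<close> and \<open>a\<close> diagonal, and every matrix in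
  \<open>SL\<^sub>2\<close> is a rotation times a diagonal times an upper unipotent matrix. Thus the semigroup \<open>S\<close> contains
  the images of all \<open>\<phi>\<^sub>i\<close>.\<close>

lemma rotations_and_diagonals_generate:
  assumes S: "S \<subseteq> \<G>\<^sub>b"
    and mult: "\<And>g h. g \<in> S \<Longrightarrow> h \<in> S \<Longrightarrow> g \<cdot> h \<in> S"
    and K: "K_bar A \<subseteq> S"
    and diag: "\<And>i r. r > 0 \<Longrightarrow> bar (km_phi A i (mat2 r 0 0 (1 / r))) \<in> S"
  shows "S = \<G>\<^sub>b"
proof -
  have prod: "bar (km_phi A i (M ** N)) \<in> S"
    if "M \<in> SL2" "N \<in> SL2" "bar (km_phi A i M) \<in> S" "bar (km_phi A i N) \<in> S" for i M N
    using that mult by (simp add: km_phi_mult bar_mult)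
  have rot: "bar (km_phi A i (mat2 c (- s) s c)) \<in> S" "mat2 c (- s) s c \<in> SL2" if "c\<^sup>2 + s\<^sup>2 = 1" for i c s
    using rotation_in_K[OF that] K that by (auto simp: mat2_SL2 power2_eq_square)
  have upper: "bar (km_phi A i (mat2 1 x 0 1)) \<in> S" for i x
  proof -
    \<comment> \<open>\<open>t\<close> is the positive root of \<open>t - 1/t = x\<close>, and \<open>u\<close> normalizes the columns \<open>(t, 1)\<close> of the rotations.\<close>
    define q where "q = sqrt (x\<^sup>2 + 4)"
    have "0 < x\<^sup>2 + 4" by (simp add: add_nonneg_pos)
    then have q: "q * q = x * x + 4" by (simp add: q_def power2_eq_square)
    have "sqrt (x\<^sup>2) < q" unfolding q_def by (subst real_sqrt_less_iff) simp
    then have "\<bar>x\<bar> < q" by simp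
    define t where "t = (x + q) / 2"
    define w where "w = 1 / t"
    define u where "u = 1 / sqrt (1 + t * t)"
    have t: "t > 0" using \<open>\<bar>x\<bar> < q\<close> by (simp add: t_def)
    have tw: "t * w = 1" using t by (simp add: w_def)
    have "t * t = x * t + 1" using q by (simp add: t_def field_simps)
    then have "t * (t - w) = t * x" using tw by (simp add: algebra_simps)
    then have x: "x = t - w" using t by simp
    have "0 < 1 + t * t" by (simp add: add_pos_nonneg)
    then have "sqrt (1 + t * t) * sqrt (1 + t * t) = 1 + t * t" "sqrt (1 + t * t) \<noteq> 0" by simp_all
    then have u: "u * u * (1 + t * t) = 1"
      unfolding u_def using \<open>0 < 1 + t * t\<close> by simp
    have k1: "(t * u)\<^sup>2 + u\<^sup>2 = 1" and k2: "u\<^sup>2 + (- (t * u))\<^sup>2 = 1"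
      using u by (simp_all add: power2_eq_square algebra_simps)
    have d: "mat2 t 0 0 (1 / t) \<in> SL2" using t by (simp add: mat2_SL2)
    have "t * u * t * u + - u * w * - (t * u) = 1" "t * u * t * (t * u) + - u * w * u = t - w"
      "u * t * u + t * u * w * - (t * u) = 0" "u * t * (t * u) + t * u * w * u = 1"
      using u tw by algebra+
    then have "mat2 (t * u) (- u) u (t * u) ** mat2 t 0 0 (1 / t) ** mat2 u (- (- (t * u))) (- (t * u)) u
        = mat2 1 x 0 1"
      unfolding mat2_mult w_def[symmetric] x
      by (simp only: mult_zero_left mult_zero_right add_0_left add_0_right minus_minus)
    then show ?thesis
      using prod[OF SL2_mult[OF rot(2)[OF k1] d] rot(2)[OF k2] prod[OF rot(2)[OF k1] d rot(1)[OF k1] diag[OF t]]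
          rot(1)[OF k2], of i] by simp
  qed
  have all: "bar (km_phi A i M) \<in> S" if M_SL2: "M \<in> SL2" for i M
  proof -
    obtain a b c d where M: "M = mat2 a b c d" "a * d - b * c = 1" using M_SL2 by (rule SL2_cases)
    \<comment> \<open>\<open>r\<close> is the length of the first column, which the rotation maps to the first axis.\<close>
    define r where "r = sqrt (a\<^sup>2 + c\<^sup>2)"
    have "a\<^sup>2 + c\<^sup>2 > 0" using M(2) by (auto simp: sum_power2_gt_zero_iff)
    then have r: "r > 0" "r\<^sup>2 = a\<^sup>2 + c\<^sup>2" by (simp_all add: r_def)
    have k: "(a / r)\<^sup>2 + (c / r)\<^sup>2 = 1"
      using r(1) by (simp add: power_divide add_divide_distrib[symmetric] r(2)[symmetric])
    define x where "x = (a * b + c * d) / r\<^sup>2"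
    have D: "mat2 r 0 0 (1 / r) \<in> SL2" and U: "mat2 1 x 0 1 \<in> SL2" using r(1) by (simp_all add: mat2_SL2)
    have "mat2 (a / r) (- (c / r)) (c / r) (a / r) ** mat2 r 0 0 (1 / r) ** mat2 1 x 0 1 = M"
    proof -
      have "a * (a * b + c * d) - c = b * r\<^sup>2" "c * (a * b + c * d) + a = d * r\<^sup>2"
        unfolding r(2) using M(2) by algebra+
      then have "a * x - c / r\<^sup>2 = b" "c * x + a / r\<^sup>2 = d"
        using r(1) by (simp_all add: x_def field_simps)
      then have "a / r * r * x + - (c / r) * (1 / r) = b" "c / r * r * x + a / r * (1 / r) = d"
        "a / r * r = a" "c / r * r = c"
        using r(1) by (simp_all add: power2_eq_square)
      then show ?thesis
        unfolding M(1) mat2_mult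
        by (simp only: mult_zero_left mult_zero_right mult_1_right add_0_left add_0_right)
    qed
    then show ?thesis
      using prod[OF SL2_mult[OF rot(2)[OF k] D] U prod[OF rot(2)[OF k] D rot(1)[OF k] diag[OF r(1)]] upper, of i]
      by simp
  qed
  have "g \<in> {g \<in> \<G>. bar g \<in> S}" if "g \<in> \<G>" for g
    by (rule KM_generated[OF _ _ that]) (simp_all add: bar_mult mult all)
  then have "bar ` \<G> \<subseteq> S" by blast
  then show ?thesis using S unfolding carrier_bar by (rule subset_antisym[rotated])
qed

end

section \<open>Topology\<close>

lemma openin_quotient_topology:
  "openin (quotient_topology \<tau> f) U \<longleftrightarrow> U \<subseteq> f ` topspace \<tau> \<and> openin \<tau> {x \<in> topspace \<tau>. f x \<in> U}"
proof -
  have "istopology (\<lambda>U. U \<subseteq> f ` topspace \<tau> \<and> openin \<tau> {x \<in> topspace \<tau>. f x \<in> U})"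
    unfolding istopology_def
  proof (rule conjI; intro allI impI)
    fix S T
    assume "S \<subseteq> f ` topspace \<tau> \<and> openin \<tau> {x \<in> topspace \<tau>. f x \<in> S}"
      "T \<subseteq> f ` topspace \<tau> \<and> openin \<tau> {x \<in> topspace \<tau>. f x \<in> T}"
    moreover have "{x \<in> topspace \<tau>. f x \<in> S \<inter> T}
        = {x \<in> topspace \<tau>. f x \<in> S} \<inter> {x \<in> topspace \<tau>. f x \<in> T}" by blast
    ultimately show "S \<inter> T \<subseteq> f ` topspace \<tau> \<and> openin \<tau> {x \<in> topspace \<tau>. f x \<in> S \<inter> T}" by auto
  next
    fix \<K>
    assume K: "\<forall>S\<in>\<K>. S \<subseteq> f ` topspace \<tau> \<and> openin \<tau> {x \<in> topspace \<tau>. f x \<in> S}"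
    have "{x \<in> topspace \<tau>. f x \<in> \<Union>\<K>} = (\<Union>S\<in>\<K>. {x \<in> topspace \<tau>. f x \<in> S})" by blast
    moreover have "openin \<tau> (\<Union>S\<in>\<K>. {x \<in> topspace \<tau>. f x \<in> S})" using K by blast
    ultimately show "\<Union>\<K> \<subseteq> f ` topspace \<tau> \<and> openin \<tau> {x \<in> topspace \<tau>. f x \<in> \<Union>\<K>}"
      using K by auto
  qed
  then show ?thesis by (simp add: quotient_topology_def)
qed

lemma topspace_quotient_topology [simp]: "topspace (quotient_topology \<tau> f) = f ` topspace \<tau>"
proof -
  have "{x \<in> topspace \<tau>. f x \<in> f ` topspace \<tau>} = topspace \<tau>" by blast
  then have "openin (quotient_topology \<tau> f) (f ` topspace \<tau>)"
    by (simp add: openin_quotient_topology)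
  then show ?thesis
    by (metis openin_quotient_topology openin_subset openin_topspace subset_antisym)
qed

lemma continuous_map_quotient: "continuous_map \<tau> (quotient_topology \<tau> f) f"
  by (auto simp: continuous_map_def openin_quotient_topology)

lemma continuous_map_from_quotient:
  assumes "continuous_map \<tau> \<sigma> (\<lambda>x. h (f x))"
  shows "continuous_map (quotient_topology \<tau> f) \<sigma> h"
  unfolding continuous_map_def
proof (intro conjI allI impI)
  show "h \<in> topspace (quotient_topology \<tau> f) \<rightarrow> topspace \<sigma>"
    using assms by (auto simp: continuous_map_def)
  fix U assume "openin \<sigma> U"
  then have "openin \<tau> {x \<in> topspace \<tau>. h (f x) \<in> U}"
    using assms by (auto simp: continuous_map_def)
  moreover have "{x \<in> topspace \<tau>. f x \<in> {x \<in> topspace (quotient_topology \<tau> f). h x \<in> U}}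
      = {x \<in> topspace \<tau>. h (f x) \<in> U}" by auto
  ultimately show "openin (quotient_topology \<tau> f) {x \<in> topspace (quotient_topology \<tau> f). h x \<in> U}"
    by (auto simp: openin_quotient_topology)
qed

context kac_moody
begin

text \<open>The supremum of all group topologies that make the \<open>\<phi>\<^sub>i\<close> continuous. Continuity into it can be tested
  on each of these topologies, so it is itself such a topology, and then the finest one.\<close>

definition sup_topology :: "'n km topology" where
  "sup_topology = topology_generated_by {U. \<exists>\<tau>. phi_group_topology A \<tau> \<and> openin \<tau> U}"

lemma phi_group_topologyD:
  assumes "phi_group_topology A \<tau>"
  shows "topspace \<tau> = \<G>"
    "continuous_map (prod_topology \<tau> \<tau>) \<tau> (\<lambda>(x, y). x \<star> y)"
    "continuous_map \<tau> \<tau> (\<lambda>x. inv\<^bsub>KM A\<^esub> x)"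
    "continuous_map (top_of_set SL2) \<tau> (km_phi A i)"
  using assms by (auto simp: phi_group_topology_def group_topology_def)

lemma phi_group_topology_indiscrete:
  "phi_group_topology A (topology_generated_by {\<G>})"
proof -
  let ?\<tau> = "topology_generated_by {\<G>}"
  have into: "continuous_map X ?\<tau> f" if "\<And>x. x \<in> topspace X \<Longrightarrow> f x \<in> \<G>"
    for X :: "'b topology" and f
  proof (rule continuous_on_generated_topo)
    fix U assume "U \<in> {\<G>}"
    then have "f -` U \<inter> topspace X = topspace X" using that by auto
    then show "openin X (f -` U \<inter> topspace X)" by simp
  qed (use that in auto)
  show ?thesis
    unfolding phi_group_topology_def group_topology_def
    by (intro conjI allI into) auto
qed

lemma topspace_sup: "topspace sup_topology = \<G>"
proof -
  have "U \<subseteq> \<G>" if "phi_group_topology A \<tau>" "openin \<tau> U" for \<tau> U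
    using openin_subset[OF that(2)] phi_group_topologyD(1)[OF that(1)] by simp
  moreover have "openin (topology_generated_by {\<G>}) \<G>"
    by (simp add: topology_generated_by_Basis)
  ultimately show ?thesis
    unfolding sup_topology_def topology_generated_by_topspace
    using phi_group_topology_indiscrete by blast
qed

lemma sup_finer: "phi_group_topology A \<tau> \<Longrightarrow> openin \<tau> U \<Longrightarrow> openin sup_topology U"
  unfolding sup_topology_def by (rule topology_generated_by_Basis) blast

lemma continuous_id_sup: "phi_group_topology A \<tau> \<Longrightarrow> continuous_map sup_topology \<tau> (\<lambda>x. x)"
  unfolding continuous_map_def
proof (intro conjI allI impI)
  assume \<tau>: "phi_group_topology A \<tau>"
  show "(\<lambda>x. x) \<in> topspace sup_topology \<rightarrow> topspace \<tau>"
    using phi_group_topologyD(1)[OF \<tau>] by (simp add: topspace_sup)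
  fix U assume U: "openin \<tau> U"
  then have "{x \<in> topspace sup_topology. x \<in> U} = U"
    using phi_group_topologyD(1)[OF \<tau>] openin_subset[OF U] by (auto simp: topspace_sup)
  then show "openin sup_topology {x \<in> topspace sup_topology. x \<in> U}"
    using sup_finer[OF \<tau> U] by simp
qed

lemma continuous_into_sup:
  assumes "\<And>\<tau>. phi_group_topology A \<tau> \<Longrightarrow> continuous_map X \<tau> f"
  shows "continuous_map X sup_topology f"
  unfolding sup_topology_def
proof (rule continuous_on_generated_topo)
  fix U assume "U \<in> {U. \<exists>\<tau>. phi_group_topology A \<tau> \<and> openin \<tau> U}"
  then obtain \<tau> where \<tau>: "phi_group_topology A \<tau>" "openin \<tau> U" by blast
  have "openin X {x \<in> topspace X. f x \<in> U}"
    using assms[OF \<tau>(1)] \<tau>(2) by (simp add: continuous_map_def)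
  moreover have "{x \<in> topspace X. f x \<in> U} = f -` U \<inter> topspace X" by blast
  ultimately show "openin X (f -` U \<inter> topspace X)" by simp
next
  have "f ` topspace X \<subseteq> \<G>"
    using continuous_map_image_subset_topspace[OF assms[OF phi_group_topology_indiscrete]] by simp
  then show "f ` topspace X \<subseteq> \<Union>{U. \<exists>\<tau>. phi_group_topology A \<tau> \<and> openin \<tau> U}"
    using topspace_sup unfolding sup_topology_def topology_generated_by_topspace by simp
qed

lemma phi_group_topology_sup: "phi_group_topology A sup_topology"
  unfolding phi_group_topology_def group_topology_def
proof (intro conjI allI)
  show "topspace sup_topology = \<G>" by (rule topspace_sup)
  show "continuous_map (prod_topology sup_topology sup_topology) sup_topology (\<lambda>(x, y). x \<star> y)"
  proof (rule continuous_into_sup)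
    fix \<tau> assume \<tau>: "phi_group_topology A \<tau>"
    have "continuous_map (prod_topology sup_topology sup_topology) (prod_topology \<tau> \<tau>) (\<lambda>z. (fst z, snd z))"
      using continuous_map_prod_top[of sup_topology sup_topology \<tau> \<tau> "\<lambda>x. x" "\<lambda>x. x"]
        continuous_id_sup[OF \<tau>] by (simp add: case_prod_unfold)
    from continuous_map_compose[OF this phi_group_topologyD(2)[OF \<tau>]]
    show "continuous_map (prod_topology sup_topology sup_topology) \<tau> (\<lambda>(x, y). x \<star> y)"
      by (simp add: o_def case_prod_unfold)
  qed
  show "continuous_map sup_topology sup_topology (\<lambda>x. inv\<^bsub>KM A\<^esub> x)"
  proof (rule continuous_into_sup)
    fix \<tau> assume \<tau>: "phi_group_topology A \<tau>"
    from continuous_map_compose[OF continuous_id_sup[OF \<tau>] phi_group_topologyD(3)[OF \<tau>]]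
    show "continuous_map sup_topology \<tau> (\<lambda>x. inv\<^bsub>KM A\<^esub> x)" by (simp add: o_def)
  qed
  show "continuous_map (top_of_set SL2) sup_topology (km_phi A i)" for i
    by (rule continuous_into_sup) (rule phi_group_topologyD(4))
qed

lemma kac_peterson_eq: "kac_peterson_topology A = sup_topology"
  unfolding kac_peterson_topology_def
proof (rule the_equality)
  show "phi_group_topology A sup_topology \<and>
      (\<forall>\<tau>'. phi_group_topology A \<tau>' \<longrightarrow> (\<forall>U. openin \<tau>' U \<longrightarrow> openin sup_topology U))"
    using phi_group_topology_sup sup_finer by blast
next
  fix \<tau> assume "phi_group_topology A \<tau> \<and> (\<forall>\<tau>'. phi_group_topology A \<tau>' \<longrightarrow> (\<forall>U. openin \<tau>' U \<longrightarrow> openin \<tau> U))"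
  then show "\<tau> = sup_topology"
    unfolding topology_eq using phi_group_topology_sup sup_finer by blast
qed

lemmas phi_group_topology_kac_peterson = phi_group_topology_sup[folded kac_peterson_eq]

abbreviation \<T> where "\<T> \<equiv> kac_peterson_topology A"
abbreviation \<T>\<^sub>b where "\<T>\<^sub>b \<equiv> quotient_topology \<T> bar"

lemma X_topology_eq: "X_topology A = quotient_topology \<T>\<^sub>b (X_proj A)"
  by (simp add: X_topology_def)

lemma topspace_bar: "topspace \<T>\<^sub>b = \<G>\<^sub>b"
  by (simp add: phi_group_topologyD(1)[OF phi_group_topology_kac_peterson] carrier_bar)

lemma continuous_mult:
  assumes "continuous_map X \<T> f" "continuous_map X \<T> g"
  shows "continuous_map X \<T> (\<lambda>x. f x \<star> g x)"
proof -
  have "continuous_map X (prod_topology \<T> \<T>) (\<lambda>x. (f x, g x))"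
    using assms by (rule continuous_map_pairedI)
  from continuous_map_compose[OF this phi_group_topologyD(2)[OF phi_group_topology_kac_peterson]]
  show ?thesis by (simp add: o_def)
qed

lemma continuous_left_mult_bar:
  assumes "P \<in> \<G>\<^sub>b"
  shows "continuous_map \<T>\<^sub>b \<T>\<^sub>b (\<lambda>Q. P \<cdot> Q)"
proof (rule continuous_map_from_quotient)
  obtain g where g: "g \<in> \<G>" "P = bar g" using assms unfolding carrier_bar by blast
  note top = phi_group_topologyD(1)[OF phi_group_topology_kac_peterson]
  have "continuous_map \<T> \<T> (\<lambda>x. g \<star> x)"
    by (rule continuous_mult) (simp_all add: top g)
  from continuous_map_compose[OF this continuous_map_quotient[of \<T> bar]]
  have "continuous_map \<T> \<T>\<^sub>b (\<lambda>x. bar (g \<star> x))" by (simp add: o_def)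
  then show "continuous_map \<T> \<T>\<^sub>b (\<lambda>x. P \<cdot> bar x)"
    by (rule continuous_map_eq) (simp add: top g bar_mult)
qed

subsection \<open>The action on the symmetric space\<close>

definition act :: "'n km set \<Rightarrow> 'n km_point \<Rightarrow> 'n km_point" where
  "act g P = g <#\<^bsub>KM_bar A\<^esub> P"

lemma act_X_proj:
  "g \<in> \<G>\<^sub>b \<Longrightarrow> h \<in> \<G>\<^sub>b \<Longrightarrow>
    act g (X_proj A h) = X_proj A (g \<cdot> h)"
  unfolding act_def X_proj_def by (rule B.lcos_m_assoc) (simp_all add: subgroup.subset[OF subgroup_K])

lemma continuous_act:
  assumes "g \<in> \<G>\<^sub>b"
  shows "continuous_map (X_topology A) (X_topology A) (act g)"
  unfolding X_topology_eq
proof (rule continuous_map_from_quotient)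
  have "continuous_map \<T>\<^sub>b (quotient_topology \<T>\<^sub>b (X_proj A)) (\<lambda>h. X_proj A (g \<cdot> h))"
    using continuous_map_compose[OF continuous_left_mult_bar[OF assms] continuous_map_quotient[of \<T>\<^sub>b "X_proj A"]]
    by (simp add: o_def)
  then show "continuous_map \<T>\<^sub>b (quotient_topology \<T>\<^sub>b (X_proj A)) (\<lambda>h. act g (X_proj A h))"
    by (rule continuous_map_eq) (simp add: assms act_X_proj topspace_bar[simplified])
qed

lemma X_proj_K:
  assumes "k \<in> K_bar A"
  shows "X_proj A k = X_proj A unit_bar"
proof -
  have K: "K_bar A \<subseteq> \<G>\<^sub>b" by (rule subgroup.subset[OF subgroup_K])
  have "k \<in> unit_bar <#\<^bsub>KM_bar A\<^esub> K_bar A" using assms K by (simp add: B.lcos_mult_one)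
  then show ?thesis
    unfolding X_proj_def by (metis B.l_repr_independence B.one_closed subgroup_K)
qed

subsection \<open>The exponential map\<close>

lemma km_exp_bar: "km_exp A v = bar (km_tor A (\<chi> i. exp (v$i)))"
  by (simp add: km_exp_def)

lemma km_exp_closed [simp]: "km_exp A v \<in> \<G>\<^sub>b"
  unfolding km_exp_bar by (intro bar_closed km_tor_closed) simp

lemma km_exp_add: "km_exp A (u + v) = km_exp A u \<cdot> km_exp A v"
proof -
  have "(\<chi> i. exp ((u + v)$i)) = (\<chi> i. exp (u$i)) * (\<chi> i. exp (v$i))"
    by (simp add: vec_eq_iff exp_add)
  then show ?thesis
    unfolding km_exp_bar by (simp add: km_tor_mult[symmetric] bar_mult km_tor_closed)
qed

lemma one_bar: "unit_bar = km_C A"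
  by (simp add: KM_bar_def)

text \<open>Such a \<open>v\<close> does not define a geodesic segment, but it can lie in the open cone. Then the curve from
  \<open>g o\<close> to \<open>g exp(v) o\<close> is replaced by the equality of these points.\<close>

lemma km_exp_kernel:
  assumes "a_proj A v = a_proj A 0"
  shows "km_exp A v = unit_bar"
proof -
  have "v \<in> a_proj A v" by (simp add: a_proj_def simple_root_def)
  then have "v \<in> a_proj A 0" using assms by simp
  then have root: "simple_root A j v = 0" for j by (simp add: a_proj_def)
  have "km_tor A (\<chi> i. exp (v$i)) \<in> km_C A"
  proof (rule km_CI[of _ "\<chi> i. of_real (v$i)"])
    fix j
    have "(\<Sum>i\<in>UNIV. (\<chi> i. complex_of_real (v$i)) $ i * of_int (A$i$j)) = of_real (simple_root A j v)"
      by (simp add: simple_root_def)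
    then show "(\<Sum>i\<in>UNIV. (\<chi> i. complex_of_real (v$i)) $ i * of_int (A$i$j)) = 0"
      by (simp add: root)
  qed (simp_all add: exp_of_real)
  then show ?thesis
    unfolding km_exp_bar one_bar by (intro G.coset_join2 subgroup_C) (simp_all add: km_C_closed)
qed

lemma km_exp_0: "km_exp A 0 = unit_bar"
  by (rule km_exp_kernel) simp

lemma km_phi_diag: "r \<noteq> 0 \<Longrightarrow> km_phi A i (mat2 r 0 0 (1 / r)) = km_tor A (coroot_tor i r)"
proof -
  assume r: "r \<noteq> 0"
  then have M: "mat2 r 0 0 (1 / r) \<in> SL2" by (simp add: mat2_SL2)
  have "wd A (phi_word i (mat2 r 0 0 (1 / r))) = wd A [Tor (coroot_tor i r)]"
    by (simp add: wd_phi_word phi_elementary wH_def wT_def)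
  then show ?thesis
    unfolding km_phi_word km_tor_def using r
    by (subst km_class_eq) (simp_all add: phi_word_valid[OF M] km_words_Cons valid_Tor coroot_tor_nonzero)
qed

lemma diag_exp:
  assumes "r > 0"
  shows "bar (km_phi A i (mat2 r 0 0 (1 / r))) = km_exp A (axis i (ln r))"
proof -
  have "coroot_tor i r = (\<chi> j. exp (axis i (ln r) $ j))"
    using assms by (simp add: coroot_tor_def axis_def vec_eq_iff)
  then show ?thesis using assms by (simp add: km_phi_diag km_exp_bar)
qed

text \<open>One coordinate at a time, the curve is a product of curves in the images of the \<open>\<phi>\<^sub>i\<close>.\<close>

lemma continuous_km_tor: "continuous_map euclideanreal \<T> (\<lambda>x. km_tor A (\<chi> i. exp (x * v$i)))"
proof -
  note top = phi_group_topologyD(1)[OF phi_group_topology_kac_peterson]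
  have "continuous_map euclideanreal \<T> (\<lambda>x. km_tor A (\<chi> i. if i \<in> J then exp (x * v$i) else 1))" for J
    using finite[of J]
  proof (induction J rule: finite_induct)
    case empty
    have "km_tor A (\<chi> i. if i \<in> {} then exp (x * v$i) else 1) = \<one>\<^bsub>KM A\<^esub>" for x
    proof -
      have "(\<chi> i. if i \<in> {} then exp (x * v$i) else 1) = 1" by (simp add: vec_eq_iff)
      then show ?thesis by (simp add: km_tor_one)
    qed
    then show ?case by (simp add: top)
  next
    case (insert k J)
    have cont: "continuous_map euclideanreal (top_of_set SL2) (\<lambda>x. mat2 (exp (x * v$k)) 0 0 (1 / exp (x * v$k)))"
    proof -
      have "continuous_on UNIV (\<lambda>x. mat2 (exp (x * v$k)) 0 0 (1 / exp (x * v$k)))"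
        unfolding mat2_def
      proof (intro continuous_on_vec_lambda)
        show "continuous_on UNIV (\<lambda>x. if i = 1 then if j = 1 then exp (x * v$k) else 0
            else if j = 1 then 0 else 1 / exp (x * v$k))" for i j :: 2
          by (cases "i = 1"; cases "j = 1") (auto intro!: continuous_intros)
      qed
      then show ?thesis by (auto simp: continuous_map_in_subtopology mat2_SL2)
    qed
    have "continuous_map euclideanreal \<T> (\<lambda>x. km_phi A k (mat2 (exp (x * v$k)) 0 0 (1 / exp (x * v$k))))"
      using continuous_map_compose[OF cont phi_group_topologyD(4)[OF phi_group_topology_kac_peterson, of k]] by (simp add: o_def)
    from continuous_mult[OF this insert.IH]
    have "continuous_map euclideanreal \<T> (\<lambda>x. km_phi A k (mat2 (exp (x * v$k)) 0 0 (1 / exp (x * v$k)))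
        \<star> km_tor A (\<chi> i. if i \<in> J then exp (x * v$i) else 1))" .
    moreover have "km_phi A k (mat2 (exp (x * v$k)) 0 0 (1 / exp (x * v$k)))
        \<star> km_tor A (\<chi> i. if i \<in> J then exp (x * v$i) else 1)
        = km_tor A (\<chi> i. if i \<in> insert k J then exp (x * v$i) else 1)" for x
    proof -
      have "(\<chi> i. if i \<in> insert k J then exp (x * v$i) else 1)
          = coroot_tor k (exp (x * v$k)) * (\<chi> i. if i \<in> J then exp (x * v$i) else 1)"
        using insert.hyps by (auto simp: vec_eq_iff coroot_tor_def)
      then show ?thesis
        by (simp add: km_phi_diag km_tor_mult coroot_tor_nonzero)
    qed
    ultimately show ?case by simp
  qed
  from this[of UNIV] show ?thesis by simp
qed

lemma continuous_geodesic:
  assumes "g \<in> \<G>\<^sub>b"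
  shows "continuous_map euclideanreal (X_topology A)
    (\<lambda>t. X_proj A (g \<cdot> km_exp A ((a * t + b) *\<^sub>R v)))"
proof -
  have "continuous_map euclideanreal \<T>\<^sub>b (\<lambda>x. km_exp A (x *\<^sub>R v))"
    using continuous_map_compose[OF continuous_km_tor[of v] continuous_map_quotient[of \<T> bar]]
    by (simp add: o_def km_exp_bar)
  moreover have "continuous_map euclideanreal euclideanreal (\<lambda>t. a * t + b)"
    by (auto intro!: continuous_intros)
  ultimately have "continuous_map euclideanreal \<T>\<^sub>b (\<lambda>t. km_exp A ((a * t + b) *\<^sub>R v))"
    using continuous_map_compose[of euclideanreal euclideanreal "\<lambda>t. a * t + b" \<T>\<^sub>b "\<lambda>x. km_exp A (x *\<^sub>R v)"]
    by (simp add: o_def)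
  from continuous_map_compose[OF continuous_map_compose[OF this continuous_left_mult_bar[OF assms]]
      continuous_map_quotient[of \<T>\<^sub>b "X_proj A"]]
  show ?thesis by (simp add: o_def X_topology_eq)
qed

end

section \<open>The open Tits cone\<close>

text \<open>The interior of the reduced Tits cone, pulled back from the quotient of \<open>\<aa>\<close> to \<open>\<aa>\<close> itself.\<close>

definition open_cone :: "int^'n^'n \<Rightarrow> (real^'n::finite) set" where
  "open_cone A = {v. a_proj A v \<in> tits_cone_interior A}"

lemma open_open_cone: "open (open_cone A)"
proof -
  have "openin (quotient_topology euclidean (a_proj A)) (tits_cone_interior A)"
    unfolding tits_cone_interior_def by (rule openin_interior_of)
  then show ?thesis by (simp add: openin_quotient_topology open_cone_def)
qed

lemma simple_root_scale: "simple_root A j (c *\<^sub>R v) = c * simple_root A j v"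
  by (simp add: simple_root_def sum_distrib_left mult.assoc)

lemma a_proj_scale:
  assumes "c \<noteq> 0"
  shows "(*\<^sub>R) c ` a_proj A v = a_proj A (c *\<^sub>R v)"
proof -
  have "u \<in> (*\<^sub>R) c ` a_proj A v" if "u \<in> a_proj A (c *\<^sub>R v)" for u
  proof -
    have "u - c *\<^sub>R v = c *\<^sub>R ((1 / c) *\<^sub>R u - v)" using assms by (simp add: scaleR_diff_right)
    then have "(1 / c) *\<^sub>R u \<in> a_proj A v"
      using that assms by (simp add: a_proj_def simple_root_scale)
    then show ?thesis using assms by (intro image_eqI[of _ _ "(1 / c) *\<^sub>R u"]) simp_all
  qed
  moreover have "c *\<^sub>R u \<in> a_proj A (c *\<^sub>R v)" if "u \<in> a_proj A v" for u
    using that by (simp add: a_proj_def simple_root_scale flip: scaleR_diff_right)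
  ultimately show ?thesis by blast
qed

lemma generated_maps_scale:
  assumes "w \<in> generated_maps (refl_a A)"
  shows "w (c *\<^sub>R v) = c *\<^sub>R w v"
proof -
  have refl: "refl_a A i (c *\<^sub>R v) = c *\<^sub>R refl_a A i v" for i v
    by (simp add: refl_a_def simple_root_scale vec_eq_iff axis_def algebra_simps)
  have "foldr (refl_a A) js (c *\<^sub>R v) = c *\<^sub>R foldr (refl_a A) js v" for js
    by (induction js) (simp_all add: refl)
  then show ?thesis using assms by (auto simp: generated_maps_def)
qed

lemma tits_cone_scale:
  assumes "P \<in> tits_cone A" "c > 0"
  shows "(*\<^sub>R) c ` P \<in> tits_cone A"
proof -
  obtain w v where P: "P = w ` a_proj A v" "w \<in> generated_maps (refl_a A)" "\<forall>i. simple_root A i v \<ge> 0"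
    using assms(1) by (auto simp: tits_cone_def)
  have "(*\<^sub>R) c ` P = w ` ((*\<^sub>R) c ` a_proj A v)"
    unfolding P(1) by (simp add: image_image generated_maps_scale[OF P(2)])
  also have "\<dots> = w ` a_proj A (c *\<^sub>R v)" using assms(2) by (simp add: a_proj_scale)
  finally have "(*\<^sub>R) c ` P = w ` a_proj A (c *\<^sub>R v)" .
  moreover have "\<forall>i. simple_root A i (c *\<^sub>R v) \<ge> 0" using P(3) assms(2) by (simp add: simple_root_scale)
  ultimately show ?thesis using P(2) unfolding tits_cone_def by blast
qed

text \<open>Scaling is a homeomorphism of the quotient of \<open>\<aa>\<close> that preserves the Tits cone.\<close>

lemma open_cone_scale:
  assumes "v \<in> open_cone A" "c > 0"
  shows "c *\<^sub>R v \<in> open_cone A"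
proof -
  let ?T = "quotient_topology euclidean (a_proj A)" and ?I = "tits_cone_interior A"
  let ?U = "(`) ((*\<^sub>R) c) ` ?I"
  have I: "openin ?T ?I" unfolding tits_cone_interior_def by (rule openin_interior_of)
  then have range: "?I \<subseteq> range (a_proj A)" by (simp add: openin_quotient_topology)
  have "{x. a_proj A x \<in> ?U} = (\<lambda>x. (1 / c) *\<^sub>R x) -` {x. a_proj A x \<in> ?I}"
  proof -
    have "a_proj A x \<in> ?U \<longleftrightarrow> a_proj A ((1 / c) *\<^sub>R x) \<in> ?I" for x
    proof
      assume "a_proj A x \<in> ?U"
      then obtain y where y: "a_proj A y \<in> ?I" "a_proj A x = (*\<^sub>R) c ` a_proj A y" using range by blast
      have "a_proj A ((1 / c) *\<^sub>R x) = (*\<^sub>R) (1 / c) ` a_proj A x"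
        using assms(2) by (simp add: a_proj_scale)
      also have "\<dots> = a_proj A y" unfolding y(2) using assms(2) by (simp add: image_image)
      finally show "a_proj A ((1 / c) *\<^sub>R x) \<in> ?I" using y(1) by simp
    next
      assume "a_proj A ((1 / c) *\<^sub>R x) \<in> ?I"
      moreover have "a_proj A x = (*\<^sub>R) c ` a_proj A ((1 / c) *\<^sub>R x)"
        using assms(2) by (simp add: a_proj_scale)
      ultimately show "a_proj A x \<in> ?U" by (rule_tac image_eqI)
    qed
    then show ?thesis by (simp only: vimage_Collect_eq)
  qed
  moreover have "open ((\<lambda>x. (1 / c) *\<^sub>R x) -` {x. a_proj A x \<in> ?I})"
    using open_open_cone[of A] unfolding open_cone_def
    by (rule open_vimage) (intro continuous_intros)
  moreover have "?U \<subseteq> range (a_proj A)"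
  proof
    fix P assume "P \<in> ?U"
    then obtain y where "P = (*\<^sub>R) c ` a_proj A y" using range by blast
    then show "P \<in> range (a_proj A)" using assms(2) by (simp add: a_proj_scale)
  qed
  ultimately have "openin ?T ?U" by (simp add: openin_quotient_topology)
  moreover have "?U \<subseteq> tits_cone A"
  proof -
    have "?I \<subseteq> tits_cone A" unfolding tits_cone_interior_def by (rule interior_of_subset)
    then show ?thesis using tits_cone_scale[OF _ assms(2)] by blast
  qed
  ultimately have sub: "?U \<subseteq> ?I"
    unfolding tits_cone_interior_def by (intro interior_of_maximal)
  have "(*\<^sub>R) c ` a_proj A v \<in> ?U"
    using assms(1) unfolding open_cone_def by (intro imageI) (rule CollectD)
  then have "a_proj A (c *\<^sub>R v) \<in> ?U"
    using assms(2) by (simp only: a_proj_scale)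
  with sub have "a_proj A (c *\<^sub>R v) \<in> ?I" by (rule subsetD)
  then show ?thesis unfolding open_cone_def by (rule CollectI)
qed

section \<open>The causal order\<close>

context kac_moody
begin

lemma causal_cone_eq:
  "causal_cone A x = {X_proj A (g \<cdot> km_exp A v) | g v.
     g \<in> \<G>\<^sub>b \<and> X_proj A g = x \<and> v \<in> open_cone A}"
  by (simp add: causal_cone_def open_cone_def)

lemma causal_cone_act:
  assumes "g \<in> \<G>\<^sub>b" "p \<in> causal_cone A x"
  shows "act g p \<in> causal_cone A (act g x)"
proof -
  obtain h v where p: "p = X_proj A (h \<cdot> km_exp A v)" "h \<in> \<G>\<^sub>b"
    "X_proj A h = x" "v \<in> open_cone A"
    using assms(2) unfolding causal_cone_eq by blast
  show ?thesis
    unfolding causal_cone_eq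
  proof (intro CollectI exI conjI)
    show "act g p = X_proj A (g \<cdot> h \<cdot> km_exp A v)"
      using assms(1) p by (simp add: act_X_proj B.m_assoc)
    show "X_proj A (g \<cdot> h) = act g x"
      using assms(1) p by (simp add: act_X_proj[symmetric])
    show "g \<cdot> h \<in> \<G>\<^sub>b" using assms(1) p(2) by simp
  qed (rule p(4))
qed

lemma pw_geodesic_causal_curveD:
  assumes "pw_geodesic_causal_curve A S T \<gamma>"
  shows "0 < S" "S < T" "continuous_map (top_of_set {S..T}) (X_topology A) \<gamma>"
    "\<forall>t \<in> {S..<T}. \<exists>\<epsilon>>0. t + \<epsilon> \<le> T \<and> \<gamma> ` {t<..<t+\<epsilon>} \<subseteq> causal_cone A (\<gamma> t)"
    "\<exists>(N::nat) \<tau>. \<tau> 0 = S \<and> \<tau> N = T \<and>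
        (\<forall>i<N. \<tau> i < \<tau> (Suc i) \<and> geodesic_segment A (\<tau> i) (\<tau> (Suc i)) \<gamma>)"
proof -
  note pw = assms[unfolded pw_geodesic_causal_curve_def causal_curve_def]
  note c = pw[THEN conjunct1]
  show "0 < S" by (rule c[THEN conjunct1])
  show "S < T" by (rule c[THEN conjunct2, THEN conjunct1])
  show "continuous_map (top_of_set {S..T}) (X_topology A) \<gamma>"
    by (rule c[THEN conjunct2, THEN conjunct2, THEN conjunct1])
  show "\<forall>t \<in> {S..<T}. \<exists>\<epsilon>>0. t + \<epsilon> \<le> T \<and> \<gamma> ` {t<..<t+\<epsilon>} \<subseteq> causal_cone A (\<gamma> t)"
    by (rule c[THEN conjunct2, THEN conjunct2, THEN conjunct2])
  show "\<exists>(N::nat) \<tau>. \<tau> 0 = S \<and> \<tau> N = T \<and>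
        (\<forall>i<N. \<tau> i < \<tau> (Suc i) \<and> geodesic_segment A (\<tau> i) (\<tau> (Suc i)) \<gamma>)"
    by (rule pw[THEN conjunct2])
qed

lemma pw_geodesic_causal_curveI:
  assumes "0 < S" "S < T" "continuous_map (top_of_set {S..T}) (X_topology A) \<gamma>"
    and "\<And>t. t \<in> {S..<T} \<Longrightarrow> \<exists>\<epsilon>>0. t + \<epsilon> \<le> T \<and> \<gamma> ` {t<..<t+\<epsilon>} \<subseteq> causal_cone A (\<gamma> t)"
    and "\<tau> 0 = S" "\<tau> (N::nat) = T"
    and "\<And>i. i < N \<Longrightarrow> \<tau> i < \<tau> (Suc i) \<and> geodesic_segment A (\<tau> i) (\<tau> (Suc i)) \<gamma>"
  shows "pw_geodesic_causal_curve A S T \<gamma>"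
proof -
  have t: "\<forall>t \<in> {S..<T}. \<exists>\<epsilon>>0. t + \<epsilon> \<le> T \<and> \<gamma> ` {t<..<t+\<epsilon>} \<subseteq> causal_cone A (\<gamma> t)"
    using assms(4) by (rule ballI)
  have i: "\<forall>i<N. \<tau> i < \<tau> (Suc i) \<and> geodesic_segment A (\<tau> i) (\<tau> (Suc i)) \<gamma>"
    using assms(7) by (rule allI[OF impI])
  show ?thesis
    unfolding pw_geodesic_causal_curve_def causal_curve_def
    by (intro conjI exI[of _ N] exI[of _ \<tau>] assms(1-3,5,6) t i)
qed

lemma pw_geodesic_causal_curve_act:
  assumes g: "g \<in> \<G>\<^sub>b" and \<gamma>: "pw_geodesic_causal_curve A S T \<gamma>"
  shows "pw_geodesic_causal_curve A S T (\<lambda>t. act g (\<gamma> t))"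
proof -
  note c = pw_geodesic_causal_curveD[OF \<gamma>]
  obtain N \<tau> where \<tau>: "\<tau> 0 = S" "\<tau> (N::nat) = T"
    "\<And>i. i < N \<Longrightarrow> \<tau> i < \<tau> (Suc i)" "\<And>i. i < N \<Longrightarrow> geodesic_segment A (\<tau> i) (\<tau> (Suc i)) \<gamma>"
    using c(5) by blast
  have seg: "geodesic_segment A r s (\<lambda>t. act g (\<gamma> t))" if segment: "geodesic_segment A r s \<gamma>" for r s
  proof -
    obtain h v a b where h: "h \<in> \<G>\<^sub>b" "a_proj A v \<noteq> a_proj A 0" "a \<noteq> 0"
      "\<forall>t \<in> {r..s}. \<gamma> t = X_proj A (h \<cdot> km_exp A ((a * t + b) *\<^sub>R v))"
      using segment unfolding geodesic_segment_def by blast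
    have gh: "g \<cdot> h \<in> \<G>\<^sub>b" using g h(1) by simp
    have eq: "act g (\<gamma> t) = X_proj A (g \<cdot> h \<cdot> km_exp A ((a * t + b) *\<^sub>R v))"
      if "t \<in> {r..s}" for t
      unfolding bspec[OF h(4) that] using g h(1) by (simp add: act_X_proj B.m_assoc)
    show ?thesis
      unfolding geodesic_segment_def
      by (rule exI[of _ "g \<cdot> h"], rule exI[of _ v], rule exI[of _ a], rule exI[of _ b])
         (intro conjI gh h(2,3) ballI eq)
  qed
  have cone: "(\<lambda>t. act g (\<gamma> t)) ` {t<..<t+\<epsilon>} \<subseteq> causal_cone A (act g (\<gamma> t))"
    if sub: "\<gamma> ` {t<..<t+\<epsilon>} \<subseteq> causal_cone A (\<gamma> t)" for t \<epsilon>
  proof (rule image_subsetI)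
    fix s assume "s \<in> {t<..<t+\<epsilon>}"
    then show "act g (\<gamma> s) \<in> causal_cone A (act g (\<gamma> t))"
      by (intro causal_cone_act[OF g] subsetD[OF sub] imageI)
  qed
  have cont: "continuous_map (top_of_set {S..T}) (X_topology A) (\<lambda>t. act g (\<gamma> t))"
    using continuous_map_compose[OF c(3) continuous_act[OF g]] unfolding o_def .
  show ?thesis
  proof (rule pw_geodesic_causal_curveI[where \<tau> = \<tau> and N = N, OF c(1,2) cont _ \<tau>(1,2)])
    fix t assume "t \<in> {S..<T}"
    from bspec[OF c(4) this] obtain \<epsilon> where "\<epsilon> > 0" "t + \<epsilon> \<le> T"
      "\<gamma> ` {t<..<t+\<epsilon>} \<subseteq> causal_cone A (\<gamma> t)" by blast
    then show "\<exists>\<epsilon>>0. t + \<epsilon> \<le> T \<and> (\<lambda>t. act g (\<gamma> t)) ` {t<..<t+\<epsilon>} \<subseteq> causal_cone A (act g (\<gamma> t))"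
      by (intro exI[of _ \<epsilon>] conjI cone)
  next
    fix i assume "i < N"
    then show "\<tau> i < \<tau> (Suc i) \<and> geodesic_segment A (\<tau> i) (\<tau> (Suc i)) (\<lambda>t. act g (\<gamma> t))"
      by (intro conjI \<tau>(3) seg[OF \<tau>(4)])
  qed
qed

lemma causally_precedes_act:
  assumes "g \<in> \<G>\<^sub>b" "causally_precedes A x y"
  shows "causally_precedes A (act g x) (act g y)"
  using assms(2) pw_geodesic_causal_curve_act[OF assms(1)] unfolding causally_precedes_def by blast

text \<open>The geodesic runs over \<open>[1, 2]\<close>, since curves are parametrized by positive times. It is causal
  because all positive multiples of \<open>v\<close> lie in the open cone.\<close>

lemma geodesic_precedes:
  assumes g: "g \<in> \<G>\<^sub>b" and v: "v \<in> open_cone A"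
  shows "causally_precedes A (X_proj A g) (X_proj A (g \<cdot> km_exp A v))"
proof (cases "a_proj A v = a_proj A 0")
  case True
  then show ?thesis using g by (simp add: km_exp_kernel causally_precedes_def)
next
  case False
  define \<gamma> where "\<gamma> t = X_proj A (g \<cdot> km_exp A ((1 * t + (- 1)) *\<^sub>R v))" for t
  have seg: "geodesic_segment A 1 2 \<gamma>"
    unfolding geodesic_segment_def \<gamma>_def
    by (rule exI[of _ g], rule exI[of _ v], rule exI[of _ 1], rule exI[of _ "- 1"]) (simp add: g False)
  have cont: "continuous_map (top_of_set {1..2}) (X_topology A) \<gamma>"
    unfolding \<gamma>_def using continuous_geodesic[OF g] by (rule continuous_map_from_subtopology)
  have step: "\<gamma> s \<in> causal_cone A (\<gamma> t)" if "t < s" for s t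
  proof -
    have "(1 * s + - 1) *\<^sub>R v = (1 * t + - 1) *\<^sub>R v + (s - t) *\<^sub>R v"
      by (simp add: algebra_simps)
    then have "\<gamma> s = X_proj A (g \<cdot> km_exp A ((1 * t + (- 1)) *\<^sub>R v)
        \<cdot> km_exp A ((s - t) *\<^sub>R v))"
      unfolding \<gamma>_def using g by (simp only: km_exp_add B.m_assoc km_exp_closed)
    moreover have "(s - t) *\<^sub>R v \<in> open_cone A" using v that by (intro open_cone_scale) simp_all
    moreover have "g \<cdot> km_exp A ((1 * t + (- 1)) *\<^sub>R v) \<in> \<G>\<^sub>b" using g by simp
    ultimately have "\<gamma> s \<in> causal_cone A (X_proj A (g \<cdot> km_exp A ((1 * t + (- 1)) *\<^sub>R v)))"
      unfolding causal_cone_eq by blast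
    then show ?thesis by (simp only: \<gamma>_def[of t])
  qed
  have causal: "\<forall>t \<in> {1..<2}. \<exists>\<epsilon>>0. t + \<epsilon> \<le> 2 \<and> \<gamma> ` {t<..<t+\<epsilon>} \<subseteq> causal_cone A (\<gamma> t)"
  proof
    fix t :: real assume "t \<in> {1..<2}"
    then show "\<exists>\<epsilon>>0. t + \<epsilon> \<le> 2 \<and> \<gamma> ` {t<..<t+\<epsilon>} \<subseteq> causal_cone A (\<gamma> t)"
      by (intro exI[of _ "2 - t"]) (auto intro: step)
  qed
  have "pw_geodesic_causal_curve A 1 2 \<gamma>"
    by (rule pw_geodesic_causal_curveI[OF _ _ cont causal[THEN bspec],
          where \<tau> = "\<lambda>i. if i = 0 then 1 else 2" and N = 1]) (simp_all add: seg)
  moreover have "\<gamma> 1 = X_proj A g" "\<gamma> 2 = X_proj A (g \<cdot> km_exp A v)"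
    using g by (simp_all add: \<gamma>_def km_exp_0)
  ultimately show ?thesis unfolding causally_precedes_def by blast
qed

lemma partition_mono:
  fixes \<tau> :: "nat \<Rightarrow> real"
  assumes "\<forall>i<N. \<tau> i < \<tau> (Suc i)" "i \<le> j" "j \<le> N"
  shows "\<tau> i \<le> \<tau> j"
  using assms(2,3)
proof (induction j rule: dec_induct)
  case (step n)
  then show ?case using assms(1) by (meson Suc_le_lessD less_imp_le order_trans)
qed simp

text \<open>The second curve is shifted in time to start where the first one ends.\<close>

lemma causally_precedes_trans:
  assumes "causally_precedes A x y" "causally_precedes A y z"
  shows "causally_precedes A x z"
proof (cases "x = y \<or> y = z")
  case True
  then show ?thesis using assms by auto
next
  case False
  obtain S1 T1 \<gamma>1 where 1: "pw_geodesic_causal_curve A S1 T1 \<gamma>1" "\<gamma>1 S1 = x" "\<gamma>1 T1 = y"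
    using assms(1) False unfolding causally_precedes_def by blast
  obtain S2 T2 \<gamma>2 where 2: "pw_geodesic_causal_curve A S2 T2 \<gamma>2" "\<gamma>2 S2 = y" "\<gamma>2 T2 = z"
    using assms(2) False unfolding causally_precedes_def by blast
  note c1 = pw_geodesic_causal_curveD[OF 1(1)]
  note c2 = pw_geodesic_causal_curveD(2-5)[OF 2(1)]
  obtain N1 \<tau>1 where \<tau>1: "\<tau>1 0 = S1" "\<tau>1 (N1::nat) = T1"
    "\<And>i. i < N1 \<Longrightarrow> \<tau>1 i < \<tau>1 (Suc i)" "\<And>i. i < N1 \<Longrightarrow> geodesic_segment A (\<tau>1 i) (\<tau>1 (Suc i)) \<gamma>1"
    using c1(5) by blast
  obtain N2 \<tau>2 where \<tau>2: "\<tau>2 0 = S2" "\<tau>2 (N2::nat) = T2"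
    "\<And>i. i < N2 \<Longrightarrow> \<tau>2 i < \<tau>2 (Suc i)" "\<And>i. i < N2 \<Longrightarrow> geodesic_segment A (\<tau>2 i) (\<tau>2 (Suc i)) \<gamma>2"
    using c2(4) by blast
  define d where "d = S2 - T1"
  define T where "T = T2 - d"
  define \<gamma> where "\<gamma> t = (if t \<le> T1 then \<gamma>1 t else \<gamma>2 (t + d))" for t
  define \<tau> where "\<tau> i = (if i \<le> N1 then \<tau>1 i else \<tau>2 (i - N1) - d)" for i
  have left: "\<gamma> t = \<gamma>1 t" if "t \<le> T1" for t using that by (simp add: \<gamma>_def)
  have right: "\<gamma> t = \<gamma>2 (t + d)" if "T1 \<le> t" for t
    using that 1(3) 2(2) by (cases "t = T1") (auto simp: \<gamma>_def d_def)
  have T: "T1 < T" using c2(1) by (simp add: T_def d_def)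
  have "continuous_map (top_of_set {S1..T}) (X_topology A) \<gamma>"
    unfolding \<gamma>_def
  proof (rule continuous_map_cases_le)
    have "{t \<in> topspace (top_of_set {S1..T}). t \<le> T1} = {S1..T1}" using T by auto
    then show "continuous_map (subtopology (top_of_set {S1..T}) {t \<in> topspace (top_of_set {S1..T}). t \<le> T1})
        (X_topology A) \<gamma>1"
      using c1(3) T by (simp add: subtopology_subtopology Int_absorb1)
    have "{t \<in> topspace (top_of_set {S1..T}). T1 \<le> t} = {T1..T}" using c1(2) by auto
    moreover have "continuous_map (top_of_set {T1..T}) (X_topology A) (\<lambda>t. \<gamma>2 (t + d))"
    proof -
      have "continuous_map (top_of_set {T1..T}) (top_of_set {S2..T2}) (\<lambda>t. t + d)"
        by (auto simp: continuous_map_in_subtopology d_def T_def intro!: continuous_intros)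
      from continuous_map_compose[OF this c2(2)] show ?thesis by (simp add: o_def)
    qed
    ultimately show "continuous_map (subtopology (top_of_set {S1..T}) {t \<in> topspace (top_of_set {S1..T}). T1 \<le> t})
        (X_topology A) (\<lambda>t. \<gamma>2 (t + d))"
      using c1(2) by (simp add: subtopology_subtopology Int_absorb1)
    show "\<gamma>1 t = \<gamma>2 (t + d)" if "t \<in> topspace (top_of_set {S1..T})" "t = T1" for t
      using that 1(3) 2(2) by (simp add: d_def)
  qed auto
  moreover have "\<exists>\<epsilon>>0. t + \<epsilon> \<le> T \<and> \<gamma> ` {t<..<t+\<epsilon>} \<subseteq> causal_cone A (\<gamma> t)" if t: "t \<in> {S1..<T}" for t
  proof (cases "t < T1")
    case True
    then obtain \<epsilon> where e: "\<epsilon> > 0" "t + \<epsilon> \<le> T1" "\<gamma>1 ` {t<..<t+\<epsilon>} \<subseteq> causal_cone A (\<gamma>1 t)"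
      using c1(4) t by (metis atLeastLessThan_iff)
    have "\<gamma> ` {t<..<t+\<epsilon>} = \<gamma>1 ` {t<..<t+\<epsilon>}"
      using e(2) by (intro image_cong) (auto intro!: left)
    then show ?thesis using e True T left[of t] by (intro exI[of _ \<epsilon>]) auto
  next
    case False
    then have "t + d \<in> {S2..<T2}" using t by (auto simp: d_def T_def)
    then obtain \<epsilon> where e: "\<epsilon> > 0" "t + d + \<epsilon> \<le> T2" "\<gamma>2 ` {t + d<..<t + d+\<epsilon>} \<subseteq> causal_cone A (\<gamma>2 (t + d))"
      using c2(3) by blast
    have "\<gamma> s \<in> causal_cone A (\<gamma> t)" if "s \<in> {t<..<t+\<epsilon>}" for s
    proof -
      have "\<gamma> s = \<gamma>2 (s + d)" "\<gamma> t = \<gamma>2 (t + d)" using that False by (auto intro!: right)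
      moreover have "s + d \<in> {t + d<..<t + d+\<epsilon>}" using that by simp
      ultimately show ?thesis using e(3) by auto
    qed
    then show ?thesis using e by (intro exI[of _ \<epsilon>]) (auto simp: T_def)
  qed
  moreover have "\<tau> i < \<tau> (Suc i) \<and> geodesic_segment A (\<tau> i) (\<tau> (Suc i)) \<gamma>" if i: "i < N1 + N2" for i
  proof (cases "i < N1")
    case True
    have "\<tau>1 (Suc i) \<le> T1"
      using partition_mono[of N1 \<tau>1 "Suc i" N1] \<tau>1(2,3) True by auto
    then have "\<gamma> t = \<gamma>1 t" if "t \<in> {\<tau>1 i..\<tau>1 (Suc i)}" for t using that by (intro left) auto
    then have "geodesic_segment A (\<tau>1 i) (\<tau>1 (Suc i)) \<gamma>"
      using \<tau>1(4)[OF True] unfolding geodesic_segment_def by simp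
    then show ?thesis using \<tau>1(3)[OF True] True by (simp add: \<tau>_def)
  next
    case False
    define j where "j = i - N1"
    have j: "j < N2" using False i by (simp add: j_def)
    have \<tau>i: "\<tau> i = \<tau>2 j - d" "\<tau> (Suc i) = \<tau>2 (Suc j) - d"
      using False \<tau>1(2) \<tau>2(1) by (auto simp: \<tau>_def j_def d_def Suc_diff_le)
    have "S2 \<le> \<tau>2 j"
      using partition_mono[of N2 \<tau>2 0 j] \<tau>2(1,3) j by auto
    then have eq: "\<gamma> t = \<gamma>2 (t + d)" if "t \<in> {\<tau>2 j - d..\<tau>2 (Suc j) - d}" for t
      using that by (intro right) (auto simp: d_def)
    obtain h v a b where h: "h \<in> \<G>\<^sub>b" "a_proj A v \<noteq> a_proj A 0" "a \<noteq> 0"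
      "\<forall>t \<in> {\<tau>2 j..\<tau>2 (Suc j)}. \<gamma>2 t = X_proj A (h \<cdot> km_exp A ((a * t + b) *\<^sub>R v))"
      using \<tau>2(4)[OF j] unfolding geodesic_segment_def by blast
    have "\<gamma> t = X_proj A (h \<cdot> km_exp A ((a * t + (a * d + b)) *\<^sub>R v))"
      if "t \<in> {\<tau>2 j - d..\<tau>2 (Suc j) - d}" for t
    proof -
      have "t + d \<in> {\<tau>2 j..\<tau>2 (Suc j)}" using that by auto
      moreover have "a * (t + d) + b = a * t + (a * d + b)" by (simp add: algebra_simps)
      ultimately show ?thesis using eq[OF that] h(4) by (metis (no_types))
    qed
    then have "geodesic_segment A (\<tau>2 j - d) (\<tau>2 (Suc j) - d) \<gamma>"
      unfolding geodesic_segment_def using h(1-3) by blast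
    then show ?thesis using \<tau>2(3)[OF j] by (simp add: \<tau>i)
  qed
  moreover have "\<tau> 0 = S1" "\<tau> (N1 + N2) = T"
    using \<tau>1(1,2) \<tau>2(1,2) by (auto simp: \<tau>_def T_def d_def)
  moreover have "S1 < T" using c1(2) T by simp
  ultimately have "pw_geodesic_causal_curve A S1 T \<gamma>"
    using c1(1) by (intro pw_geodesic_causal_curveI[of S1 T \<gamma> \<tau> "N1 + N2"])
  moreover have "\<gamma> S1 = x" "\<gamma> T = z"
    using left[of S1] right[of T] c1(2) T 1(2) 2(3) by (auto simp: T_def)
  ultimately show ?thesis unfolding causally_precedes_def by blast
qed

text \<open>Stopping before the end of the first segment keeps the remaining curve piecewise geodesic.\<close>

lemma causal_first_step:
  assumes "causally_precedes A x y" "x \<noteq> y"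
  obtains p where "p \<in> causal_cone A x" "causally_precedes A p y"
proof -
  obtain S T \<gamma> where \<gamma>: "pw_geodesic_causal_curve A S T \<gamma>" "\<gamma> S = x" "\<gamma> T = y"
    using assms unfolding causally_precedes_def by blast
  note c = pw_geodesic_causal_curveD[OF \<gamma>(1)]
  obtain N \<tau> where \<tau>: "\<tau> 0 = S" "\<tau> (N::nat) = T"
    "\<And>i. i < N \<Longrightarrow> \<tau> i < \<tau> (Suc i)" "\<And>i. i < N \<Longrightarrow> geodesic_segment A (\<tau> i) (\<tau> (Suc i)) \<gamma>"
    using c(5) by blast
  have N: "N > 0" using \<tau>(1,2) c(2) by (cases N) auto
  obtain \<epsilon> where e: "\<epsilon> > 0" "S + \<epsilon> \<le> T" "\<gamma> ` {S<..<S+\<epsilon>} \<subseteq> causal_cone A x"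
    using c(2,4) \<gamma>(2) by force
  define s where "s = (S + min (S + \<epsilon>) (\<tau> 1)) / 2"
  have \<tau>1: "S < \<tau> 1" using \<tau>(3)[OF N] \<tau>(1) by simp
  have s: "S < s" "s < S + \<epsilon>" "s < \<tau> 1" "s < T"
    using e(1,2) \<tau>1 by (auto simp: s_def min_def)
  have "\<gamma> s \<in> causal_cone A x" using e(3) s by auto
  moreover have "pw_geodesic_causal_curve A s T \<gamma>"
  proof -
    \<comment> \<open>Only the first division point moves; it stays before \<open>\<tau> 1\<close>.\<close>
    define \<sigma> where "\<sigma> i = (if i = 0 then s else \<tau> i)" for i :: nat
    have "continuous_map (top_of_set {s..T}) (X_topology A) \<gamma>"
    proof -
      have "top_of_set {s..T} = subtopology (top_of_set {S..T}) {s..T}"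
        using s(1) by (simp add: subtopology_subtopology Int_absorb1)
      then show ?thesis using continuous_map_from_subtopology[OF c(3)] by simp
    qed
    moreover have "\<forall>t \<in> {s..<T}. \<exists>\<epsilon>>0. t + \<epsilon> \<le> T \<and> \<gamma> ` {t<..<t+\<epsilon>} \<subseteq> causal_cone A (\<gamma> t)"
      using c(4) s(1) by auto
    moreover have "\<sigma> i < \<sigma> (Suc i) \<and> geodesic_segment A (\<sigma> i) (\<sigma> (Suc i)) \<gamma>" if "i < N" for i
    proof (cases "i = 0")
      case True
      have "{s..\<tau> 1} \<subseteq> {\<tau> 0..\<tau> (Suc 0)}" using s(1) \<tau>(1) by auto
      then have "geodesic_segment A s (\<tau> 1) \<gamma>"
        using \<tau>(4)[OF N] unfolding geodesic_segment_def by (meson subsetD)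
      then show ?thesis using True s(3) by (simp add: \<sigma>_def)
    next
      case False
      then show ?thesis using \<tau>(3,4)[OF that] by (simp add: \<sigma>_def)
    qed
    moreover have "\<sigma> 0 = s" "\<sigma> N = T" using N \<tau>(2) by (auto simp: \<sigma>_def)
    ultimately show ?thesis
      using c(1) s(1,4) by (intro pw_geodesic_causal_curveI[of s T \<gamma> \<sigma> N]) auto
  qed
  then have "causally_precedes A (\<gamma> s) y" using \<gamma>(3) unfolding causally_precedes_def by blast
  ultimately show ?thesis by (rule that)
qed

text \<open>The semigroup \<open>S\<close> of the introduction: \<open>neg\<close> and \<open>flat\<close> are the steps from the loop to \<open>exp(- v)\<close> and to
  the whole of \<open>exp \<aa>\<close>.\<close>

lemma closed_causal_loop_imp_trivial:
  assumes g: "g \<in> \<G>\<^sub>b" and v: "v \<in> open_cone A"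
    and return: "causally_precedes A (X_proj A (g \<cdot> km_exp A v)) (X_proj A g)"
    and x: "x \<in> X_bar A" and y: "y \<in> X_bar A"
  shows "causally_precedes A x y"
proof -
  define S where "S = {h \<in> \<G>\<^sub>b. causally_precedes A (X_proj A unit_bar) (X_proj A h)}"
  have mult: "h \<cdot> k \<in> S" if "h \<in> S" "k \<in> S" for h k
  proof -
    have hk: "h \<in> \<G>\<^sub>b" "k \<in> \<G>\<^sub>b" using that by (auto simp: S_def)
    have "causally_precedes A (act h (X_proj A unit_bar)) (act h (X_proj A k))"
      using that hk by (intro causally_precedes_act) (auto simp: S_def)
    then have "causally_precedes A (X_proj A h) (X_proj A (h \<cdot> k))"
      using hk by (simp add: act_X_proj)
    then show ?thesis using that hk causally_precedes_trans by (auto simp: S_def)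
  qed
  have cone: "km_exp A u \<in> S" if "u \<in> open_cone A" for u
    using geodesic_precedes[OF B.one_closed that] by (simp add: S_def)
  \<comment> \<open>Translate \<open>g exp(v) o \<preceq> g o\<close> by \<open>exp(- v) g\<^sup>-\<^sup>1\<close>.\<close>
  have neg: "km_exp A (- v) \<in> S"
  proof -
    let ?h = "km_exp A (- v) \<cdot> inv\<^bsub>KM_bar A\<^esub> g"
    have "km_exp A (- v) \<cdot> km_exp A v = unit_bar"
      by (simp add: km_exp_add[symmetric] km_exp_0)
    then have "?h \<cdot> (g \<cdot> km_exp A v) = unit_bar"
      using g by (simp add: B.m_assoc) (simp add: B.m_assoc[symmetric])
    moreover have "?h \<cdot> g = km_exp A (- v)"
      using g by (simp add: B.m_assoc)
    moreover have "causally_precedes A (act ?h (X_proj A (g \<cdot> km_exp A v))) (act ?h (X_proj A g))"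
      using g by (intro causally_precedes_act return) simp
    ultimately show ?thesis using g by (simp add: act_X_proj S_def)
  qed
  have flat: "km_exp A u \<in> S" for u
  proof -
    have "open ((\<lambda>\<epsilon>. v + \<epsilon> *\<^sub>R u) -` open_cone A)"
      by (rule open_vimage[OF open_open_cone]) (intro continuous_intros)
    moreover have "0 \<in> (\<lambda>\<epsilon>. v + \<epsilon> *\<^sub>R u) -` open_cone A" using v by simp
    ultimately obtain \<delta> where \<delta>: "\<delta> > 0" "ball 0 \<delta> \<subseteq> (\<lambda>\<epsilon>. v + \<epsilon> *\<^sub>R u) -` open_cone A"
      using open_contains_ball by blast
    \<comment> \<open>Steps of the form \<open>u / (n + 1)\<close> reach \<open>u\<close> after finitely many multiplications.\<close>
    obtain n :: nat where n: "1 / real (Suc n) < \<delta>" using \<delta>(1) nat_approx_posE by metis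
    let ?w = "(1 / real (Suc n)) *\<^sub>R u"
    have "1 / real (Suc n) \<in> ball 0 \<delta>" using n by simp
    then have "v + ?w \<in> open_cone A" using subsetD[OF \<delta>(2)] by (simp only: vimage_eq)
    then have "km_exp A (- v) \<cdot> km_exp A (v + ?w) \<in> S" using neg cone mult by blast
    then have w: "km_exp A ?w \<in> S" by (simp add: km_exp_add[symmetric])
    have "km_exp A (real (Suc m) *\<^sub>R ?w) \<in> S" for m
    proof (induction m)
      case (Suc m)
      have "real (Suc (Suc m)) = real (Suc m) + 1" by simp
      then have "real (Suc (Suc m)) *\<^sub>R ?w = real (Suc m) *\<^sub>R ?w + ?w"
        by (simp only: scaleR_add_left scaleR_one)
      then show ?case using mult[OF Suc w] by (simp only: km_exp_add)
    qed (use w in simp)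
    from this[of n] show ?thesis by simp
  qed
  have "S = \<G>\<^sub>b"
  proof (rule rotations_and_diagonals_generate)
    show "S \<subseteq> \<G>\<^sub>b" by (auto simp: S_def)
    show "K_bar A \<subseteq> S"
    proof
      fix k assume k: "k \<in> K_bar A"
      then show "k \<in> S"
        using X_proj_K[OF k] subgroup.subset[OF subgroup_K] by (auto simp: S_def causally_precedes_def)
    qed
    show "bar (km_phi A i (mat2 r 0 0 (1 / r))) \<in> S" if "r > 0" for i r
      unfolding diag_exp[OF that] by (rule flat)
  qed (rule mult)
  moreover obtain h k where hk: "h \<in> \<G>\<^sub>b" "k \<in> \<G>\<^sub>b" "x = X_proj A h" "y = X_proj A k"
    using x y unfolding X_bar_def by blast
  ultimately have "inv\<^bsub>KM_bar A\<^esub> h \<cdot> k \<in> S" by simp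
  then have "causally_precedes A (act h (X_proj A unit_bar)) (act h (X_proj A (inv\<^bsub>KM_bar A\<^esub> h \<cdot> k)))"
    using hk(1) by (intro causally_precedes_act) (auto simp: S_def)
  moreover have "h \<cdot> (inv\<^bsub>KM_bar A\<^esub> h \<cdot> k) = k"
    using hk by (simp add: B.m_assoc[symmetric])
  ultimately show ?thesis using hk by (simp add: act_X_proj)
qed

end

theorem proposition1p17:
  fixes A :: "int^'n^'n"
  assumes "gcm A" and "gcm_irreducible A" and "symmetrizable A"
    and "\<not> spherical A" and "\<not> affine_type A"
  shows "(\<forall>x \<in> X_bar A. \<forall>y \<in> X_bar A. (x, y) \<in> causal_preorder A) \<or>
         partial_order_on (X_bar A) (causal_preorder A)"
proof -
  interpret kac_moody A by unfold_locales (rule assms(1))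
  have pre: "preorder_on (X_bar A) (causal_preorder A)"
    unfolding preorder_on_def
  proof (intro conjI)
    show "causal_preorder A \<subseteq> X_bar A \<times> X_bar A" by (auto simp: causal_preorder_def)
    show "refl_on (X_bar A) (causal_preorder A)"
      by (auto simp: refl_on_def causal_preorder_def causally_precedes_def)
    show "trans (causal_preorder A)"
      by (rule transI) (auto simp: causal_preorder_def intro: causally_precedes_trans)
  qed
  show ?thesis
  proof (cases "antisym (causal_preorder A)")
    case True
    with pre show ?thesis by (simp add: partial_order_on_def)
  next
    case False
    then obtain x y where xy: "causally_precedes A x y" "causally_precedes A y x" "x \<noteq> y"
      by (auto simp: antisym_def causal_preorder_def)
    obtain p where p: "p \<in> causal_cone A x" "causally_precedes A p y"
      using xy(1,3) by (rule causal_first_step)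
    obtain g v where "p = X_proj A (g \<otimes>\<^bsub>KM_bar A\<^esub> km_exp A v)" "g \<in> carrier (KM_bar A)"
      "X_proj A g = x" "v \<in> open_cone A"
      using p(1) unfolding causal_cone_eq by blast
    then have "causally_precedes A u w" if "u \<in> X_bar A" "w \<in> X_bar A" for u w
      using closed_causal_loop_imp_trivial[of g v u w] causally_precedes_trans[OF p(2) xy(2)] that by simp
    then show ?thesis by (auto simp: causal_preorder_def)
  qed
qed

end
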